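(* Let $x,y$ be distinct singular moduli, and assume that $|\Delta_x|\ge|\Delta_y|$. Then $$|x-y|\ge\min\{800|\Delta_y|^{-4},\ 20000|\Delta_x|^{-1}|\Delta_y|^{-3},\ 700|\Delta_x|^{-3}\}.$$
   Context: A singular modulus is the $j$-invariant of an elliptic curve over $\mathbb{C}$ with complex multiplication; equivalently, a number $j(\tau)$ with $\tau$ an imaginary quadratic number in the upper half-plane, where $j$ is Klein's modular invariant. For a singular modulus $x$, $\Delta_x$ denotes the discriminant of the associated imaginary quadratic order (negative, $\equiv 0,1\pmod 4$). *)

theory Defs
  imports "HOL-Analysis.Analysis"
begin

definition int_span2 :: "complex \<Rightarrow> complex \<Rightarrow> complex set" where
  "int_span2 \<omega>1 \<omega>2 = {of_int m * \<omega>1 + of_int n * \<omega>2 | m n. True}"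

text \<open>
  The Weierstrass invariants \<open>g2\<close>, \<open>g3\<close> and the j-invariant of a lattice in the complex plane.
  The sums converge absolutely for a lattice, so the unordered sum is the classical one; the
  normalisation gives \<open>j(\<i>) = 1728\<close>.
\<close>

definition g2 :: "complex set \<Rightarrow> complex" where
  "g2 L = 60 * (\<Sum>\<^sub>\<infinity>\<omega>\<in>L - {0}. 1 / \<omega> ^ 4)"

definition g3 :: "complex set \<Rightarrow> complex" where
  "g3 L = 140 * (\<Sum>\<^sub>\<infinity>\<omega>\<in>L - {0}. 1 / \<omega> ^ 6)"

definition lattice_j :: "complex set \<Rightarrow> complex" where
  "lattice_j L = 1728 * g2 L ^ 3 / (g2 L ^ 3 - 27 * g3 L ^ 2)"

definition klein_j :: "complex \<Rightarrow> complex" where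
  "klein_j \<tau> = lattice_j (int_span2 1 \<tau>)"

definition imaginary_quadratic :: "complex \<Rightarrow> bool" where
  "imaginary_quadratic \<tau> \<longleftrightarrow> \<tau> \<notin> \<real> \<and>
     (\<exists>a b c :: int. a \<noteq> 0 \<and> of_int a * \<tau>\<^sup>2 + of_int b * \<tau> + of_int c = 0)"

text \<open>
  The order attached to \<open>\<tau>\<close> is the ring of multipliers of the lattice spanned by \<open>1\<close> and \<open>\<tau>\<close>,
  that is, the endomorphism ring of the corresponding elliptic curve.
\<close>

definition multiplier_ring :: "complex set \<Rightarrow> complex set" where
  "multiplier_ring L = {\<alpha>. \<forall>\<omega>\<in>L. \<alpha> * \<omega> \<in> L}"

text \<open>
  The discriminant of an imaginary quadratic order with integral basis \<open>\<omega>1\<close>, \<open>\<omega>2\<close>: the square of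
  the determinant of the conjugates of the basis, where complex conjugation is the non-trivial
  automorphism of the field.
\<close>

definition order_has_discriminant :: "complex set \<Rightarrow> int \<Rightarrow> bool" where
  "order_has_discriminant R D \<longleftrightarrow>
     (\<exists>\<omega>1 \<omega>2. R = int_span2 \<omega>1 \<omega>2 \<and>
        (\<forall>m n :: int. of_int m * \<omega>1 + of_int n * \<omega>2 = 0 \<longrightarrow> m = 0 \<and> n = 0) \<and>
        of_int D = (\<omega>1 * cnj \<omega>2 - \<omega>2 * cnj \<omega>1)\<^sup>2)"

text \<open>
  \<open>x\<close> is a singular modulus and \<open>D\<close> is its discriminant.  Since \<open>x\<close> determines the lattice up to
  homothety, and homothetic lattices have the same multiplier ring, \<open>D\<close> is determined by \<open>x\<close>.
\<close>

definition singular_modulus :: "complex \<Rightarrow> int \<Rightarrow> bool" where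
  "singular_modulus x D \<longleftrightarrow>
     (\<exists>\<tau>. Im \<tau> > 0 \<and> imaginary_quadratic \<tau> \<and> x = klein_j \<tau> \<and>
          order_has_discriminant (multiplier_ring (int_span2 1 \<tau>)) D)"

end

theory Submission
  imports Defs "HOL-Complex_Analysis.Complex_Analysis"
begin

text \<open>
  No numerical estimate of \<open>j\<close> is needed: \<open>j\<close> maps the upper half plane onto the plane as a
  covering by the modular group, ramified only over 0 (order 3) and 1728 (order 2). If the disc of
  radius \<open>R\<close> around \<open>j(w)\<close> contains no critical value except possibly its centre, the inverse branch
  of \<open>j\<close> through \<open>w\<close>, after extracting an \<open>n\<close>-th root with \<open>n\<close> the ramification order, maps a disc
  into the half plane, and the Schwarz lemma gives
  \<open>\<bar>x - j(w)\<bar> \<ge> R (\<bar>z - w\<bar> / \<bar>z - cnj w\<bar>) ^ n\<close> for some \<open>z\<close> with \<open>j(z) = x\<close>. For CM points of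
  discriminants \<open>- X\<close>, \<open>- Y\<close> the hyperbolic distance satisfies
  \<open>(\<bar>z - w\<bar> / \<bar>z - cnj w\<bar>)\<^sup>2 \<ge> 1 / (X Y + 2)\<close>. Taking \<open>w\<close> over 0 and 1728 bounds \<open>\<bar>y\<bar>\<close> and
  \<open>\<bar>y - 1728\<bar>\<close> from below; taking \<open>w\<close> over \<open>y\<close> then yields \<open>\<bar>x - y\<bar> \<ge> 700 / X\<^sup>3\<close>, the third
  term of the minimum.
\<close>

text \<open>The Schwarz lemma yields only some \<open>z\<close> over \<open>x\<close>, not the given
  CM point. The distance bound must therefore apply to every point over \<open>x\<close>: equal
  \<open>j\<close> has to force modular equivalence, and equivalence has to preserve the
  discriminant. This is why the theory of \<open>j\<close> is built on the Weierstrass function,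
  whose differential equation recovers a lattice from \<open>g2\<close> and \<open>g3\<close>. The
  two critical values are 1728 apart, whence the radius 1728 for the discs around them. Let
  \<open>R\<close> be the distance from \<open>y\<close> to the nearer one. Then 1728^2 <= R^2 (3 Y
  + 2)^3 or 1728^2 <= R^2 (4 Y + 2)^2, and R^2 <= |x - y|^2 (X Y + 2). As Y <= X, this bounds |x -
  y| below by a multiple of X^(-5/2), and the spare factor sqrt X absorbs the constants once X >= 7.
  The discriminants -3 and -4 occur only at the critical values; for \<open>y\<close> there, the
  bound around that value applies to \<open>x\<close> directly. All estimates stay squared, because
  the hyperbolic distance is controlled through its square.\<close>

section \<open>Unordered sums of holomorphic functions and Taylor remainders\<close>

lemma higher_deriv_finite_sum:
  fixes f :: "'a \<Rightarrow> complex \<Rightarrow> complex"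
  assumes "finite X" "open S" "\<And>x. x \<in> X \<Longrightarrow> f x holomorphic_on S" "z \<in> S"
  shows "(deriv ^^ n) (\<lambda>y. \<Sum>x\<in>X. f x y) z = (\<Sum>x\<in>X. (deriv ^^ n) (f x) z)"
  using assms(1,3)
proof (induction X rule: finite_induct)
  case empty
  then show ?case by simp
next
  case (insert x X)
  have "(deriv ^^ n) (\<lambda>y. f x y + (\<Sum>x\<in>X. f x y)) z
      = (deriv ^^ n) (f x) z + (deriv ^^ n) (\<lambda>y. \<Sum>x\<in>X. f x y) z"
    by (rule higher_deriv_add[where S = S])
       (use insert assms in \<open>auto intro!: holomorphic_on_sum\<close>)
  then show ?case using insert by simp
qed

text \<open>The majorant \<open>M\<close> makes the finite partial sums converge uniformly on
  \<open>S\<close>, and holomorphy and all derivatives pass to uniform limits. The case n = 1 gives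
  the derivative of the Weierstrass function, general n its Laurent coefficients.\<close>

lemma holomorphic_infsum:
  fixes f :: "'a \<Rightarrow> complex \<Rightarrow> complex" and M :: "'a \<Rightarrow> real"
  assumes S: "open S"
    and hol: "\<And>x. x \<in> A \<Longrightarrow> f x holomorphic_on S"
    and le: "\<And>x z. x \<in> A \<Longrightarrow> z \<in> S \<Longrightarrow> norm (f x z) \<le> M x"
    and M: "M summable_on A"
  shows "(\<lambda>z. \<Sum>\<^sub>\<infinity>x\<in>A. f x z) holomorphic_on S"
    and "z \<in> S \<Longrightarrow> (\<lambda>x. f x z) summable_on A"
    and "z \<in> S \<Longrightarrow> ((\<lambda>x. (deriv ^^ n) (f x) z) has_sum (deriv ^^ n) (\<lambda>z. \<Sum>\<^sub>\<infinity>x\<in>A. f x z) z) A"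
proof -
  have ul: "uniform_limit S (\<lambda>X y. \<Sum>x\<in>X. f x y) (\<lambda>y. \<Sum>\<^sub>\<infinity>x\<in>A. f x y) (finite_subsets_at_top A)"
    by (rule Weierstrass_m_test_general) (use le M in auto)
  have holX: "(\<lambda>y. \<Sum>x\<in>X. f x y) holomorphic_on S" if "X \<subseteq> A" for X
    using that hol by (auto intro!: holomorphic_on_sum)
  have ev: "\<forall>\<^sub>F X in finite_subsets_at_top A. (\<lambda>y. \<Sum>x\<in>X. f x y) holomorphic_on S"
    by (rule eventually_finite_subsets_at_top_weakI) (use holX in auto)
  have nt: "finite_subsets_at_top A \<noteq> bot" by simp
  show "(\<lambda>z. \<Sum>\<^sub>\<infinity>x\<in>A. f x z) holomorphic_on S"
    unfolding holomorphic_on_open[OF S]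
  proof
    fix z assume "z \<in> S"
    then obtain r where r: "r > 0" "cball z r \<subseteq> S"
      using S open_contains_cball by meson
    have "\<forall>\<^sub>F X in finite_subsets_at_top A. continuous_on (cball z r) (\<lambda>y. \<Sum>x\<in>X. f x y)
        \<and> (\<lambda>y. \<Sum>x\<in>X. f x y) holomorphic_on ball z r"
      using ev
    proof eventually_elim
      case (elim X)
      then show ?case
        using r ball_subset_cball by (meson holomorphic_on_imp_continuous_on holomorphic_on_subset order_trans)
    qed
    moreover have "uniform_limit (cball z r) (\<lambda>X y. \<Sum>x\<in>X. f x y) (\<lambda>y. \<Sum>\<^sub>\<infinity>x\<in>A. f x y) (finite_subsets_at_top A)"
      using ul r(2) uniform_limit_on_subset by blast
    ultimately have "(\<lambda>y. \<Sum>\<^sub>\<infinity>x\<in>A. f x y) holomorphic_on ball z r"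
      using nt by (rule holomorphic_uniform_limit)
    then show "\<exists>f'. ((\<lambda>z. \<Sum>\<^sub>\<infinity>x\<in>A. f x z) has_field_derivative f') (at z)"
      using r by (metis centre_in_ball holomorphic_on_open open_ball)
  qed
  show "(\<lambda>x. f x z) summable_on A" if "z \<in> S"
    using Infinite_Sum.abs_summable_on_comparison_test'[OF M, of "\<lambda>x. f x z"] le that
    by (blast intro: abs_summable_summable)
  assume z: "z \<in> S"
  have "((\<lambda>X. (deriv ^^ n) (\<lambda>y. \<Sum>x\<in>X. f x y) z) \<longlongrightarrow> (deriv ^^ n) (\<lambda>z. \<Sum>\<^sub>\<infinity>x\<in>A. f x z) z) (finite_subsets_at_top A)"
    by (rule higher_deriv_complex_uniform_limit[OF ul ev nt S z])
  moreover have "\<forall>\<^sub>F X in finite_subsets_at_top A.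
      (deriv ^^ n) (\<lambda>y. \<Sum>x\<in>X. f x y) z = (\<Sum>x\<in>X. (deriv ^^ n) (f x) z)"
    by (rule eventually_finite_subsets_at_top_weakI)
       (use higher_deriv_finite_sum[OF _ S _ z] hol in blast)
  ultimately show "((\<lambda>x. (deriv ^^ n) (f x) z) has_sum (deriv ^^ n) (\<lambda>z. \<Sum>\<^sub>\<infinity>x\<in>A. f x z) z) A"
    unfolding has_sum_def using tendsto_cong by fastforce
qed

text \<open>The tail of the Taylor series divided by z^N is again a power series converging on the
  same disc, so the quotient is holomorphic at 0 as well.\<close>

lemma holomorphic_taylor_remainder:
  fixes f :: "complex \<Rightarrow> complex"
  assumes f: "f holomorphic_on ball 0 r"
  obtains g :: "complex \<Rightarrow> complex" where "g holomorphic_on ball 0 r"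
    "\<And>z. z \<in> ball 0 r \<Longrightarrow> f z = (\<Sum>k<N. (deriv ^^ k) f 0 / fact k * z ^ k) + z ^ N * g z"
proof
  define c where "c k = (deriv ^^ k) f 0 / fact k" for k
  define g where "g z = (\<Sum>n. c (n + N) * z ^ n)" for z :: complex
  have sums: "(\<lambda>n. c n * z ^ n) sums f z" if "z \<in> ball 0 r" for z
    using holomorphic_power_series[OF f that] by (simp add: c_def)
  have sg: "(\<lambda>n. c (n + N) * z ^ n) sums g z" if z: "z \<in> ball 0 r" for z
  proof -
    have "summable (\<lambda>n. c (n + N) * z ^ n)"
    proof (cases "z = 0")
      case True
      then show ?thesis by (auto intro!: summable_finite[of "{0}"])
    next
      case False
      have "summable (\<lambda>n. c (n + N) * z ^ (n + N))"
        using sums[OF z] by (intro summable_ignore_initial_segment) (auto simp: sums_iff)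
      then have "summable (\<lambda>n. c (n + N) * z ^ (n + N) / z ^ N)"
        by (rule summable_divide)
      then show ?thesis using False by (simp add: power_add)
    qed
    then show ?thesis by (simp add: g_def summable_sums)
  qed
  show "g holomorphic_on ball 0 r"
    by (rule power_series_holomorphic[where a = "\<lambda>n. c (n + N)"]) (use sg in auto)
  fix z :: complex assume z: "z \<in> ball 0 r"
  have "(\<lambda>n. c (n + N) * z ^ (n + N)) sums (f z - (\<Sum>k<N. c k * z ^ k))"
    using sums_split_initial_segment[OF sums[OF z]] .
  moreover have "(\<lambda>n. c (n + N) * z ^ (n + N)) sums (z ^ N * g z)"
    using sums_mult[OF sg[OF z], of "z ^ N"] by (simp add: power_add mult_ac)
  ultimately have "f z - (\<Sum>k<N. c k * z ^ k) = z ^ N * g z"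
    by (rule sums_unique2)
  then show "f z = (\<Sum>k<N. (deriv ^^ k) f 0 / fact k * z ^ k) + z ^ N * g z"
    by (simp add: c_def algebra_simps)
qed

lemma DERIV_divide_shift_power:
  fixes z w a c :: complex
  assumes "z \<noteq> w"
  shows "((\<lambda>z. a / (z - w) ^ n - c) has_field_derivative - (of_nat n * a / (z - w) ^ Suc n)) (at z)"
proof -
  have zw: "z - w \<noteq> 0" using assms by simp
  have "((\<lambda>z. (z - w) ^ n) has_field_derivative of_nat n * (z - w) ^ (n - 1)) (at z)"
    by (auto intro!: derivative_eq_intros)
  from DERIV_diff[OF DERIV_divide[OF DERIV_const[of a] this] DERIV_const[of c]]
  have "((\<lambda>z. a / (z - w) ^ n - c) has_field_derivative
      (0 * (z - w) ^ n - a * (of_nat n * (z - w) ^ (n - 1))) / ((z - w) ^ n * (z - w) ^ n) - 0) (at z)"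
    using zw by (simp only: power_not_zero not_False_eq_True)
  moreover have "(0 * (z - w) ^ n - a * (of_nat n * (z - w) ^ (n - 1))) / ((z - w) ^ n * (z - w) ^ n) - 0
      = - (of_nat n * a / (z - w) ^ Suc n)"
  proof (cases n)
    case (Suc k)
    have "(z - w) ^ k \<noteq> 0" using zw by simp
    then show ?thesis using zw unfolding Suc by (simp add: frac_eq_eq)
  qed simp
  ultimately show ?thesis by (simp only:)
qed

section \<open>The Weierstrass function of a lattice\<close>

text \<open>The axioms name no basis. They are the three facts that the analysis uses: closure under
  subtraction, convergence of the sum of |\<omega>|^(-3) (which entails discreteness), and a compact
  set meeting every coset. In this form they pass easily to scaled lattices and to the union of a
  lattice with a half period translate.\<close>

locale complex_lattice =
  fixes L :: "complex set"
  assumes zero_mem: "0 \<in> L"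
    and diff_mem: "\<And>a b. a \<in> L \<Longrightarrow> b \<in> L \<Longrightarrow> a - b \<in> L"
    and summable_cube: "(\<lambda>\<omega>. 1 / norm \<omega> ^ 3) summable_on (L - {0})"
    and cocompact: "\<exists>K. compact K \<and> (\<forall>z. \<exists>\<omega>\<in>L. z - \<omega> \<in> K)"
begin

lemma uminus_mem: "a \<in> L \<Longrightarrow> - a \<in> L"
  using diff_mem[OF zero_mem, of a] by simp

lemma add_mem: "a \<in> L \<Longrightarrow> b \<in> L \<Longrightarrow> a + b \<in> L"
  using diff_mem[of a "- b"] uminus_mem[of b] by simp

text \<open>Every nonzero point of norm at most \<open>B'\<close> contributes at least 1 / B'^3 to a
  convergent sum, which bounds the size of all finite sets of such points.\<close>

lemma finite_bounded: "finite {\<omega> \<in> L. norm \<omega> \<le> B}"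
proof -
  define T where "T = infsum (\<lambda>\<omega>. 1 / norm \<omega> ^ 3) (L - {0})"
  define B' where "B' = max B 1"
  have "card F \<le> nat \<lfloor>B' ^ 3 * T\<rfloor>" if F: "F \<subseteq> {\<omega> \<in> L - {0}. norm \<omega> \<le> B'}" "finite F" for F
  proof -
    have "card F * (1 / B' ^ 3) \<le> (\<Sum>\<omega>\<in>F. 1 / norm \<omega> ^ 3)"
    proof (rule sum_bounded_below[where A = F and K = "1 / B' ^ 3"])
      fix \<omega> assume "\<omega> \<in> F"
      then have "0 < norm \<omega>" "norm \<omega> \<le> B'" using F by auto
      then show "1 / B' ^ 3 \<le> 1 / norm \<omega> ^ 3"
        by (intro divide_left_mono power_mono mult_pos_pos) (auto simp: B'_def)
    qed
    also have "\<dots> \<le> T" unfolding T_def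
      by (rule finite_sum_le_infsum) (use F summable_cube in auto)
    finally have "real (card F) \<le> B' ^ 3 * T"
      by (simp add: B'_def field_simps)
    then show ?thesis by (simp add: le_nat_iff le_floor_iff)
  qed
  then have "finite {\<omega> \<in> L - {0}. norm \<omega> \<le> B'}"
    by (intro finite_if_finite_subsets_card_bdd[THEN conjunct1]) blast
  then have "finite (insert 0 {\<omega> \<in> L - {0}. norm \<omega> \<le> B'})" by simp
  then show ?thesis by (rule rev_finite_subset) (auto simp: B'_def)
qed

lemma countable: "countable L"
proof -
  have "L = (\<Union>n::nat. {\<omega> \<in> L. norm \<omega> \<le> n})"
    using real_arch_simple by auto
  moreover have "countable \<dots>"
    by (intro countable_UN) (auto intro: countable_finite finite_bounded)
  ultimately show ?thesis by simp
qed

lemma isolated: "\<exists>e>0. \<forall>\<omega>\<in>L. \<omega> \<noteq> z \<longrightarrow> e \<le> norm (\<omega> - z)"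
proof -
  let ?F = "{\<omega> \<in> L. norm \<omega> \<le> norm z + 1}"
  obtain d where d: "d > 0" "\<forall>x\<in>?F. x \<noteq> z \<longrightarrow> d \<le> dist z x"
    using finite_set_avoid[OF finite_bounded] by blast
  show ?thesis
  proof (intro exI[of _ "min d 1"] conjI ballI impI)
    fix \<omega> assume w: "\<omega> \<in> L" "\<omega> \<noteq> z"
    show "min d 1 \<le> norm (\<omega> - z)"
    proof (cases "\<omega> \<in> ?F")
      case True
      then show ?thesis using d w by (auto simp: dist_norm norm_minus_commute min_le_iff_disj)
    next
      case False
      then show ?thesis using w norm_triangle_ineq2[of \<omega> z] by auto
    qed
  qed (use d in auto)
qed

lemma closed: "closed L"
  unfolding closed_def open_contains_ball
proof
  fix z assume "z \<in> - L"
  moreover obtain e where "e > 0" "\<forall>\<omega>\<in>L. \<omega> \<noteq> z \<longrightarrow> e \<le> norm (\<omega> - z)"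
    using isolated by blast
  ultimately have "ball z e \<subseteq> - L"
    by (auto simp: dist_norm norm_minus_commute not_le[symmetric])
  with \<open>e > 0\<close> show "\<exists>e>0. ball z e \<subseteq> - L" by blast
qed

lemma open_compl: "open (- L)"
  using closed by auto

definition wp :: "complex \<Rightarrow> complex" where
  "wp z = 1 / z\<^sup>2 + (\<Sum>\<^sub>\<infinity>\<omega>\<in>L - {0}. 1 / (z - \<omega>)\<^sup>2 - 1 / \<omega>\<^sup>2)"

text \<open>The difference equals z (2 \<omega> - z) / (\<omega>^2 (z - \<omega>)^2). The constant
  10 comes from |2 \<omega> - z| <= 5/2 |\<omega>| and |z - \<omega>| >= |\<omega>| / 2.\<close>

lemma wp_term_bound:
  fixes z \<omega> :: complex
  assumes "norm z < B" "2 * B < norm \<omega>"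
  shows "norm (1 / (z - \<omega>)\<^sup>2 - 1 / \<omega>\<^sup>2) \<le> 10 * B * (1 / norm \<omega> ^ 3)"
proof -
  have B: "B > 0" using assms(1) norm_ge_zero[of z] by linarith
  define m where "m = norm \<omega>"
  have m: "m > 0" "2 * B < m" using assms B by (auto simp: m_def)
  have zw: "m / 2 \<le> norm (z - \<omega>)"
    using norm_triangle_ineq2[of \<omega> z] assms by (simp add: m_def norm_minus_commute)
  have nz: "z \<noteq> \<omega>" "\<omega> \<noteq> 0" using m zw by (auto simp: m_def)
  have "1 / (z - \<omega>)\<^sup>2 - 1 / \<omega>\<^sup>2 = z * (2 * \<omega> - z) / (\<omega>\<^sup>2 * (z - \<omega>)\<^sup>2)"
    using nz by (simp add: divide_simps) (simp add: algebra_simps power2_eq_square)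
  also have "norm \<dots> = norm z * norm (2 * \<omega> - z) / (m\<^sup>2 * (norm (z - \<omega>))\<^sup>2)"
    by (simp add: norm_mult norm_divide norm_power m_def)
  also have "\<dots> \<le> B * (5 / 2 * m) / (m\<^sup>2 * (m / 2)\<^sup>2)"
  proof (intro frac_le mult_mono mult_left_mono power_mono)
    show "norm (2 * \<omega> - z) \<le> 5 / 2 * m"
      using norm_triangle_ineq4[of "2 * \<omega>" z] assms by (simp add: m_def norm_mult)
  qed (use assms zw m B in auto)
  also have "\<dots> = 10 * B * (1 / m ^ 3)"
    using m by (simp add: field_simps power2_eq_square power3_eq_cube)
  finally show ?thesis by (simp add: m_def)
qed

text \<open>For |z| < B the finitely many terms from \<open>near B\<close> carry all the poles other
  than the one at 0, while those from \<open>far B\<close> have a common summable majorant. The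
  factor 2 keeps |z - \<omega>| above |\<omega>| / 2 on the far part.\<close>

definition near :: "real \<Rightarrow> complex set" where
  "near B = {\<omega> \<in> L - {0}. norm \<omega> \<le> 2 * B}"

definition far :: "real \<Rightarrow> complex set" where
  "far B = {\<omega> \<in> L - {0}. norm \<omega> > 2 * B}"

lemma near_far: "L - {0} = near B \<union> far B" "near B \<inter> far B = {}"
  by (auto simp: near_def far_def)

lemma finite_near: "finite (near B)"
  unfolding near_def by (rule rev_finite_subset[OF finite_bounded[of "2 * B"]]) auto

lemma far_sum:
  fixes B :: real
  defines "f \<equiv> \<lambda>\<omega> z. 1 / (z - \<omega>)\<^sup>2 - 1 / \<omega>\<^sup>2"
  shows "(\<lambda>z. \<Sum>\<^sub>\<infinity>\<omega>\<in>far B. f \<omega> z) holomorphic_on ball 0 B"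
    and "z \<in> ball 0 B \<Longrightarrow> (\<lambda>\<omega>. f \<omega> z) summable_on far B"
    and "z \<in> ball 0 B \<Longrightarrow> ((\<lambda>\<omega>. (deriv ^^ n) (f \<omega>) z) has_sum
           (deriv ^^ n) (\<lambda>z. \<Sum>\<^sub>\<infinity>\<omega>\<in>far B. f \<omega> z) z) (far B)"
proof -
  have hol: "f \<omega> holomorphic_on ball 0 B" if "\<omega> \<in> far B" for \<omega>
  proof -
    have "z - \<omega> \<noteq> 0" if "z \<in> ball 0 B" for z
    proof
      assume "z - \<omega> = 0"
      then have "norm \<omega> < B" using that by auto
      moreover have "2 * B < norm \<omega>" using \<open>\<omega> \<in> far B\<close> by (auto simp: far_def)
      moreover have "norm \<omega> \<ge> 0" by simp
      ultimately show False by linarith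
    qed
    then show ?thesis unfolding f_def by (intro holomorphic_intros) auto
  qed
  have le: "norm (f \<omega> z) \<le> 10 * B * (1 / norm \<omega> ^ 3)" if "\<omega> \<in> far B" "z \<in> ball 0 B" for \<omega> z
    using wp_term_bound[of z B \<omega>] that by (auto simp: f_def far_def)
  have "(\<lambda>\<omega>. 1 / norm \<omega> ^ 3) summable_on far B"
    by (rule summable_on_subset_banach[OF summable_cube]) (auto simp: far_def)
  then have M: "(\<lambda>\<omega>. 10 * B * (1 / norm \<omega> ^ 3)) summable_on far B"
    by (rule summable_on_cmult_right)
  note * = holomorphic_infsum[OF open_ball hol le M]
  show "(\<lambda>z. \<Sum>\<^sub>\<infinity>\<omega>\<in>far B. f \<omega> z) holomorphic_on ball 0 B" using *(1) by blast
  show "z \<in> ball 0 B \<Longrightarrow> (\<lambda>\<omega>. f \<omega> z) summable_on far B" using *(2) by blast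
  show "z \<in> ball 0 B \<Longrightarrow> ((\<lambda>\<omega>. (deriv ^^ n) (f \<omega>) z) has_sum
           (deriv ^^ n) (\<lambda>z. \<Sum>\<^sub>\<infinity>\<omega>\<in>far B. f \<omega> z) z) (far B)" using *(3) by blast
qed

lemma wp_decomp:
  assumes "z \<in> ball 0 B"
  shows "wp z = 1 / z\<^sup>2 + (\<Sum>\<omega>\<in>near B. 1 / (z - \<omega>)\<^sup>2 - 1 / \<omega>\<^sup>2)
     + (\<Sum>\<^sub>\<infinity>\<omega>\<in>far B. 1 / (z - \<omega>)\<^sup>2 - 1 / \<omega>\<^sup>2)"
proof -
  have "(\<Sum>\<^sub>\<infinity>\<omega>\<in>L - {0}. 1 / (z - \<omega>)\<^sup>2 - 1 / \<omega>\<^sup>2)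
     = (\<Sum>\<omega>\<in>near B. 1 / (z - \<omega>)\<^sup>2 - 1 / \<omega>\<^sup>2) + (\<Sum>\<^sub>\<infinity>\<omega>\<in>far B. 1 / (z - \<omega>)\<^sup>2 - 1 / \<omega>\<^sup>2)"
    unfolding near_far(1)[of B]
  proof (subst infsum_Un_disjoint)
    show "(\<lambda>\<omega>. 1 / (z - \<omega>)\<^sup>2 - 1 / \<omega>\<^sup>2) summable_on near B"
      by (rule summable_on_finite) (rule finite_near)
  qed (simp_all only: far_sum(2)[OF assms] near_far(2) infsum_finite[OF finite_near])
  then show ?thesis by (simp only: wp_def add.assoc)
qed

text \<open>After differentiation the convergence terms 1 / \<omega>^2 disappear and 1 / z^2 becomes
  the term of \<omega> = 0. The derivative is thus a sum over all of \<open>L\<close> and is visibly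
  invariant under translation.\<close>

lemma wp_has_derivative:
  assumes "z \<notin> L"
  shows "(wp has_field_derivative deriv wp z) (at z)"
    and "((\<lambda>\<omega>. - 2 / (z - \<omega>) ^ 3) has_sum deriv wp z) L"
proof -
  define B where "B = norm z + 1"
  have z: "z \<in> ball 0 B" by (simp add: B_def)
  define T where "T = (\<lambda>z. \<Sum>\<^sub>\<infinity>\<omega>\<in>far B. 1 / (z - \<omega>)\<^sup>2 - 1 / \<omega>\<^sup>2)"
  define D where "D = - 2 / z ^ 3 + (\<Sum>\<omega>\<in>near B. - 2 / (z - \<omega>) ^ 3) + deriv T z"
  have nz: "z \<noteq> 0" "\<And>\<omega>. \<omega> \<in> L \<Longrightarrow> z - \<omega> \<noteq> 0" using assms zero_mem by auto
  have d1: "((\<lambda>z. 1 / (z - \<omega>)\<^sup>2 - c) has_field_derivative - 2 / (z - \<omega>) ^ 3) (at z)"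
    if "\<omega> \<in> L" for \<omega> c
  proof -
    have "z \<noteq> \<omega>" using nz(2)[OF that] by simp
    moreover have "- (of_nat 2 * 1 / (z - \<omega>) ^ Suc 2) = - 2 / (z - \<omega>) ^ 3"
      by (simp del: power_Suc)
    ultimately show ?thesis
      using DERIV_divide_shift_power[of z \<omega> 1 2 c] by metis
  qed
  have d2: "(T has_field_derivative deriv T z) (at z)"
    by (rule holomorphic_derivI[OF far_sum(1)[of B, folded T_def] open_ball z])
  have "((\<lambda>z. 1 / z\<^sup>2 + (\<Sum>\<omega>\<in>near B. 1 / (z - \<omega>)\<^sup>2 - 1 / \<omega>\<^sup>2) + T z) has_field_derivative D) (at z)"
  proof -
    have **: "((\<lambda>z. 1 / z\<^sup>2) has_field_derivative - 2 / z ^ 3) (at z)"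
      using d1[OF zero_mem, of 0] by (simp only: diff_zero)
    have "((\<lambda>z. \<Sum>\<omega>\<in>near B. 1 / (z - \<omega>)\<^sup>2 - 1 / \<omega>\<^sup>2) has_field_derivative
        (\<Sum>\<omega>\<in>near B. - 2 / (z - \<omega>) ^ 3)) (at z)"
    proof (rule DERIV_sum)
      fix \<omega> assume "\<omega> \<in> near B"
      then have "\<omega> \<in> L" by (simp add: near_def)
      then show "((\<lambda>z. 1 / (z - \<omega>)\<^sup>2 - 1 / \<omega>\<^sup>2) has_field_derivative - 2 / (z - \<omega>) ^ 3) (at z)"
        by (rule d1)
    qed
    from DERIV_add[OF DERIV_add[OF ** this] d2] show ?thesis unfolding D_def .
  qed
  then have wpD: "(wp has_field_derivative D) (at z)"
  proof (rule has_field_derivative_transform_within_open)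
    show "\<And>w. w \<in> ball 0 B \<Longrightarrow> 1 / w\<^sup>2 + (\<Sum>\<omega>\<in>near B. 1 / (w - \<omega>)\<^sup>2 - 1 / \<omega>\<^sup>2) + T w = wp w"
      unfolding T_def by (rule wp_decomp[symmetric])
  qed (use z in auto)
  then have D: "deriv wp z = D" by (rule DERIV_imp_deriv)
  with wpD show "(wp has_field_derivative deriv wp z) (at z)" by simp
  have "((\<lambda>\<omega>. deriv (\<lambda>z. 1 / (z - \<omega>)\<^sup>2 - 1 / \<omega>\<^sup>2) z) has_sum deriv T z) (far B)"
    using far_sum(3)[OF z, of 1, folded T_def] by (simp only: funpow_0 funpow.simps One_nat_def o_def id_def)
  moreover have "deriv (\<lambda>z. 1 / (z - \<omega>)\<^sup>2 - 1 / \<omega>\<^sup>2) z = - 2 / (z - \<omega>) ^ 3" if "\<omega> \<in> far B" for \<omega>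
  proof (rule DERIV_imp_deriv, rule d1)
    show "\<omega> \<in> L" using that by (simp add: far_def)
  qed
  ultimately have far: "((\<lambda>\<omega>. - 2 / (z - \<omega>) ^ 3) has_sum deriv T z) (far B)"
    by (simp only: cong: has_sum_cong)
  have *: "((\<lambda>\<omega>. - 2 / (z - \<omega>) ^ 3) has_sum
      (- 2 / (z - 0) ^ 3 + (\<Sum>\<omega>\<in>near B. - 2 / (z - \<omega>) ^ 3))) (insert 0 (near B))"
  proof -
    have "0 \<notin> near B" by (simp add: near_def)
    then have sum_eq: "(\<Sum>\<omega>\<in>insert 0 (near B). - 2 / (z - \<omega>) ^ 3) = - 2 / (z - 0) ^ 3 + (\<Sum>\<omega>\<in>near B. - 2 / (z - \<omega>) ^ 3)"
      by (rule sum.insert[OF finite_near])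
    have "finite (insert 0 (near B))" by (simp add: finite_near)
    from has_sum_finite[OF this, of "\<lambda>\<omega>. - 2 / (z - \<omega>) ^ 3"] show ?thesis
      unfolding sum_eq .
  qed
  have eq: "insert 0 (near B) \<union> far B = L"
    using near_far(1)[of B] zero_mem by auto
  have "((\<lambda>\<omega>. - 2 / (z - \<omega>) ^ 3) has_sum D) (insert 0 (near B) \<union> far B)"
  proof -
    have "insert 0 (near B) \<inter> far B = {}" using near_far(2)[of B] by (auto simp: far_def)
    from has_sum_Un_disjoint[OF * far this] show ?thesis by (simp only: D_def diff_zero)
  qed
  then show "((\<lambda>\<omega>. - 2 / (z - \<omega>) ^ 3) has_sum deriv wp z) L"
    unfolding D eq .
qed

lemma wp_holomorphic: "wp holomorphic_on (- L)"
  unfolding holomorphic_on_open[OF open_compl] using wp_has_derivative(1) by auto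

lemma wp_even: "wp (- z) = wp z"
proof -
  have "(\<Sum>\<^sub>\<infinity>\<omega>\<in>L - {0}. 1 / (- z - \<omega>)\<^sup>2 - 1 / \<omega>\<^sup>2) = (\<Sum>\<^sub>\<infinity>\<omega>\<in>L - {0}. 1 / (z - \<omega>)\<^sup>2 - 1 / \<omega>\<^sup>2)"
    by (rule infsum_reindex_bij_witness[where i = uminus and j = uminus])
       (use uminus_mem in \<open>auto simp: power2_eq_square algebra_simps\<close>)
  then show ?thesis by (simp add: wp_def)
qed

lemma add_mem_iff: "\<omega> \<in> L \<Longrightarrow> z + \<omega> \<in> L \<longleftrightarrow> z \<in> L"
  using add_mem diff_mem by (metis add_diff_cancel_right')

lemma wp'_periodic:
  assumes "\<omega> \<in> L" "z \<notin> L"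
  shows "deriv wp (z + \<omega>) = deriv wp z"
proof -
  have "((\<lambda>\<nu>. - 2 / (z + \<omega> - \<nu>) ^ 3) has_sum deriv wp (z + \<omega>)) L"
    using assms by (intro wp_has_derivative) (simp add: add_mem_iff)
  also have "?this \<longleftrightarrow> ((\<lambda>\<nu>. - 2 / (z - \<nu>) ^ 3) has_sum deriv wp (z + \<omega>)) L"
    by (rule has_sum_reindex_bij_witness[where i = "\<lambda>\<nu>. \<nu> + \<omega>" and j = "\<lambda>\<nu>. \<nu> - \<omega>"])
       (use add_mem diff_mem assms in \<open>auto simp: algebra_simps\<close>)
  finally show ?thesis
    using wp_has_derivative(2)[OF assms(2)] has_sum_unique by blast
qed

lemma connected_compl: "connected (- L)"
  using connected_open_diff_countable[of "UNIV :: complex set" L] countable connected_UNIV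
  by (simp add: Compl_eq_Diff_UNIV)

text \<open>The difference of the two sides has derivative zero on a connected set, so it is a
  constant c. Evenness then gives c = - c.\<close>

lemma wp_periodic:
  assumes w: "\<omega> \<in> L" and z: "z \<notin> L"
  shows "wp (z + \<omega>) = wp z"
proof -
  have "((\<lambda>z. wp (z + \<omega>) - wp z) has_field_derivative 0) (at z)" if "z \<in> - L" for z
  proof -
    have zl: "z \<notin> L" using that by simp
    have "((\<lambda>z. wp (z + \<omega>)) has_field_derivative deriv wp (z + \<omega>)) (at z)"
      using wp_has_derivative(1)[of "z + \<omega>"] zl w
      by (simp add: add_mem_iff DERIV_shift)
    from DERIV_diff[OF this wp_has_derivative(1)[OF zl]]
    show "((\<lambda>z. wp (z + \<omega>) - wp z) has_field_derivative 0) (at z)"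
      using wp'_periodic[OF w zl] by simp
  qed
  then have "(\<lambda>z. wp (z + \<omega>) - wp z) constant_on (- L)"
    by (rule has_field_derivative_0_imp_constant_on) (use connected_compl open_compl in auto)
  then obtain c where c: "\<And>z. z \<in> - L \<Longrightarrow> wp (z + \<omega>) - wp z = c"
    unfolding constant_on_def by blast
  \<comment> \<open>The point - z - \<omega> replaces the customary - \<omega> / 2, which may lie in
    \<open>L\<close>. Evenness turns its difference into the negative of the one at
    \<open>z\<close>.\<close>
  have "- z - \<omega> \<in> - L" 
    using z w add_mem_iff[of \<omega> "- z - \<omega>"] uminus_mem[of "-z"] by auto
  from c[OF this] have "wp z - wp (z + \<omega>) = c"
    using wp_even[of z] wp_even[of "z + \<omega>"] by simp
  moreover have "wp (z + \<omega>) - wp z = c" using c z by simp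
  ultimately show ?thesis by (simp add: algebra_simps) 
qed

text \<open>The Taylor coefficients at 0 of the part without the pole are, up to factorials, the
  lattice sums in \<open>g2\<close> and \<open>g3\<close>.\<close>

lemma wp_regular_part:
  obtains r p where "r > 0" "p holomorphic_on ball 0 r" "ball 0 r \<inter> L = {0}"
    "\<And>z. z \<in> ball 0 r \<Longrightarrow> wp z = 1 / z\<^sup>2 + p z"
    "p 0 = 0"
    "\<And>n. n > 0 \<Longrightarrow> ((\<lambda>\<omega>. fact (Suc n) / \<omega> ^ (n + 2)) has_sum (deriv ^^ n) p 0) (L - {0})"
proof -
  obtain e where e: "e > 0" "\<forall>\<omega>\<in>L. \<omega> \<noteq> 0 \<longrightarrow> e \<le> norm (\<omega> - 0)"
    using isolated by blast
  \<comment> \<open>All nonzero lattice points have norm at least \<open>e\<close> > 2 r, so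
    \<open>near r\<close> is empty and the far sum is the whole sum.\<close>
  define r where "r = e / 3"
  have r: "r > 0" using e by (simp add: r_def)
  have far: "far r = L - {0}" using e by (force simp: far_def r_def)
  have near: "near r = {}" using e by (force simp: near_def r_def)
  define p where "p = (\<lambda>z. \<Sum>\<^sub>\<infinity>\<omega>\<in>L - {0}. 1 / (z - \<omega>)\<^sup>2 - 1 / \<omega>\<^sup>2)"
  have hol: "p holomorphic_on ball 0 r" using far_sum(1)[of r] by (simp add: p_def far)
  have der: "(deriv ^^ n) (\<lambda>z. 1 / (z - \<omega>)\<^sup>2 - 1 / \<omega>\<^sup>2) z
      = (-1) ^ n * fact (Suc n) / (z - \<omega>) ^ (n + 2) - (if n = 0 then 1 / \<omega>\<^sup>2 else 0)"
    if "z \<noteq> \<omega>" for n and \<omega> z :: complex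
    using that
  proof (induction n arbitrary: z)
    case 0
    show ?case by (simp add: power2_eq_square)
  next
    case (Suc n)
    define c where "c = (if n = 0 then 1 / \<omega>\<^sup>2 else 0)"
    have "- (of_nat (n + 2) * ((-1) ^ n * fact (Suc n)) / (z - \<omega>) ^ Suc (n + 2))
        = (-1) ^ Suc n * fact (Suc (Suc n)) / (z - \<omega>) ^ (Suc n + 2)"
      by (simp add: fact_Suc[of "Suc n"] del: fact_Suc power_Suc) (simp add: power2_eq_square)
    with DERIV_divide_shift_power[OF Suc.prems, of "(-1) ^ n * fact (Suc n)" "n + 2" c]
    have "deriv (\<lambda>z. (-1) ^ n * fact (Suc n) / (z - \<omega>) ^ (n + 2) - c) z
        = (-1) ^ Suc n * fact (Suc (Suc n)) / (z - \<omega>) ^ (Suc n + 2)"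
      by (metis DERIV_imp_deriv)
    moreover have "deriv ((deriv ^^ n) (\<lambda>z. 1 / (z - \<omega>)\<^sup>2 - 1 / \<omega>\<^sup>2)) z
        = deriv (\<lambda>z. (-1) ^ n * fact (Suc n) / (z - \<omega>) ^ (n + 2) - c) z"
    proof (rule deriv_cong_ev)
      have "\<forall>\<^sub>F z in nhds z. z \<in> - {\<omega>}"
        by (rule eventually_nhds_in_open) (use Suc.prems in auto)
      then show "\<forall>\<^sub>F z in nhds z. (deriv ^^ n) (\<lambda>z. 1 / (z - \<omega>)\<^sup>2 - 1 / \<omega>\<^sup>2) z
          = (-1) ^ n * fact (Suc n) / (z - \<omega>) ^ (n + 2) - c"
        by eventually_elim (use Suc.IH in \<open>auto simp: c_def\<close>)
    qed simp
    ultimately show ?case by simp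
  qed
  show ?thesis
  proof (rule that[OF r hol])
    show "ball 0 r \<inter> L = {0}" using e r zero_mem by (force simp: r_def)
    \<comment> \<open>This includes z = 0, where 1 / 0 = 0 by convention.\<close>
    show "wp z = 1 / z\<^sup>2 + p z" for z by (simp add: wp_def p_def)
    show "p 0 = 0" by (simp add: p_def)
    fix n :: nat assume n: "n > 0"
    have "((\<lambda>\<omega>. (deriv ^^ n) (\<lambda>z. 1 / (z - \<omega>)\<^sup>2 - 1 / \<omega>\<^sup>2) 0) has_sum (deriv ^^ n) p 0) (L - {0})"
      using far_sum(3)[of 0 r n] r by (simp add: far p_def)
    also have "?this \<longleftrightarrow> ((\<lambda>\<omega>. fact (Suc n) / \<omega> ^ (n + 2)) has_sum (deriv ^^ n) p 0) (L - {0})"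
    proof (rule has_sum_cong)
      fix \<omega> assume "\<omega> \<in> L - {0}"
      moreover have "(- \<omega>) ^ (n + 2) = (-1) ^ n * \<omega> ^ (n + 2)"
        by (subst power_minus) simp
      ultimately show "(deriv ^^ n) (\<lambda>z. 1 / (z - \<omega>)\<^sup>2 - 1 / \<omega>\<^sup>2) 0 = fact (Suc n) / \<omega> ^ (n + 2)"
        using n by (subst der) (auto simp: field_simps)
    qed
    finally show "((\<lambda>\<omega>. fact (Suc n) / \<omega> ^ (n + 2)) has_sum (deriv ^^ n) p 0) (L - {0})" .
  qed
qed

lemma odd_sum_zero:
  assumes "((\<lambda>\<omega>. c / \<omega> ^ k) has_sum s) (L - {0})" "odd k"
  shows "s = 0"
proof -
  have "((\<lambda>\<omega>. c / \<omega> ^ k) has_sum s) (L - {0}) \<longleftrightarrow> ((\<lambda>\<omega>. - (c / \<omega> ^ k)) has_sum s) (L - {0})"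
    by (rule has_sum_reindex_bij_witness[where i = uminus and j = uminus])
       (use uminus_mem assms(2) in auto)
  with assms(1) have "((\<lambda>\<omega>. - (c / \<omega> ^ k)) has_sum s) (L - {0})" by simp
  then have "((\<lambda>\<omega>. c / \<omega> ^ k) has_sum - s) (L - {0})"
    by (simp only: has_sum_uminus)
  then have "- s = s" by (rule has_sum_unique[OF _ assms(1)])
  then show ?thesis by simp
qed

text \<open>Odd coefficients vanish by symmetry. The coefficient of z^2 is 3!/2! = 3 times the sum
  of \<omega>^(-4), and 60 / 20 = 3; that of z^4 is 5!/4! = 5 times the sum of \<omega>^(-6), and
  140 / 28 = 5.\<close>

lemma wp_laurent:
  obtains r p q where "r > 0" "ball 0 r \<inter> L = {0}"
    "p holomorphic_on ball 0 r" "q holomorphic_on ball 0 r"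
    "\<And>z. z \<in> ball 0 r \<Longrightarrow> wp z = 1 / z\<^sup>2 + p z" 
    "\<And>z. z \<in> ball 0 r \<Longrightarrow> p z = g2 L / 20 * z\<^sup>2 + g3 L / 28 * z ^ 4 + z ^ 5 * q z"
proof -
  obtain r p where rp: "r > 0" "p holomorphic_on ball 0 r" "ball 0 r \<inter> L = {0}"
    "\<And>z. z \<in> ball 0 r \<Longrightarrow> wp z = 1 / z\<^sup>2 + p z"
    "p 0 = 0"
    and D: "\<And>n. n > 0 \<Longrightarrow> ((\<lambda>\<omega>. fact (Suc n) / \<omega> ^ (n + 2)) has_sum (deriv ^^ n) p 0) (L - {0})"
    using wp_regular_part by blast
  obtain q where q: "q holomorphic_on ball 0 r"
    "\<And>z. z \<in> ball 0 r \<Longrightarrow> p z = (\<Sum>k<5. (deriv ^^ k) p 0 / fact k * z ^ k) + z ^ 5 * q z"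
    using holomorphic_taylor_remainder[OF rp(2), of 5] by blast
  have 1: "(deriv ^^ 1) p 0 = 0" and 3: "(deriv ^^ 3) p 0 = 0"
    using odd_sum_zero[OF D[of 1]] odd_sum_zero[OF D[of 3]] by simp_all
  have D': "(deriv ^^ n) p 0 = fact (Suc n) * (\<Sum>\<^sub>\<infinity>\<omega>\<in>L - {0}. 1 / \<omega> ^ (n + 2))" if "n > 0" for n
  proof -
    have "(deriv ^^ n) p 0 = (\<Sum>\<^sub>\<infinity>\<omega>\<in>L - {0}. fact (Suc n) * (1 / \<omega> ^ (n + 2)))"
      using infsumI[OF D[OF that]] by simp
    also have "\<dots> = fact (Suc n) * (\<Sum>\<^sub>\<infinity>\<omega>\<in>L - {0}. 1 / \<omega> ^ (n + 2))"
      by (rule infsum_cmult_right')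
    finally show ?thesis .
  qed
  have 2: "g2 L = 10 * (deriv ^^ 2) p 0" and 4: "g3 L = 7 / 6 * (deriv ^^ 4) p 0"
    using D'[of 2] D'[of 4] by (simp_all add: g2_def g3_def eval_nat_numeral fact_reduce)
  have "p z = g2 L / 20 * z\<^sup>2 + g3 L / 28 * z ^ 4 + z ^ 5 * q z" if "z \<in> ball 0 r" for z
  proof -
    have "{..<5::nat} = {0, 1, 2, 3, 4}" by auto
    then have "(\<Sum>k<5. (deriv ^^ k) p 0 / fact k * z ^ k) = g2 L / 20 * z\<^sup>2 + g3 L / 28 * z ^ 4"
      using 1 3 rp(5) unfolding 2 4 by (simp add: fact_numeral)
    then show ?thesis using q(2)[OF that] by simp
  qed
  then show ?thesis using that rp q by blast
qed

section \<open>Liouville's theorem for elliptic functions and the differential equation\<close>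

text \<open>Periodicity carries the limit at 0 to every lattice point, so \<open>f\<close> extends
  to an entire function \<open>g\<close>. All its values occur on a compact set, and Liouville's
  theorem applies.\<close>

lemma elliptic_constant:
  assumes hol: "f holomorphic_on (- L)"
    and per: "\<And>z \<omega>. z \<notin> L \<Longrightarrow> \<omega> \<in> L \<Longrightarrow> f (z + \<omega>) = f z"
    and lim: "f \<midarrow>0\<rightarrow> l" and z: "z \<notin> L"
  shows "f z = l"
proof -
  define g where "g z = (if z \<in> L then l else f z)" for z
  have limw: "f \<midarrow>w\<rightarrow> l" if w: "w \<in> L" for w
  proof (rule LIM_offset_zero_cancel)
    obtain e where e: "e > 0" "\<forall>\<omega>\<in>L. \<omega> \<noteq> 0 \<longrightarrow> e \<le> norm (\<omega> - 0)"
      using isolated by blast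
    show "(\<lambda>h. f (w + h)) \<midarrow>0\<rightarrow> l"
    proof (rule Lim_transform_within[OF lim \<open>e > 0\<close>])
      fix h :: complex assume h: "0 < dist h 0" "dist h 0 < e"
      have "h \<notin> L"
      proof
        assume "h \<in> L"
        then have "e \<le> norm (h - 0)" using e(2) h(1) by auto
        then show False using h(2) by simp
      qed
      then show "f h = f (w + h)" using per[of h w] w by (simp add: add.commute)
    qed
  qed
  have "g field_differentiable at w" for w
  proof (cases "w \<in> L")
    case False
    obtain d where d: "d > 0" "ball w d \<subseteq> - L"
      using open_compl False open_contains_ball by (metis ComplI)
    have "f field_differentiable at w"
      using hol open_compl False by (simp add: holomorphic_on_open field_differentiable_def)
    then show ?thesis
      by (rule field_differentiable_transform_within[OF d(1), rotated 2])
         (use d in \<open>auto simp: g_def dist_commute subset_iff\<close>)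
  next
    case True
    obtain e where e: "e > 0" "\<forall>\<omega>\<in>L. \<omega> \<noteq> w \<longrightarrow> e \<le> norm (\<omega> - w)"
      using isolated by blast
    have notin: "x \<notin> L" if "x \<in> ball w e - {w}" for x
    proof
      assume "x \<in> L"
      then have "e \<le> norm (x - w)" using e(2) that by auto
      then show False using that by (simp add: dist_norm norm_minus_commute)
    qed
    have "(\<lambda>y. if y = w then l else f y) holomorphic_on ball w e"
      by (rule removable_singularity[OF _ open_ball limw[OF True]])
         (rule holomorphic_on_subset[OF hol], use notin in blast)
    then have "g holomorphic_on ball w e"
      by (rule holomorphic_transform) (use notin True in \<open>auto simp: g_def\<close>)
    then show ?thesis
      using e(1) by (auto simp: holomorphic_on_open field_differentiable_def)
  qed
  then have ghol: "g holomorphic_on UNIV"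
    by (simp add: holomorphic_on_def field_differentiable_at_within)
  have gper: "g (z + \<omega>) = g z" if "\<omega> \<in> L" for z \<omega>
    using per that add_mem_iff[OF that] by (auto simp: g_def)
  obtain K where K: "compact K" "\<forall>z. \<exists>\<omega>\<in>L. z - \<omega> \<in> K"
    using cocompact by blast
  have "g z \<in> g ` K" for z
  proof -
    obtain \<omega> where w: "\<omega> \<in> L" "z - \<omega> \<in> K" using K(2) by blast
    have "g (z - \<omega> + \<omega>) = g (z - \<omega>)" using gper[OF w(1)] .
    then show ?thesis using w by simp
  qed
  moreover have "compact (g ` K)"
    using K(1) ghol by (intro compact_continuous_image)
      (auto intro: holomorphic_on_imp_continuous_on holomorphic_on_subset)
  ultimately have "bounded (range g)"
    by (meson bounded_subset compact_imp_bounded image_subsetI)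
  then have "g constant_on UNIV" by (rule Liouville_theorem[OF ghol])
  then have "g z = g 0" by (auto simp: constant_on_def)
  then show ?thesis using z zero_mem by (simp add: g_def)
qed

text \<open>The difference \<Phi> of the two sides is periodic and holomorphic off \<open>L\<close>.
  The Laurent expansion to order 4 shows that it tends to 0 at 0, so it vanishes
  identically.\<close>

lemma wp_ode:
  assumes "z \<notin> L"
  shows "(deriv wp z)\<^sup>2 = 4 * wp z ^ 3 - g2 L * wp z - g3 L"
proof -
  define \<Phi> where "\<Phi> z = (deriv wp z)\<^sup>2 - 4 * wp z ^ 3 + g2 L * wp z + g3 L" for z
  define G where "G = g2 L / 20"
  define H where "H = g3 L / 28"
  obtain r p q where r: "r > 0" "ball 0 r \<inter> L = {0}"
    and hol: "p holomorphic_on ball 0 r" "q holomorphic_on ball 0 r"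
    and wp: "\<And>z. z \<in> ball 0 r \<Longrightarrow> wp z = 1 / z\<^sup>2 + p z" 
    and p: "\<And>z. z \<in> ball 0 r \<Longrightarrow> p z = G * z\<^sup>2 + H * z ^ 4 + z ^ 5 * q z"
    using wp_laurent unfolding G_def H_def by blast
  \<comment> \<open>Here z^4 s(z) is the derivative of z^5 q(z).\<close>
  define s where "s z = 5 * q z + z * deriv q z" for z
  define p' where "p' z = 2 * G * z + 4 * H * z ^ 3 + z ^ 4 * s z" for z
  \<comment> \<open>What is left of \<Phi> once the negative powers and the constants have
    cancelled: 4 - 4 at z^(-6), -8 - 12 + 20 for \<open>G\<close> at z^(-2), and -16 - 12 + 28 for
    \<open>H\<close> at z^0. It is continuous at 0 with value 0.\<close>
  define E where "E z = - 4 * (z * s z) - 12 * (z * q z) + (p' z)\<^sup>2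
      - 12 * z\<^sup>2 * (G + H * z\<^sup>2 + z ^ 3 * q z)\<^sup>2 - 4 * p z ^ 3 + 20 * G * p z" for z
  have dp: "(p has_field_derivative p' z) (at z)" if z: "z \<in> ball 0 r" for z
  proof (rule has_field_derivative_transform_within_open[where S = "ball 0 r"])
    show "((\<lambda>z. G * z\<^sup>2 + H * z ^ 4 + z ^ 5 * q z) has_field_derivative p' z) (at z)"
      unfolding p'_def s_def
      by (rule derivative_eq_intros refl holomorphic_derivI[OF hol(2) open_ball z])+
         (simp add: algebra_simps eval_nat_numeral)
  qed (use p z in auto)
  have dwp: "deriv wp z = - 2 / z ^ 3 + p' z" if z: "z \<in> ball 0 r" "z \<noteq> 0" for z
  proof (rule DERIV_imp_deriv, rule has_field_derivative_transform_within_open[where S = "ball 0 r"])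
    have "((\<lambda>z. 1 / (z - 0) ^ 2 - 0) has_field_derivative - 2 / z ^ 3) (at z)"
      using DERIV_divide_shift_power[OF z(2), of 1 2 0] by (simp del: power_Suc)
    from DERIV_add[OF this dp[OF z(1)]]
    show "((\<lambda>z. 1 / z\<^sup>2 + p z) has_field_derivative - 2 / z ^ 3 + p' z) (at z)"
      by (simp only: diff_zero)
  qed (use wp z in auto)
  have \<Phi>E: "\<Phi> z = E z" if z: "z \<in> ball 0 r" "z \<noteq> 0" for z
  proof -
    have "\<Phi> z = (- 2 / z ^ 3 + p' z)\<^sup>2 - 4 * (1 / z\<^sup>2 + p z) ^ 3 + 20 * G * (1 / z\<^sup>2 + p z) + 28 * H"
      using dwp[OF z] wp[OF z(1)] by (simp add: \<Phi>_def G_def H_def)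
    also have "\<dots> = - 4 * p' z / z ^ 3 + (p' z)\<^sup>2 - 12 * p z / z ^ 4 - 12 * (p z)\<^sup>2 / z\<^sup>2 - 4 * p z ^ 3
        + 20 * G / z\<^sup>2 + 20 * G * p z + 28 * H"
      using z(2) by (simp add: divide_simps) (simp add: algebra_simps eval_nat_numeral)
    also have "- 4 * p' z / z ^ 3 = - 8 * G / z\<^sup>2 - 16 * H - 4 * (z * s z)"
      using z(2) by (simp add: p'_def divide_simps) (simp add: algebra_simps eval_nat_numeral)
    also have "12 * p z / z ^ 4 = 12 * G / z\<^sup>2 + 12 * H + 12 * (z * q z)"
      using z(2) p[OF z(1)] by (simp add: divide_simps) (simp add: algebra_simps eval_nat_numeral)
    also have "12 * (p z)\<^sup>2 / z\<^sup>2 = 12 * z\<^sup>2 * (G + H * z\<^sup>2 + z ^ 3 * q z)\<^sup>2"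
    proof -
      have "p z = z\<^sup>2 * (G + H * z\<^sup>2 + z ^ 3 * q z)"
        using p[OF z(1)] by (simp add: algebra_simps eval_nat_numeral)
      then show ?thesis using z(2) by (simp add: power_mult_distrib eval_nat_numeral)
    qed
    finally show ?thesis by (simp add: E_def)
  qed
  have contE: "continuous_on (ball 0 r) E"
    unfolding E_def p'_def s_def
    by (intro continuous_intros holomorphic_on_imp_continuous_on[OF hol(1)]
         holomorphic_on_imp_continuous_on[OF hol(2)]
         holomorphic_on_imp_continuous_on[OF holomorphic_deriv[OF hol(2) open_ball]])
  have "p 0 = 0" using p[of 0] r by simp
  then have "E 0 = 0" by (simp add: E_def p'_def)
  moreover have "E \<midarrow>0\<rightarrow> E 0"
    using contE r(1) by (simp add: continuous_on_eq_continuous_at isContD)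
  ultimately have limE: "E \<midarrow>0\<rightarrow> 0" by simp
  have "\<Phi> \<midarrow>0\<rightarrow> 0"
    by (rule Lim_transform_within[OF limE r(1)]) (use \<Phi>E in auto)
  moreover have "\<Phi> holomorphic_on (- L)"
    unfolding \<Phi>_def
    by (intro holomorphic_intros wp_holomorphic holomorphic_deriv open_compl)
  moreover have "\<Phi> (z + \<omega>) = \<Phi> z" if "z \<notin> L" "\<omega> \<in> L" for z \<omega>
    using that by (simp add: \<Phi>_def wp_periodic wp'_periodic)
  ultimately have "\<Phi> z = 0" using assms elliptic_constant by blast
  then show ?thesis by (simp add: \<Phi>_def algebra_simps) 
qed

end

section \<open>Half periods and the nonvanishing of the discriminant\<close>

context complex_lattice
begin

lemma wp_principal_part:
  obtains r p where "r > 0" "p holomorphic_on ball 0 r" "ball 0 r \<inter> L = {0}" "p 0 = 0"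
    "\<And>z. z \<in> ball 0 r \<Longrightarrow> wp z = 1 / z\<^sup>2 + p z"
    "\<And>z. z \<in> ball 0 r \<Longrightarrow> z \<noteq> 0 \<Longrightarrow> deriv wp z = - 2 / z ^ 3 + deriv p z"
proof -
  obtain r p where r: "r > 0" and hol: "p holomorphic_on ball 0 r" and L: "ball 0 r \<inter> L = {0}"
    and wp: "\<And>z. z \<in> ball 0 r \<Longrightarrow> wp z = 1 / z\<^sup>2 + p z" and p0: "p 0 = 0"
    and "\<And>n. n > 0 \<Longrightarrow> ((\<lambda>\<omega>. fact (Suc n) / \<omega> ^ (n + 2)) has_sum (deriv ^^ n) p 0) (L - {0})"
    by (rule wp_regular_part) (rule that)
  have dwp: "deriv wp z = - 2 / z ^ 3 + deriv p z" if z: "z \<in> ball 0 r" "z \<noteq> 0" for z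
  proof (rule DERIV_imp_deriv, rule has_field_derivative_transform_within_open[where S = "ball 0 r"])
    have "((\<lambda>z. 1 / (z - 0) ^ 2 - 0) has_field_derivative - 2 / z ^ 3) (at z)"
      using DERIV_divide_shift_power[OF z(2), of 1 2 0] by (simp del: power_Suc)
    from DERIV_add[OF this holomorphic_derivI[OF hol open_ball z(1)]]
    show "((\<lambda>z. 1 / z\<^sup>2 + p z) has_field_derivative - 2 / z ^ 3 + deriv p z) (at z)"
      by (simp only: diff_zero)
  qed (use wp z in auto)
  show ?thesis by (rule that[OF r hol L p0 wp dwp])
qed

lemma wp_lim: "(\<lambda>z. z\<^sup>2 * wp z) \<midarrow>0\<rightarrow> 1"
  and wp'_lim: "(\<lambda>z. z ^ 3 * deriv wp z) \<midarrow>0\<rightarrow> - 2"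
proof -
  obtain r p where r: "r > 0" and hol: "p holomorphic_on ball 0 r"
    and "ball 0 r \<inter> L = {0}" "p 0 = 0"
    and wp: "\<And>z. z \<in> ball 0 r \<Longrightarrow> wp z = 1 / z\<^sup>2 + p z"
    and dwp: "\<And>z. z \<in> ball 0 r \<Longrightarrow> z \<noteq> 0 \<Longrightarrow> deriv wp z = - 2 / z ^ 3 + deriv p z"
    by (rule wp_principal_part) (rule that)
  have c: "p \<midarrow>0\<rightarrow> p 0" "deriv p \<midarrow>0\<rightarrow> deriv p 0"
    using holomorphic_on_imp_continuous_on[OF hol]
      holomorphic_on_imp_continuous_on[OF holomorphic_deriv[OF hol open_ball]] r
    by (simp_all add: continuous_on_eq_continuous_at isContD)
  have "(\<lambda>z. 1 + z\<^sup>2 * p z) \<midarrow>0\<rightarrow> 1 + 0\<^sup>2 * p 0"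
    by (intro tendsto_intros c)
  then have 1: "(\<lambda>z. 1 + z\<^sup>2 * p z) \<midarrow>0\<rightarrow> 1" by simp
  show "(\<lambda>z. z\<^sup>2 * wp z) \<midarrow>0\<rightarrow> 1"
    by (rule Lim_transform_within[OF 1 r]) (use wp in \<open>auto simp: distrib_left\<close>)
  have "(\<lambda>z. - 2 + z ^ 3 * deriv p z) \<midarrow>0\<rightarrow> - 2 + 0 ^ 3 * deriv p 0"
    by (intro tendsto_intros c)
  then have 2: "(\<lambda>z. - 2 + z ^ 3 * deriv p z) \<midarrow>0\<rightarrow> - 2" by simp
  show "(\<lambda>z. z ^ 3 * deriv wp z) \<midarrow>0\<rightarrow> - 2"
    by (rule Lim_transform_within[OF 2 r]) (use dwp in \<open>auto simp: distrib_left right_diff_distrib\<close>)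
qed

lemma eventually_not_mem: "\<forall>\<^sub>F z in at w. z \<notin> L"
proof -
  obtain e where e: "e > 0" "\<forall>\<omega>\<in>L. \<omega> \<noteq> w \<longrightarrow> e \<le> norm (\<omega> - w)"
    using isolated by blast
  show ?thesis unfolding eventually_at
  proof (intro exI[of _ e] conjI ballI impI)
    fix z assume "z \<noteq> w \<and> dist z w < e"
    then show "z \<notin> L" using e(2) by (auto simp: dist_norm not_le[symmetric])
  qed (rule e(1))
qed

lemma wp_lim_at:
  assumes "w \<in> L"
  shows "(\<lambda>z. (z - w)\<^sup>2 * wp z) \<midarrow>w\<rightarrow> 1"
proof (rule LIM_offset_zero_cancel)
  have ev: "\<forall>\<^sub>F h in at 0. h\<^sup>2 * wp h = (w + h - w)\<^sup>2 * wp (w + h)"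
    using eventually_not_mem[of 0]
  proof eventually_elim
    case (elim h)
    then show ?case using wp_periodic[OF assms, of h] by (simp add: add.commute)
  qed
  show "(\<lambda>h. (w + h - w)\<^sup>2 * wp (w + h)) \<midarrow>0\<rightarrow> 1"
    using wp_lim tendsto_cong[OF ev] by simp
qed

text \<open>The derivative is odd, and - h and h differ by the period 2 h.\<close>

lemma wp'_half_period:
  assumes "h \<notin> L" "2 * h \<in> L"
  shows "deriv wp h = 0"
proof -
  have mh: "- h \<notin> L" using assms uminus_mem[of "- h"] by auto
  have "((\<lambda>z. wp (- z)) has_field_derivative deriv wp (- h) * (- 1)) (at h)"
    by (rule DERIV_chain2[where f = wp and g = uminus, OF wp_has_derivative(1)[OF mh]])
       (auto intro!: derivative_eq_intros)
  then have "deriv wp h = - deriv wp (- h)"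
    by (simp add: wp_even DERIV_imp_deriv)
  moreover have "deriv wp (- h + 2 * h) = deriv wp (- h)"
    by (rule wp'_periodic[OF assms(2) mh])
  ultimately show ?thesis by simp
qed

lemma wp_not_eventually_const: "\<not> (\<forall>\<^sub>F z in at 0. wp z = v)"
proof
  assume ev: "\<forall>\<^sub>F z in at 0. wp z = v"
  have "(\<lambda>z. z\<^sup>2 * v) \<midarrow>0\<rightarrow> 0\<^sup>2 * v" by (intro tendsto_intros)
  moreover have "\<forall>\<^sub>F z in at 0. z\<^sup>2 * v = z\<^sup>2 * wp z"
    using ev by eventually_elim (simp only:)
  ultimately have "(\<lambda>z. z\<^sup>2 * wp z) \<midarrow>0\<rightarrow> 0\<^sup>2 * v" by (rule Lim_transform_eventually)
  from LIM_unique[OF this wp_lim] show False by simp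
qed

text \<open>The product studied in \<open>wp_half_periods_distinct\<close> also has the half period
  as a period. On this larger lattice \<open>elliptic_constant\<close> can be applied to it with a
  single limit at 0.\<close>

lemma half_translate_lattice:
  assumes h: "h \<notin> L" "2 * h \<in> L"
  shows "complex_lattice (L \<union> (\<lambda>\<omega>. \<omega> + h) ` L)"
proof
  show "0 \<in> L \<union> (\<lambda>\<omega>. \<omega> + h) ` L" using zero_mem by blast
  have mem: "x \<in> (\<lambda>\<omega>. \<omega> + h) ` L \<longleftrightarrow> x - h \<in> L" for x by force
  have mem': "x - h \<in> L \<longleftrightarrow> x + h \<in> L" for x
    using add_mem[of "x - h" "2 * h"] diff_mem[of "x + h" "2 * h"] h by (auto simp: algebra_simps)
  show "a - b \<in> L \<union> (\<lambda>\<omega>. \<omega> + h) ` L"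
    if "a \<in> L \<union> (\<lambda>\<omega>. \<omega> + h) ` L" "b \<in> L \<union> (\<lambda>\<omega>. \<omega> + h) ` L" for a b
    using that diff_mem[of a b] diff_mem[of "a - h" b] diff_mem[of a "b - h"] diff_mem[of "a - h" "b - h"]
      mem'[of "a - b"]
    unfolding Un_iff mem by (auto simp: algebra_simps)
  have "\<exists>K. compact K \<and> (\<forall>z. \<exists>\<omega>\<in>L. z - \<omega> \<in> K)" by (rule cocompact)
  then show "\<exists>K. compact K \<and> (\<forall>z. \<exists>\<omega>\<in>L \<union> (\<lambda>\<omega>. \<omega> + h) ` L. z - \<omega> \<in> K)" by blast
  have "(\<lambda>\<omega>. 1 / norm (\<omega> + h) ^ 3) summable_on L"
  proof -
    have far: "(\<lambda>\<omega>. 1 / norm (\<omega> + h) ^ 3) summable_on far (norm h)"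
    proof (rule summable_on_comparison_test)
      have "(\<lambda>\<omega>. 1 / norm \<omega> ^ 3) summable_on far (norm h)"
        by (rule summable_on_subset_banach[OF summable_cube]) (auto simp: far_def)
      then show "(\<lambda>\<omega>. 8 * (1 / norm \<omega> ^ 3)) summable_on far (norm h)"
        by (rule summable_on_cmult_right)
      fix \<omega> assume "\<omega> \<in> far (norm h)"
      then have w: "norm \<omega> > 2 * norm h" "norm \<omega> > 0" by (auto simp: far_def)
      have "norm \<omega> / 2 \<le> norm (\<omega> + h)"
        using norm_triangle_ineq4[of "\<omega> + h" h] w by simp
      then have "(norm \<omega> / 2) ^ 3 \<le> norm (\<omega> + h) ^ 3" by (rule power_mono) simp
      moreover have "0 < (norm \<omega> / 2) ^ 3" using w by simp
      ultimately have "1 / norm (\<omega> + h) ^ 3 \<le> 1 / (norm \<omega> / 2) ^ 3"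
        by (intro divide_left_mono mult_pos_pos) linarith+
      then show "1 / norm (\<omega> + h) ^ 3 \<le> 8 * (1 / norm \<omega> ^ 3)" by (simp add: power_divide)
    qed simp
    have "finite (insert 0 (near (norm h)))" using finite_near by simp
    from summable_on_union[OF summable_on_finite[OF this] far]
    have "(\<lambda>\<omega>. 1 / norm (\<omega> + h) ^ 3) summable_on insert 0 (near (norm h)) \<union> far (norm h)" .
    moreover have "insert 0 (near (norm h)) \<union> far (norm h) = L"
      using near_far(1)[of "norm h"] zero_mem by auto
    ultimately show ?thesis by simp
  qed
  then have "(\<lambda>\<omega>. 1 / norm \<omega> ^ 3) summable_on (\<lambda>\<omega>. \<omega> + h) ` L"
    by (subst summable_on_reindex) (auto simp: o_def)
  from summable_on_union[OF summable_cube this]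
  have "(\<lambda>\<omega>. 1 / norm \<omega> ^ 3) summable_on (L - {0}) \<union> (\<lambda>\<omega>. \<omega> + h) ` L" .
  then show "(\<lambda>\<omega>. 1 / norm \<omega> ^ 3) summable_on (L \<union> (\<lambda>\<omega>. \<omega> + h) ` L) - {0}"
    by (rule summable_on_subset_banach) auto
qed

text \<open>If \<open>\<wp>\<close> took the same value \<open>v\<close> at two inequivalent half periods \<open>h1\<close>, \<open>h2\<close>, then
  \<open>(\<wp> z - v) (\<wp> (z + h1) - v)\<close> would have no poles and vanish at \<open>h2\<close>.\<close>

lemma wp_half_periods_distinct:
  assumes h1: "h1 \<notin> L" "2 * h1 \<in> L" and h2: "h2 \<notin> L" "h2 - h1 \<notin> L" "2 * h2 \<in> L"
  shows "wp h1 \<noteq> wp h2"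
proof
  assume eq: "wp h1 = wp h2"
  define v where "v = wp h1"
  define L' where "L' = L \<union> (\<lambda>\<omega>. \<omega> + h1) ` L"
  interpret M: complex_lattice L'
    unfolding L'_def by (rule half_translate_lattice[OF h1])
  have mem: "x \<in> L' \<longleftrightarrow> x \<in> L \<or> x - h1 \<in> L" for x by (force simp: L'_def)
  have mem': "x - h1 \<in> L \<longleftrightarrow> x + h1 \<in> L" for x
    using add_mem[of "x - h1" "2 * h1"] diff_mem[of "x + h1" "2 * h1"] h1 by (auto simp: algebra_simps)
  define F where "F z = (wp z - v) * (wp (z + h1) - v)" for z
  have hol1: "(\<lambda>z. wp (z + h1)) holomorphic_on - L'"
  proof -
    have "(wp \<circ> (\<lambda>z. z + h1)) holomorphic_on - L'"
      by (rule holomorphic_on_compose_gen[OF _ wp_holomorphic])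
         (auto intro!: holomorphic_intros simp: mem mem')
    then show ?thesis by (simp add: o_def)
  qed
  have holF: "F holomorphic_on - L'"
    unfolding F_def
    by (intro holomorphic_intros hol1 holomorphic_on_subset[OF wp_holomorphic]) (auto simp: mem)
  have perF1: "F (z + \<omega>) = F z" if "z \<notin> L'" "\<omega> \<in> L" for z \<omega>
  proof -
    have "wp (z + h1 + \<omega>) = wp (z + h1)"
      by (rule wp_periodic) (use that mem mem' in auto)
    moreover have "wp (z + \<omega>) = wp z"
      by (rule wp_periodic) (use that mem mem' in auto)
    ultimately show ?thesis by (simp add: F_def add.commute add.left_commute)
  qed
  have perF: "F (z + \<omega>) = F z" if z: "z \<notin> L'" and w: "\<omega> \<in> L'" for z \<omega>
  proof (cases "\<omega> \<in> L")
    case True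
    then show ?thesis using perF1 z by blast
  next
    case False
    then have w': "\<omega> - h1 \<in> L" using w mem by blast
    have zh: "z + h1 \<notin> L'"
      using z mem[of z] mem[of "z + h1"] mem'[of z] by auto
    have "F (z + h1 + (\<omega> - h1)) = F (z + h1)" by (rule perF1[OF zh w'])
    also have "wp (z + 2 * h1) = wp z"
      by (rule wp_periodic[OF h1(2)]) (use z mem in auto)
    then have "F (z + h1) = F z" by (simp add: F_def algebra_simps)
    finally show ?thesis by simp
  qed
  obtain r p where r: "r > 0" and p: "p holomorphic_on ball 0 r"
    and "ball 0 r \<inter> L = {0}" "p 0 = 0"
    and wp: "\<And>z. z \<in> ball 0 r \<Longrightarrow> wp z = 1 / z\<^sup>2 + p z"
    and "\<And>z. z \<in> ball 0 r \<Longrightarrow> z \<noteq> 0 \<Longrightarrow> deriv wp z = - 2 / z ^ 3 + deriv p z"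
    by (rule wp_principal_part) (rule that)
  obtain d where d: "d > 0" "ball h1 d \<subseteq> - L"
    using open_compl h1(1) open_contains_ball by (metis ComplI)
  define e where "e = min r d"
  have e: "e > 0" "e \<le> r" "e \<le> d" using r d by (auto simp: e_def)
  define u where "u z = wp (z + h1) - v" for z
  have du: "(u has_field_derivative deriv wp (z + h1)) (at z)" if "z \<in> ball 0 e" for z
  proof -
    have "z + h1 \<in> ball h1 d" using that e by (simp add: dist_norm)
    then have "(wp has_field_derivative deriv wp (z + h1)) (at (z + h1))"
      using d wp_has_derivative(1) by blast
    then have "((\<lambda>z. wp (z + h1)) has_field_derivative deriv wp (z + h1)) (at z)"
      by (simp add: DERIV_shift)
    then show ?thesis unfolding u_def by (auto intro!: derivative_eq_intros)
  qed
  then have hu: "u holomorphic_on ball 0 e"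
    unfolding holomorphic_on_open[OF open_ball] by blast
  obtain w where hw: "w holomorphic_on ball 0 e"
    and w: "\<And>z. z \<in> ball 0 e \<Longrightarrow> u z = (\<Sum>k<2. (deriv ^^ k) u 0 / fact k * z ^ k) + z\<^sup>2 * w z"
    using holomorphic_taylor_remainder[OF hu] by blast
  \<comment> \<open>At the half period \<open>h1\<close> the derivative vanishes too, so
    \<open>u\<close> has a zero of order at least two at 0. It cancels the double pole of the other
    factor of \<open>F\<close>.\<close>
  have "u 0 = 0" by (simp add: u_def v_def)
  moreover have "deriv u 0 = 0"
    using DERIV_imp_deriv[OF du[of 0]] e wp'_half_period[OF h1] by simp
  ultimately have uw: "u z = z\<^sup>2 * w z" if "z \<in> ball 0 e" for z
    using w[OF that] by (simp add: numeral_2_eq_2)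
  have Fw: "F z = (1 + z\<^sup>2 * (p z - v)) * w z" if "z \<in> ball 0 e" "z \<noteq> 0" for z
  proof -
    have "F z = (1 / z\<^sup>2 + p z - v) * (z\<^sup>2 * w z)"
      using wp[of z] uw[OF that(1)] that e by (simp add: F_def u_def)
    also have "\<dots> = (1 + z\<^sup>2 * (p z - v)) * w z"
      using that(2) by (simp add: divide_simps) (simp add: algebra_simps)
    finally show ?thesis .
  qed
  have c: "p \<midarrow>0\<rightarrow> p 0" "w \<midarrow>0\<rightarrow> w 0"
    using holomorphic_on_imp_continuous_on[OF p] holomorphic_on_imp_continuous_on[OF hw] r e
    by (simp_all add: continuous_on_eq_continuous_at isContD)
  have "(\<lambda>z. (1 + z\<^sup>2 * (p z - v)) * w z) \<midarrow>0\<rightarrow> (1 + 0\<^sup>2 * (p 0 - v)) * w 0"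
    by (intro tendsto_intros c)
  then have limF: "F \<midarrow>0\<rightarrow> w 0"
    using Lim_transform_within[of "\<lambda>z. (1 + z\<^sup>2 * (p z - v)) * w z" _ 0 UNIV e F] Fw e by simp
  have Fc: "F z = w 0" if "z \<notin> L'" for z
    by (rule M.elliptic_constant[OF holF perF limF that])
  have "h2 \<notin> L'" using h2 mem by auto
  from Fc[OF this] have "w 0 = 0" using eq by (simp add: F_def v_def)
  then have F0: "F z = 0" if "z \<notin> L'" for z using Fc that by simp
  \<comment> \<open>Near 0 the first factor of \<open>F\<close> cannot vanish because of its pole,
    so the second one does. Then the Weierstrass function equals \<open>v\<close> near
    \<open>h1\<close>, hence everywhere, against the pole at 0.\<close>
  have "\<forall>\<^sub>F z in at 0. wp z \<noteq> v"
  proof -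
    have "(\<lambda>z. z\<^sup>2 * (wp z - v)) \<midarrow>0\<rightarrow> 1 - 0\<^sup>2 * v"
      unfolding right_diff_distrib by (intro tendsto_intros wp_lim)
    then have "\<forall>\<^sub>F z in at 0. z\<^sup>2 * (wp z - v) \<noteq> 0"
      by (rule tendsto_imp_eventually_ne) simp
    then show ?thesis by eventually_elim auto
  qed
  then have "\<forall>\<^sub>F z in at 0. u z = 0"
    using M.eventually_not_mem[of 0]
    by eventually_elim (use F0 in \<open>auto simp: F_def u_def\<close>)
  then obtain e' where e': "e' > 0" "\<And>z. z \<noteq> 0 \<Longrightarrow> norm z < e' \<Longrightarrow> u z = 0"
    unfolding eventually_at by (auto simp: dist_norm)
  have "wp z = v" if "z \<notin> L" for z
  proof (rule analytic_continuation_open[of "ball h1 (min d e')" "- L" wp "\<lambda>_. v"])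
    show "wp z = v" if "z \<in> ball h1 (min d e')" for z
      using e'(2)[of "z - h1"] that by (cases "z = h1") (auto simp: u_def v_def dist_norm norm_minus_commute)
    show "ball h1 (min d e') \<noteq> {}" using d e' by simp
  qed (use d that open_compl connected_compl wp_holomorphic in auto)
  then have "\<forall>\<^sub>F z in at 0. wp z = v"
    using eventually_not_mem[of 0] by (auto elim: eventually_mono)
  then show False using wp_not_eventually_const by blast
qed

text \<open>The values a, b, c at the three half periods are distinct roots of 4 t^3 - g2 t - g3.
  Subtracting the root equations pairwise gives a + b + c = 0 and expresses \<open>g2\<close> and
  \<open>g3\<close> in a and b; the discriminant becomes 16 times the squared product of the
  differences.\<close>

lemma discriminant_nonzero:
  assumes "h1 \<notin> L" "2 * h1 \<in> L" "h2 \<notin> L" "2 * h2 \<in> L" "h1 + h2 \<notin> L"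
  shows "g2 L ^ 3 - 27 * g3 L ^ 2 \<noteq> 0"
proof -
  define h3 where "h3 = h1 + h2"
  have h3: "h3 \<notin> L" "2 * h3 \<in> L"
    using assms add_mem[of "2 * h1" "2 * h2"] by (auto simp: h3_def algebra_simps)
  have "h2 - h1 \<notin> L"
    using assms add_mem[of "h2 - h1" "2 * h1"] by (auto simp: algebra_simps)
  then have 12: "wp h1 \<noteq> wp h2" using wp_half_periods_distinct[of h1 h2] assms by blast
  have 13: "wp h1 \<noteq> wp h3" using wp_half_periods_distinct[of h1 h3] assms h3 by (simp add: h3_def)
  have 23: "wp h2 \<noteq> wp h3" using wp_half_periods_distinct[of h2 h3] assms h3 by (simp add: h3_def)
  have root: "4 * wp h ^ 3 - g2 L * wp h - g3 L = 0" if "h \<notin> L" "2 * h \<in> L" for h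
    using wp_ode[OF that(1)] wp'_half_period[OF that] by simp
  define a where "a = wp h1"
  define b where "b = wp h2"
  define c where "c = wp h3"
  have abc: "a \<noteq> b" "a \<noteq> c" "b \<noteq> c" using 12 13 23 by (simp_all add: a_def b_def c_def)
  have r: "4 * a ^ 3 - g2 L * a - g3 L = 0" "4 * b ^ 3 - g2 L * b - g3 L = 0" "4 * c ^ 3 - g2 L * c - g3 L = 0"
    using root assms h3 by (simp_all add: a_def b_def c_def)
  have "(a - b) * (4 * (a\<^sup>2 + a * b + b\<^sup>2) - g2 L)
      = (4 * a ^ 3 - g2 L * a - g3 L) - (4 * b ^ 3 - g2 L * b - g3 L)"
    by (simp add: algebra_simps eval_nat_numeral)
  then have g2: "g2 L = 4 * (a\<^sup>2 + a * b + b\<^sup>2)" using abc r by simp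
  have "(a - c) * (4 * (a\<^sup>2 + a * c + c\<^sup>2) - g2 L)
      = (4 * a ^ 3 - g2 L * a - g3 L) - (4 * c ^ 3 - g2 L * c - g3 L)"
    by (simp add: algebra_simps eval_nat_numeral)
  then have g2': "g2 L = 4 * (a\<^sup>2 + a * c + c\<^sup>2)" using abc r by simp
  have "4 * (a\<^sup>2 + a * b + b\<^sup>2) = 4 * (a\<^sup>2 + a * c + c\<^sup>2)"
    using g2 g2' by (simp only:)
  then have "a\<^sup>2 + a * b + b\<^sup>2 = a\<^sup>2 + a * c + c\<^sup>2"
    by (simp only: mult_cancel_left) simp
  moreover have "(b - c) * (a + b + c) = (a\<^sup>2 + a * b + b\<^sup>2) - (a\<^sup>2 + a * c + c\<^sup>2)"
    by (simp add: algebra_simps eval_nat_numeral)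
  ultimately have "(b - c) * (a + b + c) = 0" by (simp only: diff_self)
  then have "a + b + c = 0" using abc by simp
  then have c: "c = - a - b" by (simp add: eq_neg_iff_add_eq_0 algebra_simps)
  have g3: "g3 L = - 4 * a * b * (a + b)"
    using r(1) g2 by (simp add: algebra_simps eval_nat_numeral)
  have "g2 L ^ 3 - 27 * g3 L ^ 2 = 16 * ((a - b) * (a - c) * (b - c))\<^sup>2"
    unfolding g2 g3 c by (simp add: algebra_simps eval_nat_numeral)
  then show ?thesis using abc by simp
qed

end

text \<open>Both Weierstrass functions solve the same differential equation. If their difference, which is
  holomorphic at 0, had leading term \<open>z ^ n\<close>, comparing leading terms would give \<open>- 4 n = 12\<close>.\<close>

lemma lattice_le_of_invariants_eq:
  assumes "complex_lattice L" "complex_lattice M" "g2 L = g2 M" "g3 L = g3 M"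
  shows "L \<subseteq> M"
proof -
  interpret L: complex_lattice L by fact
  interpret M: complex_lattice M by fact
  define f where "f = L.wp"
  define g where "g = M.wp"
  obtain r1 p1 where r1: "r1 > 0" and p1: "p1 holomorphic_on ball 0 r1" and L1: "ball 0 r1 \<inter> L = {0}"
    and p10: "p1 0 = 0"
    and f: "\<And>z. z \<in> ball 0 r1 \<Longrightarrow> L.wp z = 1 / z\<^sup>2 + p1 z"
    and f': "\<And>z. z \<in> ball 0 r1 \<Longrightarrow> z \<noteq> 0 \<Longrightarrow> deriv L.wp z = - 2 / z ^ 3 + deriv p1 z"
    by (rule L.wp_principal_part) (rule that)
  obtain r2 p2 where r2: "r2 > 0" and p2: "p2 holomorphic_on ball 0 r2" and L2: "ball 0 r2 \<inter> M = {0}"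
    and p20: "p2 0 = 0"
    and g: "\<And>z. z \<in> ball 0 r2 \<Longrightarrow> M.wp z = 1 / z\<^sup>2 + p2 z"
    and g': "\<And>z. z \<in> ball 0 r2 \<Longrightarrow> z \<noteq> 0 \<Longrightarrow> deriv M.wp z = - 2 / z ^ 3 + deriv p2 z"
    by (rule M.wp_principal_part) (rule that)
  define r where "r = min r1 r2"
  have r: "r > 0" "r \<le> r1" "r \<le> r2" using r1 r2 by (auto simp: r_def)
  have hp: "p1 holomorphic_on ball 0 r" "p2 holomorphic_on ball 0 r"
    by (rule holomorphic_on_subset[OF p1], use r in auto)
       (rule holomorphic_on_subset[OF p2], use r in auto)
  define d where "d z = p1 z - p2 z" for z
  have hd: "d holomorphic_on ball 0 r" unfolding d_def by (intro holomorphic_intros hp)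
  have d0: "d 0 = 0" by (simp add: d_def p10 p20)
  have fg: "f z - g z = d z" if "z \<in> ball 0 r" for z
    using f[of z] g[of z] that r by (simp add: d_def f_def g_def)
  have fg': "deriv f z - deriv g z = deriv d z" if "z \<in> ball 0 r" "z \<noteq> 0" for z
  proof -
    have "deriv d z = deriv p1 z - deriv p2 z"
      unfolding d_def
      by (intro deriv_diff holomorphic_on_imp_differentiable_at[OF hp(1) open_ball that(1)]
            holomorphic_on_imp_differentiable_at[OF hp(2) open_ball that(1)])
    then show ?thesis using f'[of z] g'[of z] that r by (simp add: f_def g_def)
  qed
  have notin: "z \<notin> L" "z \<notin> M" if "z \<in> ball 0 r" "z \<noteq> 0" for z
  proof -
    have "z \<in> ball 0 r1" "z \<in> ball 0 r2" using that(1) r by auto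
    then show "z \<notin> L" "z \<notin> M" using L1 L2 that(2) by blast+
  qed
  have ode: "deriv d z * (deriv f z + deriv g z) = d z * (4 * ((f z)\<^sup>2 + f z * g z + (g z)\<^sup>2) - g2 L)"
    if z: "z \<in> ball 0 r" "z \<noteq> 0" for z
  proof -
    have "deriv d z * (deriv f z + deriv g z) = (deriv f z)\<^sup>2 - (deriv g z)\<^sup>2"
      unfolding fg'[OF z, symmetric] by (simp add: algebra_simps power2_eq_square)
    also have "\<dots> = (4 * f z ^ 3 - g2 L * f z - g3 L) - (4 * g z ^ 3 - g2 L * g z - g3 L)"
      using L.wp_ode[OF notin(1)[OF z]] M.wp_ode[OF notin(2)[OF z]] assms by (simp add: f_def g_def)
    also have "\<dots> = d z * (4 * ((f z)\<^sup>2 + f z * g z + (g z)\<^sup>2) - g2 L)"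
      unfolding fg[OF z(1), symmetric] by (simp add: algebra_simps eval_nat_numeral)
    finally show ?thesis .
  qed
  have "d constant_on ball 0 r"
  proof (rule ccontr)
    assume nc: "\<not> d constant_on ball 0 r"
    obtain e s n where n: "0 < n" and s: "0 < s" "ball (0::complex) s \<subseteq> ball 0 r" and e: "e holomorphic_on ball 0 s"
      and de: "\<And>w. w \<in> ball 0 s \<Longrightarrow> d w = (w - 0) ^ n * e w"
      and e0: "\<And>w. w \<in> ball 0 s \<Longrightarrow> e w \<noteq> 0"
    proof (rule holomorphic_factor_zero_nonconstant[OF hd open_ball connected_ball _ d0 nc])
      show "0 \<in> ball (0::complex) r" using r by simp
    qed (rule that)
    have dd: "deriv d z = of_nat n * z ^ (n - 1) * e z + z ^ n * deriv e z" if "z \<in> ball 0 s" for z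
    proof (rule DERIV_imp_deriv, rule has_field_derivative_transform_within_open[where S = "ball 0 s"])
      show "((\<lambda>z. z ^ n * e z) has_field_derivative of_nat n * z ^ (n - 1) * e z + z ^ n * deriv e z) (at z)"
        by (rule derivative_eq_intros refl holomorphic_derivI[OF e open_ball that])+ simp
    qed (use that de in auto)
    \<comment> \<open>\<open>A\<close> and \<open>B\<close> are the two sides of \<open>ode\<close>
      multiplied by z^4 and divided by z^n. Both have limits at 0, namely -4 n e(0) and 12
      e(0).\<close>
    define A where "A z = (of_nat n * e z + z * deriv e z) * (z ^ 3 * deriv f z + z ^ 3 * deriv g z)" for z
    define B where "B z = e z * (4 * ((z\<^sup>2 * f z)\<^sup>2 + (z\<^sup>2 * f z) * (z\<^sup>2 * g z) + (z\<^sup>2 * g z)\<^sup>2) - z ^ 4 * g2 L)" for z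
    have AB: "A z = B z" if z: "z \<in> ball 0 s" "z \<noteq> 0" for z
    proof -
      have zr: "z \<in> ball 0 r" using z s by blast
      have "z ^ n * A z = z ^ 4 * (deriv d z * (deriv f z + deriv g z))"
      proof -
        obtain k where k: "n = Suc k" using n by (cases n) auto
        show ?thesis unfolding dd[OF z(1)] A_def k
          by (simp add: algebra_simps power_numeral_reduce)
      qed
      also have "\<dots> = z ^ 4 * (d z * (4 * ((f z)\<^sup>2 + f z * g z + (g z)\<^sup>2) - g2 L))"
        using ode[OF zr z(2)] by simp
      also have "\<dots> = z ^ n * B z"
        unfolding B_def de[OF z(1)] by (simp add: algebra_simps power_numeral_reduce power2_eq_square)
      finally show ?thesis using z(2) by simp
    qed
    have c: "e \<midarrow>0\<rightarrow> e 0" "deriv e \<midarrow>0\<rightarrow> deriv e 0"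
      using holomorphic_on_imp_continuous_on[OF e]
        holomorphic_on_imp_continuous_on[OF holomorphic_deriv[OF e open_ball]] s
      by (simp_all add: continuous_on_eq_continuous_at isContD)
    have "A \<midarrow>0\<rightarrow> (of_nat n * e 0 + 0 * deriv e 0) * (- 2 + - 2)"
      unfolding A_def f_def g_def by (intro tendsto_intros c L.wp'_lim M.wp'_lim)
    moreover have "A \<midarrow>0\<rightarrow> e 0 * (4 * (1\<^sup>2 + 1 * 1 + 1\<^sup>2) - 0 ^ 4 * g2 L)"
    proof (rule Lim_transform_within[OF _ s(1)])
      show "B \<midarrow>0\<rightarrow> e 0 * (4 * (1\<^sup>2 + 1 * 1 + 1\<^sup>2) - 0 ^ 4 * g2 L)"
        unfolding B_def f_def g_def by (intro tendsto_intros c L.wp_lim M.wp_lim)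
    qed (use AB in auto)
    ultimately have "(of_nat n * e 0 + 0 * deriv e 0) * (- 2 + - 2) = e 0 * (4 * (1\<^sup>2 + 1 * 1 + 1\<^sup>2) - 0 ^ 4 * g2 L)"
      by (rule LIM_unique)
    then have *: "of_nat n * e 0 * (- 4) = e 0 * 12" by simp
    have "e 0 * (of_nat n + 3) = (e 0 * 12 - of_nat n * e 0 * (- 4)) / 4" by (simp add: field_simps)
    also have "\<dots> = 0" unfolding * by simp
    finally have "e 0 * (of_nat n + 3) = 0" .
    moreover have "e 0 \<noteq> 0" using e0 s by simp
    ultimately have "of_nat (n + 3) = (0 :: complex)" by simp
    then show False unfolding of_nat_eq_0_iff by simp
  qed
  then obtain c where c: "\<And>z. z \<in> ball 0 r \<Longrightarrow> d z = c" unfolding constant_on_def by blast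
  have "c = 0" using c[of 0] d0 r by simp
  then have near0: "f z = g z" if "z \<in> ball 0 r" for z
    using fg[OF that] c[OF that] by simp
  have conn: "connected (- (L \<union> M))"
    using connected_open_diff_countable[of "UNIV :: complex set" "L \<union> M"] L.countable M.countable connected_UNIV
    by (simp add: Compl_eq_Diff_UNIV)
  have eq: "f z = g z" if "z \<notin> L \<union> M" for z
  proof (rule analytic_continuation_open[of "ball 0 r - {0}" "- (L \<union> M)" f g])
    show "ball (0::complex) r - {0} \<noteq> {}"
    proof -
      have "of_real (r / 2) \<in> ball (0::complex) r - {0}" using r by auto
      then show ?thesis by blast
    qed
    show "open (- (L \<union> M))" using L.open_compl M.open_compl by auto
    show "ball 0 r - {0} \<subseteq> - (L \<union> M)" using notin by blast
    show "f holomorphic_on - (L \<union> M)" "g holomorphic_on - (L \<union> M)"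
      unfolding f_def g_def
      by (rule holomorphic_on_subset[OF L.wp_holomorphic], blast)
         (rule holomorphic_on_subset[OF M.wp_holomorphic], blast)
  qed (use that conn near0 in auto)
  show "L \<subseteq> M"
  proof
    fix w assume w: "w \<in> L"
    show "w \<in> M"
    \<comment> \<open>Outside \<open>M\<close> the second function is continuous at
      \<open>w\<close>, while the first has a double pole there; off the two lattices they
      agree.\<close>
    proof (rule ccontr)
      assume wM: "w \<notin> M"
      have "isCont M.wp w" using M.wp_has_derivative(1)[OF wM] by (rule DERIV_isCont)
      then have "(\<lambda>z. (z - w)\<^sup>2 * M.wp z) \<midarrow>w\<rightarrow> (w - w)\<^sup>2 * M.wp w"
        by (intro tendsto_intros isContD)
      moreover have "\<forall>\<^sub>F z in at w. (z - w)\<^sup>2 * M.wp z = (z - w)\<^sup>2 * L.wp z"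
        using L.eventually_not_mem[of w] M.eventually_not_mem[of w]
        by eventually_elim (use eq in \<open>simp add: f_def g_def\<close>)
      ultimately have "(\<lambda>z. (z - w)\<^sup>2 * L.wp z) \<midarrow>w\<rightarrow> (w - w)\<^sup>2 * M.wp w"
        by (rule Lim_transform_eventually)
      from LIM_unique[OF this L.wp_lim_at[OF w]] show False by simp
    qed
  qed
qed

lemma lattice_eq_of_invariants_eq:
  assumes "complex_lattice L" "complex_lattice M" "g2 L = g2 M" "g3 L = g3 M"
  shows "L = M"
  using lattice_le_of_invariants_eq[OF assms] lattice_le_of_invariants_eq[OF assms(2,1)] assms by auto

lemma complex_lattice_scale:
  assumes "complex_lattice L" "c \<noteq> 0"
  shows "complex_lattice ((*) c ` L)"
proof -
  interpret complex_lattice L by fact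
  show ?thesis
  proof
    show "0 \<in> (*) c ` L" using zero_mem by force
    show "a - b \<in> (*) c ` L" if "a \<in> (*) c ` L" "b \<in> (*) c ` L" for a b
    proof -
      obtain x y where xy: "x \<in> L" "y \<in> L" "a = c * x" "b = c * y" using \<open>a \<in> _\<close> \<open>b \<in> _\<close> by blast
      then have "a - b = c * (x - y)" by (simp add: algebra_simps)
      then show ?thesis using diff_mem[OF xy(1,2)] by blast
    qed
    have eq: "(*) c ` L - {0} = (*) c ` (L - {0})" using assms(2) by auto
    have "(\<lambda>\<omega>. 1 / norm c ^ 3 * (1 / norm \<omega> ^ 3)) summable_on (L - {0})"
      by (intro summable_on_cmult_right summable_cube)
    also have "?this \<longleftrightarrow> ((\<lambda>\<omega>. 1 / norm \<omega> ^ 3) \<circ> (*) c) summable_on (L - {0})"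
      by (simp add: o_def norm_mult power_mult_distrib)
    also have "\<dots> \<longleftrightarrow> (\<lambda>\<omega>. 1 / norm \<omega> ^ 3) summable_on (*) c ` (L - {0})"
      by (rule summable_on_reindex[symmetric]) (use assms(2) in \<open>auto simp: inj_on_def\<close>)
    finally show "(\<lambda>\<omega>. 1 / norm \<omega> ^ 3) summable_on (*) c ` L - {0}" unfolding eq .
    obtain K where K: "compact K" "\<forall>z. \<exists>\<omega>\<in>L. z - \<omega> \<in> K" using cocompact by blast
    have "\<exists>\<omega>\<in>(*) c ` L. z - \<omega> \<in> (*) c ` K" for z
    proof -
      obtain \<omega> where w: "\<omega> \<in> L" "z / c - \<omega> \<in> K" using K(2) by blast
      have "z - c * \<omega> = c * (z / c - \<omega>)" using assms(2) by (simp add: algebra_simps)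
      then show ?thesis using w by (intro bexI[of _ "c * \<omega>"]) auto
    qed
    moreover have "compact ((*) c ` K)"
      using K(1) by (intro compact_continuous_image continuous_intros)
    ultimately show "\<exists>K. compact K \<and> (\<forall>z. \<exists>\<omega>\<in>(*) c ` L. z - \<omega> \<in> K)" by blast
  qed
qed

lemma lattice_sum_scale:
  fixes c :: complex
  assumes "c \<noteq> 0"
  shows "(\<Sum>\<^sub>\<infinity>\<omega>\<in>(*) c ` L - {0}. 1 / \<omega> ^ k) = (\<Sum>\<^sub>\<infinity>\<omega>\<in>L - {0}. 1 / \<omega> ^ k) / c ^ k"
proof -
  have eq: "(*) c ` L - {0} = (*) c ` (L - {0})" using assms by auto
  have "(\<Sum>\<^sub>\<infinity>\<omega>\<in>(*) c ` L - {0}. 1 / \<omega> ^ k) = infsum ((\<lambda>\<omega>. 1 / \<omega> ^ k) \<circ> (*) c) (L - {0})"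
    unfolding eq by (rule infsum_reindex) (use assms in \<open>auto simp: inj_on_def\<close>)
  also have "(\<lambda>\<omega>. 1 / \<omega> ^ k) \<circ> (*) c = (\<lambda>\<omega>. 1 / c ^ k * (1 / \<omega> ^ k))"
    by (simp add: fun_eq_iff power_mult_distrib)
  also have "infsum \<dots> (L - {0}) = 1 / c ^ k * (\<Sum>\<^sub>\<infinity>\<omega>\<in>L - {0}. 1 / \<omega> ^ k)"
    by (rule infsum_cmult_right')
  finally show ?thesis by simp
qed

lemma g2_scale: "c \<noteq> 0 \<Longrightarrow> g2 ((*) c ` L) = g2 L / c ^ 4"
  and g3_scale: "c \<noteq> 0 \<Longrightarrow> g3 ((*) c ` L) = g3 L / c ^ 6"
  by (simp_all add: g2_def g3_def lattice_sum_scale)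

section \<open>The modular function on the upper half plane\<close>

abbreviation tau_lattice :: "complex \<Rightarrow> complex set" where
  "tau_lattice \<tau> \<equiv> int_span2 1 \<tau>"

abbreviation index_pairs :: "(int \<times> int) set" where
  "index_pairs \<equiv> UNIV - {(0, 0)}"

text \<open>Summing over integer pairs keeps the index set independent of \<tau>, so the sum is one
  of holomorphic functions of \<tau>.\<close>

definition eisenstein :: "nat \<Rightarrow> complex \<Rightarrow> complex" where
  "eisenstein k \<tau> = (\<Sum>\<^sub>\<infinity>(m, n)\<in>index_pairs. 1 / (of_int m + of_int n * \<tau>) ^ k)"

lemma summable_int_powr: "(\<lambda>k::int. (1 + \<bar>real_of_int k\<bar>) powr (- 3 / 2)) summable_on UNIV"
proof -
  let ?f = "\<lambda>k::int. (1 + \<bar>real_of_int k\<bar>) powr (- 3 / 2)"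
  have "summable (\<lambda>n::nat. real n powr (- 3 / 2))" by (simp add: summable_real_powr_iff)
  then have "summable (\<lambda>n::nat. real (Suc n) powr (- 3 / 2))"
    by (subst summable_Suc_iff)
  then have "(\<lambda>n::nat. real (Suc n) powr (- 3 / 2)) summable_on UNIV"
    by (subst summable_on_UNIV_nonneg_real_iff) auto
  then have *: "(\<lambda>n::nat. (1 + real n) powr (- 3 / 2)) summable_on UNIV"
    by simp
  have "?f summable_on range int"
    by (subst summable_on_reindex) (use * in \<open>auto simp: o_def\<close>)
  moreover have "?f summable_on range (\<lambda>n. - int n)"
    by (subst summable_on_reindex) (use * in \<open>auto simp: o_def inj_on_def\<close>)
  ultimately have "?f summable_on range int \<union> range (\<lambda>n. - int n)"
    by (rule summable_on_union)
  moreover have "range int \<union> range (\<lambda>n. - int n) = UNIV"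
  proof -
    have "k \<in> range int \<union> range (\<lambda>n. - int n)" for k
      by (cases k rule: int_cases2) auto
    then show ?thesis by blast
  qed
  ultimately show ?thesis by simp
qed

text \<open>Since (1 + |m|)(1 + |n|) <= (1 + |m| + |n|)^2, the cube dominates a product of powers
  with exponent 3/2, whose double series splits into two convergent ones. The factor 8 comes from 1
  + s <= 2 s for s >= 1.\<close>

lemma summable_index_pairs_cube:
  "(\<lambda>(m, n). 1 / (\<bar>real_of_int m\<bar> + \<bar>real_of_int n\<bar>) ^ 3) summable_on index_pairs"
proof -
  let ?f = "\<lambda>k::int. (1 + \<bar>real_of_int k\<bar>) powr (- 3 / 2)"
  have "(\<lambda>(m, n). ?f m * ?f n) summable_on UNIV \<times> UNIV"
  proof (rule summable_on_SigmaI)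
    show "((\<lambda>n. case (m, n) of (m, n) \<Rightarrow> ?f m * ?f n) has_sum (?f m * infsum ?f UNIV)) UNIV" for m
      using has_sum_cmult_right[OF has_sum_infsum[OF summable_int_powr], of "?f m"] by simp
    show "(\<lambda>m. ?f m * infsum ?f UNIV) summable_on UNIV"
      by (rule summable_on_cmult_left[OF summable_int_powr])
  qed auto
  then have "(\<lambda>(m, n). ?f m * ?f n) summable_on index_pairs"
    by (rule summable_on_subset_banach) auto
  from summable_on_cmult_right[OF this, of 8]
  have M: "(\<lambda>x. 8 * (case x of (m, n) \<Rightarrow> ?f m * ?f n)) summable_on index_pairs" .
  show ?thesis
  proof (rule summable_on_comparison_test[OF M])
    fix x :: "int \<times> int" assume x: "x \<in> index_pairs"
    obtain m n where mn: "x = (m, n)" by (cases x)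
    define a where "a = \<bar>real_of_int m\<bar>"
    define b where "b = \<bar>real_of_int n\<bar>"
    have ab: "a \<ge> 0" "b \<ge> 0" by (auto simp: a_def b_def)
    have "m \<noteq> 0 \<or> n \<noteq> 0" using x mn by auto
    then have "1 \<le> \<bar>m\<bar> + \<bar>n\<bar>" by linarith
    then have "real_of_int 1 \<le> real_of_int (\<bar>m\<bar> + \<bar>n\<bar>)" by (simp only: of_int_le_iff)
    then have ge1: "a + b \<ge> 1" by (simp add: a_def b_def)
    have "(1 + a) * (1 + b) \<le> (1 + a + b)\<^sup>2" using ab by (simp add: power2_eq_square algebra_simps)
    then have "((1 + a) * (1 + b)) powr (3 / 2) \<le> ((1 + a + b)\<^sup>2) powr (3 / 2)"
      using ab by (intro powr_mono2) auto
    also have "\<dots> = (1 + a + b) ^ 3"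
    proof -
      have pos: "1 + a + b \<ge> 0" using ab by simp
      have "((1 + a + b)\<^sup>2) powr (3 / 2) = ((1 + a + b) powr 2) powr (3 / 2)"
        using powr_numeral[OF pos, of "num.Bit0 num.One"] by (simp only:)
      also have "\<dots> = (1 + a + b) powr 3" unfolding powr_powr by simp
      also have "\<dots> = (1 + a + b) ^ 3" by (rule powr_numeral[OF pos])
      finally show ?thesis .
    qed
    also have "\<dots> \<le> (2 * (a + b)) ^ 3" using ge1 ab by (intro power_mono) auto
    also have "\<dots> = 8 * (a + b) ^ 3" unfolding power_mult_distrib by simp
    finally have "((1 + a) * (1 + b)) powr (3 / 2) \<le> 8 * (a + b) ^ 3" .
    moreover have "((1 + a) * (1 + b)) powr (3 / 2) > 0" using ab by (simp add: add_pos_nonneg)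
    ultimately have "1 / (8 * (a + b) ^ 3) \<le> 1 / (((1 + a) * (1 + b)) powr (3 / 2))"
      using ge1 by (intro divide_left_mono mult_pos_pos) auto
    also have "\<dots> = (1 + a) powr (- 3 / 2) * (1 + b) powr (- 3 / 2)"
      using ab by (simp add: powr_mult powr_minus_divide)
    finally show "(case x of (m, n) \<Rightarrow> 1 / (\<bar>real_of_int m\<bar> + \<bar>real_of_int n\<bar>) ^ 3)
       \<le> 8 * (case x of (m, n) \<Rightarrow> ?f m * ?f n)"
      by (simp add: mn a_def b_def)
    show "0 \<le> (case x of (m, n) \<Rightarrow> 1 / (\<bar>real_of_int m\<bar> + \<bar>real_of_int n\<bar>) ^ 3)"
      by (simp add: mn)
  qed
qed

text \<open>The imaginary part controls n, and then the real part controls m, uniformly in \<tau> on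
  the region. The bound serves both for convergence and for the finiteness behind proper
  discontinuity.\<close>

lemma lattice_point_lower_bound:
  assumes "\<eta> > 0" "Im \<tau> \<ge> \<eta>" "\<bar>Re \<tau>\<bar> \<le> B"
  shows "\<bar>real_of_int m\<bar> + \<bar>real_of_int n\<bar> \<le> (1 + (B + 1) / \<eta>) * norm (of_int m + of_int n * \<tau>)"
proof -
  define w where "w = of_int m + of_int n * \<tau>"
  have "\<bar>real_of_int n\<bar> * \<eta> \<le> \<bar>real_of_int n\<bar> * Im \<tau>" using assms by (intro mult_left_mono) auto
  also have "\<dots> = \<bar>Im w\<bar>" using assms by (simp add: w_def abs_mult)
  also have "\<dots> \<le> norm w" by (rule abs_Im_le_cmod)
  finally have n: "\<bar>real_of_int n\<bar> \<le> norm w / \<eta>" using assms(1) by (simp add: field_simps)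
  have "real_of_int m = Re w - real_of_int n * Re \<tau>" by (simp add: w_def)
  then have "\<bar>real_of_int m\<bar> \<le> \<bar>Re w\<bar> + \<bar>real_of_int n\<bar> * \<bar>Re \<tau>\<bar>"
    by (simp add: abs_mult[symmetric])
  also have "\<dots> \<le> norm w + norm w / \<eta> * B"
    using n assms by (intro add_mono mult_mono abs_Re_le_cmod) auto
  finally have "\<bar>real_of_int m\<bar> + \<bar>real_of_int n\<bar> \<le> norm w + norm w / \<eta> * B + norm w / \<eta>"
    using n by simp
  also have "\<dots> = (1 + (B + 1) / \<eta>) * norm w" by (simp add: algebra_simps add_divide_distrib)
  finally show ?thesis by (simp only: w_def)
qed

lemma eisenstein_term_bound:
  assumes "\<eta> > 0" "Im \<tau> \<ge> \<eta>" "\<bar>Re \<tau>\<bar> \<le> B" "k \<ge> 3" "x \<in> index_pairs"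
  shows "norm (case x of (m, n) \<Rightarrow> 1 / (of_int m + of_int n * \<tau>) ^ k)
      \<le> (1 + (B + 1) / \<eta>) ^ k * (case x of (m, n) \<Rightarrow> 1 / (\<bar>real_of_int m\<bar> + \<bar>real_of_int n\<bar>) ^ 3)"
proof -
  obtain m n where mn: "x = (m, n)" by (cases x)
  define C where "C = 1 + (B + 1) / \<eta>"
  define s where "s = \<bar>real_of_int m\<bar> + \<bar>real_of_int n\<bar>"
  define w where "w = norm (of_int m + of_int n * \<tau>)"
  have "m \<noteq> 0 \<or> n \<noteq> 0" using assms(5) mn by auto
  then have "1 \<le> \<bar>m\<bar> + \<bar>n\<bar>" by linarith
  then have "real_of_int 1 \<le> real_of_int (\<bar>m\<bar> + \<bar>n\<bar>)" by (simp only: of_int_le_iff)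
  then have s: "s \<ge> 1" by (simp add: s_def)
  have B: "B \<ge> 0" using assms(3) by linarith
  have C: "C > 0" using B assms(1) by (auto simp: C_def intro!: add_pos_nonneg)
  have sw: "s \<le> C * w"
    unfolding s_def C_def w_def by (rule lattice_point_lower_bound[OF assms(1-3)])
  have "C * w > 0" using s sw by linarith
  then have w: "w > 0" using C by (simp add: zero_less_mult_iff)
  have "s ^ 3 \<le> s ^ k" using s assms(4) by (rule power_increasing[rotated])
  also have "\<dots> \<le> (C * w) ^ k" using sw s by (intro power_mono) auto
  finally have "1 / w ^ k \<le> C ^ k / s ^ 3" using w s C by (simp add: field_simps power_mult_distrib)
  then show ?thesis by (simp add: mn norm_divide norm_power w_def s_def C_def)
qed

lemma eisenstein_holomorphic:
  assumes "k \<ge> 3"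
  shows "eisenstein k holomorphic_on {z. Im z > 0}"
proof -
  have "eisenstein k field_differentiable at z" if z: "Im z > 0" for z
  proof -
    define S where "S = {w. Im w > Im z / 2} \<inter> {w. Re w < \<bar>Re z\<bar> + 1} \<inter> {w. Re w > - (\<bar>Re z\<bar> + 1)}"
    have "open S"
      unfolding S_def by (intro open_Int open_halfspace_Im_gt open_halfspace_Re_lt open_halfspace_Re_gt)
    moreover have "z \<in> S" using z by (auto simp: S_def)
    ultimately have S: "open S" "z \<in> S" by blast+
    have "(\<lambda>\<tau>. \<Sum>\<^sub>\<infinity>x\<in>index_pairs. (case x of (m, n) \<Rightarrow> 1 / (of_int m + of_int n * \<tau>) ^ k)) holomorphic_on S"
    proof (rule holomorphic_infsum(1))
      show "(\<lambda>x. (1 + ((\<bar>Re z\<bar> + 1) + 1) / (Im z / 2)) ^ k *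
          (case x of (m, n) \<Rightarrow> 1 / (\<bar>real_of_int m\<bar> + \<bar>real_of_int n\<bar>) ^ 3)) summable_on index_pairs"
        by (intro summable_on_cmult_right summable_index_pairs_cube)
      show "norm (case x of (m, n) \<Rightarrow> 1 / (of_int m + of_int n * \<tau>) ^ k)
         \<le> (1 + ((\<bar>Re z\<bar> + 1) + 1) / (Im z / 2)) ^ k *
          (case x of (m, n) \<Rightarrow> 1 / (\<bar>real_of_int m\<bar> + \<bar>real_of_int n\<bar>) ^ 3)"
        if "x \<in> index_pairs" "\<tau> \<in> S" for x \<tau>
        by (rule eisenstein_term_bound) (use that z assms in \<open>auto simp: S_def\<close>)
      fix x assume x: "x \<in> index_pairs"
      obtain m n where mn: "x = (m, n)" by (cases x)
      have "of_int m + of_int n * \<tau> \<noteq> 0" if "\<tau> \<in> S" for \<tau>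
      proof
        assume "of_int m + of_int n * \<tau> = 0"
        then have "norm (of_int m + of_int n * \<tau>) = 0" by simp
        moreover have "Im \<tau> > 0" using that z by (simp add: S_def)
        ultimately have "\<bar>real_of_int m\<bar> + \<bar>real_of_int n\<bar> \<le> 0"
          using lattice_point_lower_bound[of "Im \<tau>" \<tau> "\<bar>Re \<tau>\<bar>" m n] by simp
        then show False using x mn by auto
      qed
      then show "(\<lambda>\<tau>. case x of (m, n) \<Rightarrow> 1 / (of_int m + of_int n * \<tau>) ^ k) holomorphic_on S"
        unfolding mn prod.case by (intro holomorphic_intros) auto
    qed (rule S(1))
    then have "eisenstein k holomorphic_on S" by (simp add: eisenstein_def[abs_def])
    then show ?thesis using S by (rule holomorphic_on_imp_differentiable_at)
  qed
  then show ?thesis by (simp add: holomorphic_on_def field_differentiable_at_within)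
qed

text \<open>The bound is uniform as Im \<tau> grows; it is what makes the singularity at q = 0
  removable.\<close>

lemma eisenstein_bounded:
  assumes "k \<ge> 3" "\<eta> > 0"
  shows "\<exists>M. \<forall>\<tau>. Im \<tau> \<ge> \<eta> \<longrightarrow> \<bar>Re \<tau>\<bar> \<le> B \<longrightarrow> norm (eisenstein k \<tau>) \<le> M"
proof -
  define f where "f = (\<lambda>x. (1 + (B + 1) / \<eta>) ^ k *
      (case x of (m, n) \<Rightarrow> 1 / (\<bar>real_of_int m\<bar> + \<bar>real_of_int n\<bar>) ^ 3))"
  have f: "f summable_on index_pairs"
    unfolding f_def by (intro summable_on_cmult_right summable_index_pairs_cube)
  have "norm (eisenstein k \<tau>) \<le> infsum f index_pairs" if "Im \<tau> \<ge> \<eta>" "\<bar>Re \<tau>\<bar> \<le> B" for \<tau>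
    unfolding eisenstein_def
  proof (rule norm_infsum_le)
    show "(f has_sum infsum f index_pairs) index_pairs" using f by (rule has_sum_infsum)
    have le: "norm (case x of (m, n) \<Rightarrow> 1 / (of_int m + of_int n * \<tau>) ^ k) \<le> f x" if "x \<in> index_pairs" for x
      unfolding f_def by (rule eisenstein_term_bound) (use that assms \<open>Im \<tau> \<ge> \<eta>\<close> \<open>\<bar>Re \<tau>\<bar> \<le> B\<close> in auto)
    then show "\<And>x. x \<in> index_pairs \<Longrightarrow> norm (case x of (m, n) \<Rightarrow> 1 / (of_int m + of_int n * \<tau>) ^ k) \<le> f x" .
    have "(\<lambda>x. case x of (m, n) \<Rightarrow> 1 / (of_int m + of_int n * \<tau>) ^ k) summable_on index_pairs"
      using Infinite_Sum.abs_summable_on_comparison_test'[OF f le] by (rule abs_summable_summable)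
    then show "((\<lambda>x. case x of (m, n) \<Rightarrow> 1 / (of_int m + of_int n * \<tau>) ^ k) has_sum
        (\<Sum>\<^sub>\<infinity>x\<in>index_pairs. case x of (m, n) \<Rightarrow> 1 / (of_int m + of_int n * \<tau>) ^ k)) index_pairs"
      by (rule has_sum_infsum)
  qed
  then show ?thesis by blast
qed

lemma lattice_coords_unique:
  assumes "Im \<tau> \<noteq> 0" "of_int m + of_int n * \<tau> = of_int m' + of_int n' * \<tau>"
  shows "m = m'" "n = n'"
proof -
  have "Im (of_int m + of_int n * \<tau>) = Im (of_int m' + of_int n' * \<tau>)" using assms(2) by simp
  then show n: "n = n'" using assms(1) by simp
  show "m = m'" using assms(2) by (simp add: n)
qed

lemma tau_lattice_alt: "tau_lattice \<tau> = (\<lambda>(m, n). of_int m + of_int n * \<tau>) ` UNIV"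
  by (auto simp: int_span2_def)

lemma tau_latticeI: "of_int m + of_int n * \<tau> \<in> tau_lattice \<tau>"
  unfolding tau_lattice_alt by force

lemma tau_latticeE:
  assumes "x \<in> tau_lattice \<tau>"
  obtains m n where "x = of_int m + of_int n * \<tau>"
  using assms unfolding tau_lattice_alt by auto

lemma tau_lattice_minus_0:
  assumes "Im \<tau> > 0"
  shows "tau_lattice \<tau> - {0} = (\<lambda>(m, n). of_int m + of_int n * \<tau>) ` index_pairs"
    and "inj_on (\<lambda>(m, n). of_int m + of_int n * \<tau>) index_pairs"
proof -
  have inj: "inj (\<lambda>(m, n). of_int m + of_int n * \<tau>)"
    using lattice_coords_unique[of \<tau>] assms by (auto simp: inj_on_def)
  then show "inj_on (\<lambda>(m, n). of_int m + of_int n * \<tau>) index_pairs" by (rule inj_on_subset) auto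
  have "(\<lambda>(m, n). of_int m + of_int n * \<tau>) ` index_pairs
     = (\<lambda>(m, n). of_int m + of_int n * \<tau>) ` UNIV - (\<lambda>(m, n). of_int m + of_int n * \<tau>) ` {(0, 0)}"
    by (rule image_set_diff[OF inj])
  then show "tau_lattice \<tau> - {0} = (\<lambda>(m, n). of_int m + of_int n * \<tau>) ` index_pairs"
    unfolding tau_lattice_alt by simp
qed

lemma lattice_sum_eisenstein:
  assumes "Im \<tau> > 0"
  shows "(\<Sum>\<^sub>\<infinity>\<omega>\<in>tau_lattice \<tau> - {0}. 1 / \<omega> ^ k) = eisenstein k \<tau>"
  unfolding tau_lattice_minus_0(1)[OF assms] eisenstein_def
  by (subst infsum_reindex[OF tau_lattice_minus_0(2)[OF assms]]) (simp add: o_def case_prod_unfold)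

lemma g2_tau: "Im \<tau> > 0 \<Longrightarrow> g2 (tau_lattice \<tau>) = 60 * eisenstein 4 \<tau>"
  and g3_tau: "Im \<tau> > 0 \<Longrightarrow> g3 (tau_lattice \<tau>) = 140 * eisenstein 6 \<tau>"
  by (simp_all add: g2_def g3_def lattice_sum_eisenstein)

lemma complex_lattice_tau:
  assumes "Im \<tau> > 0"
  shows "complex_lattice (tau_lattice \<tau>)"
proof
  show "0 \<in> tau_lattice \<tau>" unfolding int_span2_def by (auto intro!: exI[of _ 0])
  show "a - b \<in> tau_lattice \<tau>" if ab: "a \<in> tau_lattice \<tau>" "b \<in> tau_lattice \<tau>" for a b
  proof -
    obtain m n m' n' where "a = of_int m * 1 + of_int n * \<tau>" "b = of_int m' * 1 + of_int n' * \<tau>"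
      using ab unfolding int_span2_def by blast
    then have "a - b = of_int (m - m') * 1 + of_int (n - n') * \<tau>" by (simp add: algebra_simps)
    then show ?thesis unfolding int_span2_def by blast
  qed
  have "(\<lambda>(m, n). 1 / norm (of_int m + of_int n * \<tau>) ^ 3) summable_on index_pairs"
  proof (rule summable_on_comparison_test)
    show "(\<lambda>x. (1 + (\<bar>Re \<tau>\<bar> + 1) / Im \<tau>) ^ 3 *
          (case x of (m, n) \<Rightarrow> 1 / (\<bar>real_of_int m\<bar> + \<bar>real_of_int n\<bar>) ^ 3)) summable_on index_pairs"
      by (intro summable_on_cmult_right summable_index_pairs_cube)
    fix x assume x: "x \<in> index_pairs"
    show "(case x of (m, n) \<Rightarrow> 1 / norm (of_int m + of_int n * \<tau>) ^ 3)
      \<le> (1 + (\<bar>Re \<tau>\<bar> + 1) / Im \<tau>) ^ 3 *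
          (case x of (m, n) \<Rightarrow> 1 / (\<bar>real_of_int m\<bar> + \<bar>real_of_int n\<bar>) ^ 3)"
      using eisenstein_term_bound[OF assms order_refl order_refl _ x, of 3]
      by (simp add: case_prod_unfold norm_divide norm_power)
  qed auto
  then have "((\<lambda>\<omega>. 1 / norm \<omega> ^ 3) \<circ> (\<lambda>(m, n). of_int m + of_int n * \<tau>)) summable_on index_pairs"
    by (simp add: o_def case_prod_unfold)
  then show "(\<lambda>\<omega>. 1 / norm \<omega> ^ 3) summable_on tau_lattice \<tau> - {0}"
    unfolding tau_lattice_minus_0(1)[OF assms]
    by (subst summable_on_reindex[OF tau_lattice_minus_0(2)[OF assms]])
  have "\<exists>\<omega>\<in>tau_lattice \<tau>. z - \<omega> \<in> cball 0 (1 + norm \<tau>)" for z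
  proof -
    define t where "t = Im z / Im \<tau>"
    define s where "s = Re z - t * Re \<tau>"
    have z: "z = of_real s + of_real t * \<tau>"
      using assms by (simp add: complex_eq_iff s_def t_def)
    define \<omega> where "\<omega> = of_int \<lfloor>s\<rfloor> * 1 + of_int \<lfloor>t\<rfloor> * \<tau>"
    have "z - \<omega> = of_real (frac s) + of_real (frac t) * \<tau>"
      unfolding z \<omega>_def frac_def by (simp add: algebra_simps)
    also have "norm \<dots> \<le> frac s + frac t * norm \<tau>"
      by (rule norm_triangle_le) (simp add: norm_mult frac_ge_0)
    also have "\<dots> \<le> 1 + 1 * norm \<tau>"
      by (intro add_mono mult_right_mono) (auto intro: less_imp_le frac_lt_1)
    finally have "z - \<omega> \<in> cball 0 (1 + norm \<tau>)" by simp
    moreover have "\<omega> \<in> tau_lattice \<tau>" unfolding \<omega>_def int_span2_def by blast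
    ultimately show ?thesis by blast
  qed
  then show "\<exists>K. compact K \<and> (\<forall>z. \<exists>\<omega>\<in>tau_lattice \<tau>. z - \<omega> \<in> K)"
    by (intro exI[of _ "cball 0 (1 + norm \<tau>)"]) auto
qed

lemma discriminant_tau_nonzero:
  assumes "Im \<tau> > 0"
  shows "g2 (tau_lattice \<tau>) ^ 3 - 27 * g3 (tau_lattice \<tau>) ^ 2 \<noteq> 0"
proof -
  interpret complex_lattice "tau_lattice \<tau>" by (rule complex_lattice_tau[OF assms])
  have mem: "of_int m + of_int n * \<tau> \<in> tau_lattice \<tau>" for m n
    unfolding tau_lattice_alt by force
  have notmem: "(of_int m + of_int n * \<tau>) / 2 \<notin> tau_lattice \<tau>" if "odd m \<or> odd n" for m n
  proof
    assume "(of_int m + of_int n * \<tau>) / 2 \<in> tau_lattice \<tau>"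
    then obtain m' n' where "(of_int m + of_int n * \<tau>) / 2 = of_int m' + of_int n' * \<tau>"
      unfolding tau_lattice_alt by force
    then have "of_int m + of_int n * \<tau> = of_int (2 * m') + of_int (2 * n') * \<tau>"
      by (simp add: field_simps)
    from lattice_coords_unique[OF _ this] assms that show False by simp
  qed
  show ?thesis
  proof (rule discriminant_nonzero[of "1 / 2" "\<tau> / 2"])
    show "1 / 2 \<notin> tau_lattice \<tau>" using notmem[of 1 0] by simp
    show "\<tau> / 2 \<notin> tau_lattice \<tau>" using notmem[of 0 1] by simp
    show "1 / 2 + \<tau> / 2 \<notin> tau_lattice \<tau>" using notmem[of 1 1] by (simp add: add_divide_distrib)
    show "2 * (1 / 2) \<in> tau_lattice \<tau>" using mem[of 1 0] by simp
    show "2 * (\<tau> / 2) \<in> tau_lattice \<tau>" using mem[of 0 1] by simp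
  qed
qed

section \<open>Holomorphy and modular invariance of \<open>klein_j\<close>\<close>

abbreviation upper_half_plane :: "complex set" ("\<H>") where
  "\<H> \<equiv> {z. Im z > 0}"

lemma open_upper_half_plane: "open \<H>"
  by (rule open_halfspace_Im_gt)

lemma convex_upper_half_plane: "convex \<H>"
  by (rule convex_halfspace_Im_gt)

lemma klein_j_holomorphic: "klein_j holomorphic_on \<H>"
proof -
  have "(\<lambda>z. 1728 * (60 * eisenstein 4 z) ^ 3 / ((60 * eisenstein 4 z) ^ 3 - 27 * (140 * eisenstein 6 z)\<^sup>2)) holomorphic_on \<H>"
  proof (intro holomorphic_intros eisenstein_holomorphic)
    show "(60 * eisenstein 4 z) ^ 3 - 27 * (140 * eisenstein 6 z)\<^sup>2 \<noteq> 0" if "z \<in> \<H>" for z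
      using discriminant_tau_nonzero[of z] that by (simp only: g2_tau g3_tau mem_Collect_eq not_False_eq_True)
  qed auto
  then show ?thesis
    by (rule holomorphic_transform) (simp add: klein_j_def lattice_j_def g2_tau g3_tau)
qed

definition moebius_int :: "int \<Rightarrow> int \<Rightarrow> int \<Rightarrow> int \<Rightarrow> complex \<Rightarrow> complex" where
  "moebius_int a b c d z = (of_int a * z + of_int b) / (of_int c * z + of_int d)"

lemma moebius_denom_nonzero:
  assumes "a * d - b * c = (1::int)" "Im z > 0"
  shows "of_int c * z + of_int d \<noteq> 0"
proof
  assume "of_int c * z + of_int d = 0"
  then have "of_int d + of_int c * z = of_int 0 + of_int 0 * z" by (simp add: add.commute)
  from lattice_coords_unique[OF _ this] assms show False by simp
qed

lemma Im_moebius_int: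
  assumes "a * d - b * c = (1::int)"
  shows "Im (moebius_int a b c d z) = Im z / (norm (of_int c * z + of_int d))\<^sup>2"
proof -
  have "Im (moebius_int a b c d z) = (a * d - b * c) * Im z / (norm (of_int c * z + of_int d))\<^sup>2"
    unfolding moebius_int_def by (simp add: Im_divide cmod_power2) (simp add: algebra_simps)
  then show ?thesis using assms by simp
qed

lemma moebius_int_upper:
  assumes "a * d - b * c = (1::int)" "Im z > 0"
  shows "Im (moebius_int a b c d z) > 0"
  using moebius_denom_nonzero[OF assms] assms by (simp add: Im_moebius_int)

lemma moebius_int_lattice:
  assumes det: "a * d - b * c = (1::int)" and z: "Im z > 0"
  shows "tau_lattice (moebius_int a b c d z) = (*) (1 / (of_int c * z + of_int d)) ` tau_lattice z"
proof -
  define \<alpha> where "\<alpha> = of_int c * z + of_int d"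
  have \<alpha>: "\<alpha> \<noteq> 0" using moebius_denom_nonzero[OF assms] by (simp add: \<alpha>_def)
  have w: "moebius_int a b c d z = (of_int a * z + of_int b) / \<alpha>" by (simp add: moebius_int_def \<alpha>_def)
  have det': "of_int a * of_int d - of_int b * of_int c = (1::complex)"
    using det by (metis of_int_1 of_int_diff of_int_mult)
  show ?thesis
    unfolding \<alpha>_def[symmetric] w
  proof (intro equalityI subsetI)
    fix x assume "x \<in> tau_lattice ((of_int a * z + of_int b) / \<alpha>)"
    then obtain m n where x: "x = of_int m + of_int n * ((of_int a * z + of_int b) / \<alpha>)"
      unfolding tau_lattice_alt by force
    have "x = 1 / \<alpha> * (of_int (m * d + n * b) + of_int (m * c + n * a) * z)"
      unfolding x using \<alpha> by (simp add: field_simps) (simp add: \<alpha>_def algebra_simps)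
    then show "x \<in> (*) (1 / \<alpha>) ` tau_lattice z" using tau_latticeI by blast
  next
    fix x assume "x \<in> (*) (1 / \<alpha>) ` tau_lattice z"
    then obtain m n where x: "x = 1 / \<alpha> * (of_int m + of_int n * z)"
      unfolding tau_lattice_alt by force
    \<comment> \<open>The coefficients come from the inverse of the integer matrix.\<close>
    have 1: "of_int m + of_int n * z = of_int (a * m - b * n) * \<alpha> + of_int (d * n - c * m) * (of_int a * z + of_int b)"
    proof -
      have "of_int (a * m - b * n) * \<alpha> + of_int (d * n - c * m) * (of_int a * z + of_int b)
        = (of_int a * of_int d - of_int b * of_int c) * (of_int m + of_int n * z)"
        by (simp add: \<alpha>_def algebra_simps)
      then show ?thesis by (simp add: det')
    qed
    have "x = of_int (a * m - b * n) + of_int (d * n - c * m) * ((of_int a * z + of_int b) / \<alpha>)"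
      unfolding x 1 using \<alpha> by (simp add: field_simps)
    then show "x \<in> tau_lattice ((of_int a * z + of_int b) / \<alpha>)" by (simp only: tau_latticeI)
  qed
qed

lemma lattice_j_scale:
  assumes "c \<noteq> 0"
  shows "lattice_j ((*) c ` L) = lattice_j L"
proof -
  have "(g2 L / c ^ 4) ^ 3 = g2 L ^ 3 / c ^ 12" "(g3 L / c ^ 6)\<^sup>2 = (g3 L)\<^sup>2 / c ^ 12"
    by (simp_all add: power_divide power_mult[symmetric])
  then show ?thesis
    using assms by (simp add: lattice_j_def g2_scale g3_scale diff_divide_distrib[symmetric])
qed

lemma klein_j_moebius:
  assumes "a * d - b * c = (1::int)" "Im z > 0"
  shows "klein_j (moebius_int a b c d z) = klein_j z"
  unfolding klein_j_def moebius_int_lattice[OF assms]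
  by (rule lattice_j_scale) (use moebius_denom_nonzero[OF assms] in simp)

section \<open>Lattices with equal invariants\<close>

lemma exists_nth_root:
  fixes w :: complex
  assumes "n > 0"
  shows "\<exists>z. z ^ n = w"
proof (cases "w = 0")
  case True
  then show ?thesis using assms by (intro exI[of _ 0]) simp
next
  case False
  have "exp (Ln w / of_nat n) ^ n = exp (of_nat n * (Ln w / of_nat n))"
    by (rule exp_of_nat_mult[symmetric])
  also have "\<dots> = w" using False assms by simp
  finally show ?thesis by blast
qed

text \<open>Equal \<open>j\<close> means A^3 B'^2 = A'^3 B^2. A fourth root \<nu> of A / A' scales
  \<open>g2\<close> correctly and \<open>g3\<close> up to sign; replacing \<nu> by i \<nu> keeps the
  fourth power and flips the sixth. If A' = 0 then A = 0, and a sixth root of B / B' is taken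
  instead.\<close>

lemma klein_j_eq_imp_homothetic:
  assumes z: "Im z > 0" and w: "Im w > 0" and eq: "klein_j z = klein_j w"
  shows "\<exists>\<mu>. \<mu> \<noteq> 0 \<and> tau_lattice z = (*) \<mu> ` tau_lattice w"
proof -
  define A B A' B' where "A = g2 (tau_lattice z)" and "B = g3 (tau_lattice z)"
    and "A' = g2 (tau_lattice w)" and "B' = g3 (tau_lattice w)"
  have D: "A ^ 3 - 27 * B\<^sup>2 \<noteq> 0" "A' ^ 3 - 27 * B'\<^sup>2 \<noteq> 0"
    using discriminant_tau_nonzero z w by (simp_all add: A_def B_def A'_def B'_def)
  have "1728 * A ^ 3 / (A ^ 3 - 27 * B\<^sup>2) = 1728 * A' ^ 3 / (A' ^ 3 - 27 * B'\<^sup>2)"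
    using eq by (simp add: klein_j_def lattice_j_def A_def B_def A'_def B'_def)
  then have "A ^ 3 * (A' ^ 3 - 27 * B'\<^sup>2) = A' ^ 3 * (A ^ 3 - 27 * B\<^sup>2)"
    using D by (simp add: frac_eq_eq)
  then have cross: "A ^ 3 * B'\<^sup>2 = A' ^ 3 * B\<^sup>2" by (simp add: algebra_simps)
  have "\<exists>\<nu>. \<nu> \<noteq> 0 \<and> A = A' * \<nu> ^ 4 \<and> B = B' * \<nu> ^ 6"
  proof (cases "A' = 0")
    case True
    then have B': "B' \<noteq> 0" using D by auto
    then have A: "A = 0" using cross True by simp
    then have B: "B \<noteq> 0" using D by auto
    obtain \<nu> where \<nu>: "\<nu> ^ 6 = B / B'" using exists_nth_root[of 6 "B / B'"] by auto
    then have "\<nu> \<noteq> 0" using B B' by auto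
    then show ?thesis using \<nu> A True B' by (intro exI[of _ \<nu>]) simp
  next
    case False
    have A: "A \<noteq> 0"
    proof
      assume "A = 0"
      then have "B = 0" using cross False by simp
      then show False using D \<open>A = 0\<close> by simp
    qed
    obtain \<nu> where \<nu>: "\<nu> ^ 4 = A / A'" using exists_nth_root[of 4 "A / A'"] by auto
    have \<nu>0: "\<nu> \<noteq> 0" using \<nu> A False by auto
    have A4: "A = A' * \<nu> ^ 4" using \<nu> False by simp
    have "A' ^ 3 * B\<^sup>2 = A' ^ 3 * (B' * \<nu> ^ 6)\<^sup>2"
      unfolding cross[symmetric] A4 by (simp add: power_mult_distrib power_mult[symmetric])
    then have "B\<^sup>2 = (B' * \<nu> ^ 6)\<^sup>2" using False by simp
    then consider "B = B' * \<nu> ^ 6" | "B = - (B' * \<nu> ^ 6)" by (auto simp: power2_eq_iff)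
    then show ?thesis
    proof cases
      case 1
      then show ?thesis using \<nu>0 A4 by blast
    next
      case 2
      have "\<i> ^ 4 = 1" "\<i> ^ 6 = - 1" by (simp_all add: eval_nat_numeral)
      then have "(\<i> * \<nu>) ^ 4 = \<nu> ^ 4" "(\<i> * \<nu>) ^ 6 = - (\<nu> ^ 6)"
        by (simp_all add: power_mult_distrib)
      then show ?thesis using \<nu>0 A4 2 by (intro exI[of _ "\<i> * \<nu>"]) simp
    qed
  qed
  then obtain \<nu> where \<nu>: "\<nu> \<noteq> 0" "A = A' * \<nu> ^ 4" "B = B' * \<nu> ^ 6" by blast
  define \<mu> where "\<mu> = 1 / \<nu>"
  have \<mu>: "\<mu> \<noteq> 0" using \<nu> by (simp add: \<mu>_def)
  have "tau_lattice z = (*) \<mu> ` tau_lattice w"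
  proof (rule lattice_eq_of_invariants_eq)
    show "complex_lattice (tau_lattice z)" by (rule complex_lattice_tau[OF z])
    show "complex_lattice ((*) \<mu> ` tau_lattice w)"
      by (rule complex_lattice_scale[OF complex_lattice_tau[OF w] \<mu>])
    show "g2 (tau_lattice z) = g2 ((*) \<mu> ` tau_lattice w)"
      unfolding g2_scale[OF \<mu>] using \<nu> by (simp add: A_def A'_def \<mu>_def power_one_over)
    show "g3 (tau_lattice z) = g3 ((*) \<mu> ` tau_lattice w)"
      unfolding g3_scale[OF \<mu>] using \<nu> by (simp add: B_def B'_def \<mu>_def power_one_over)
  qed
  then show ?thesis using \<mu> by blast
qed

text \<open>A homothety carries the basis 1, w to another basis of the lattice of \<open>z\<close>.
  The change of basis and its inverse are integral, so the determinant is a unit, and positivity of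
  both imaginary parts fixes its sign.\<close>

theorem klein_j_eq_imp_equivalent:
  assumes z: "Im z > 0" and w: "Im w > 0" and eq: "klein_j z = klein_j w"
  obtains a b c d where "a * d - b * c = (1::int)" "z = moebius_int a b c d w"
proof -
  obtain \<mu> where \<mu>: "\<mu> \<noteq> 0" and L: "tau_lattice z = (*) \<mu> ` tau_lattice w"
    using klein_j_eq_imp_homothetic[OF assms] by blast
  have "1 \<in> tau_lattice z" using tau_latticeI[of 1 0 z] by simp
  then obtain x where x: "x \<in> tau_lattice w" "1 = \<mu> * x" unfolding L by blast
  obtain d c where "x = of_int d + of_int c * w" using x(1) by (rule tau_latticeE)
  with x(2) have cd: "1 = \<mu> * (of_int d + of_int c * w)" by (simp only:)
  have "z \<in> tau_lattice z" using tau_latticeI[of 0 1 z] by simp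
  then obtain x where x: "x \<in> tau_lattice w" "z = \<mu> * x" unfolding L by blast
  obtain b a where "x = of_int b + of_int a * w" using x(1) by (rule tau_latticeE)
  with x(2) have ab: "z = \<mu> * (of_int b + of_int a * w)" by (simp only:)
  have "\<mu> * 1 \<in> tau_lattice z" unfolding L using tau_latticeI[of 1 0 w] by (intro imageI) simp
  then obtain p q where pq: "\<mu> = of_int p + of_int q * z" by (auto elim: tau_latticeE)
  have "\<mu> * w \<in> tau_lattice z" unfolding L using tau_latticeI[of 0 1 w] by (intro imageI) simp
  then obtain r s where rs: "\<mu> * w = of_int r + of_int s * z" by (auto elim: tau_latticeE)
  have Iw: "Im w \<noteq> 0" using w by simp
  have "\<mu> * (of_int 1 + of_int 0 * w) = of_int p * 1 + of_int q * z" using pq by simp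
  also have "\<dots> = \<mu> * (of_int (p * d + q * b) + of_int (p * c + q * a) * w)"
    by (subst cd, subst ab) (simp add: algebra_simps)
  finally have "of_int 1 + of_int 0 * w = of_int (p * d + q * b) + of_int (p * c + q * a) * w"
    using \<mu> by (simp only: mult_cancel_left) simp
  from lattice_coords_unique[OF Iw this] have 1: "p * d + q * b = 1" "p * c + q * a = 0" by simp_all
  have "\<mu> * (of_int 0 + of_int 1 * w) = of_int r * 1 + of_int s * z" using rs by simp
  also have "\<dots> = \<mu> * (of_int (r * d + s * b) + of_int (r * c + s * a) * w)"
    by (subst cd, subst ab) (simp add: algebra_simps)
  finally have "of_int 0 + of_int 1 * w = of_int (r * d + s * b) + of_int (r * c + s * a) * w"
    using \<mu> by (simp only: mult_cancel_left) simp
  from lattice_coords_unique[OF Iw this] have 2: "r * d + s * b = 0" "r * c + s * a = 1" by simp_all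
  have "(a * d - b * c) * (p * s - q * r)
      = (p * d + q * b) * (r * c + s * a) - (p * c + q * a) * (r * d + s * b)"
    by (simp add: algebra_simps)
  then have unit: "(a * d - b * c) * (p * s - q * r) = 1" using 1 2 by simp
  have nz: "of_int c * w + of_int d \<noteq> 0"
  proof
    assume "of_int c * w + of_int d = 0"
    then have "1 = \<mu> * 0" using cd by (simp add: add.commute)
    then show False by simp
  qed
  have zm: "z = moebius_int a b c d w"
  proof -
    have "\<mu> = 1 / (of_int c * w + of_int d)" using cd nz by (simp add: field_simps)
    then show ?thesis using ab by (simp add: moebius_int_def add.commute)
  qed
  \<comment> \<open>Orientation: the sign of Im z is that of the determinant times that of Im w,
    which excludes -1.\<close>
  have "Im z = of_int (a * d - b * c) * Im w / (norm (of_int c * w + of_int d))\<^sup>2"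
    unfolding zm moebius_int_def by (simp add: Im_divide cmod_power2) (simp add: algebra_simps)
  then have "of_int (a * d - b * c) * (Im w / (norm (of_int c * w + of_int d))\<^sup>2) > 0" using z by simp
  moreover have "Im w / (norm (of_int c * w + of_int d))\<^sup>2 > 0" using w nz by simp
  ultimately have "real_of_int (a * d - b * c) > 0" by (rule zero_less_mult_pos2)
  then have "a * d - b * c > 0" by (simp only: of_int_0_less_iff)
  with unit have "a * d - b * c = 1" by (metis zmult_eq_1_iff less_irrefl not_one_less_zero zero_less_one neg_0_less_iff_less not_less_iff_gr_or_eq)
  then show ?thesis using that zm by blast
qed

section \<open>Stabilizers and the critical values\<close>

text \<open>A matrix fixing \<open>w\<close> maps the lattice to itself through multiplication by 1
  / \<alpha>, and \<open>g2\<close>, \<open>g3\<close> are homogeneous of degrees -4 and -6. So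
  \<alpha>^4 = 1 unless \<open>g2\<close> vanishes and \<alpha>^6 = 1 unless \<open>g3\<close>
  vanishes, which also yields the values of \<open>j\<close> at i and at
  \<open>zeta6\<close>.\<close>

lemma stabilizer_unit:
  assumes det: "a * d - b * c = (1::int)" and w: "Im w > 0" and fx: "moebius_int a b c d w = w"
  defines "\<alpha> \<equiv> of_int c * w + of_int d"
  shows "g2 (tau_lattice w) = g2 (tau_lattice w) * \<alpha> ^ 4"
    and "g3 (tau_lattice w) = g3 (tau_lattice w) * \<alpha> ^ 6"
proof -
  have \<alpha>: "1 / \<alpha> \<noteq> 0" using moebius_denom_nonzero[OF det w] by (simp add: \<alpha>_def)
  have L: "tau_lattice w = (*) (1 / \<alpha>) ` tau_lattice w"
    using moebius_int_lattice[OF det w] by (simp only: fx \<alpha>_def)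
  have "g2 (tau_lattice w) = g2 ((*) (1 / \<alpha>) ` tau_lattice w)" by (rule arg_cong[OF L])
  then show "g2 (tau_lattice w) = g2 (tau_lattice w) * \<alpha> ^ 4"
    unfolding g2_scale[OF \<alpha>] by (simp add: power_one_over)
  have "g3 (tau_lattice w) = g3 ((*) (1 / \<alpha>) ` tau_lattice w)" by (rule arg_cong[OF L])
  then show "g3 (tau_lattice w) = g3 (tau_lattice w) * \<alpha> ^ 6"
    unfolding g3_scale[OF \<alpha>] by (simp add: power_one_over)
qed

text \<open>Squares are taken because a matrix and its negative give opposite denominators but the
  same map. The set is thus a copy of the stabilizer in PSL(2, Z).\<close>

definition stabilizer_units :: "complex \<Rightarrow> complex set" where
  "stabilizer_units w = {(of_int c * w + of_int d)\<^sup>2 | a b c d.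
     a * d - b * c = (1::int) \<and> moebius_int a b c d w = w}"

text \<open>Enters as an upper bound for the multiplicity of \<open>klein_j\<close> over
  \<open>v\<close>. An upper bound is the useful direction: the distance quotient in
  \<open>klein_j_schwarz\<close> is at most 1, so its power only decreases when the exponent
  grows.\<close>

definition ramification :: "complex \<Rightarrow> nat" where
  "ramification v = (if v = 0 then 3 else if v = 1728 then 2 else 1)"

text \<open>A unit \<beta> = \<alpha>^2 satisfies \<beta>^2 = 1 if \<open>g2\<close> is nonzero and
  \<beta>^3 = 1 if \<open>g3\<close> is nonzero. Now j = 0 means \<open>g2\<close> = 0 and j = 1728
  means \<open>g3\<close> = 0, so in each case \<beta> is a root of unity of order dividing the
  ramification.\<close>

lemma stabilizer_units_card:
  assumes w: "Im w > 0"
  shows "finite (stabilizer_units w)" "card (stabilizer_units w) \<le> ramification (klein_j w)"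
proof -
  let ?n = "ramification (klein_j w)"
  define A where "A = g2 (tau_lattice w)"
  define B where "B = g3 (tau_lattice w)"
  have D: "A ^ 3 - 27 * B\<^sup>2 \<noteq> 0" using discriminant_tau_nonzero[OF w] by (simp add: A_def B_def)
  have j: "klein_j w = 1728 * A ^ 3 / (A ^ 3 - 27 * B\<^sup>2)"
    by (simp add: klein_j_def lattice_j_def A_def B_def)
  have n: "?n \<ge> 1" by (simp add: ramification_def)
  have "\<beta> ^ ?n = 1" if mem: "\<beta> \<in> stabilizer_units w" for \<beta>
  proof -
    obtain a b c d where det: "a * d - b * c = (1::int)" and fx: "moebius_int a b c d w = w"
      and \<beta>: "\<beta> = (of_int c * w + of_int d)\<^sup>2"
      using mem unfolding stabilizer_units_def by blast
    have A2: "A * (\<beta>\<^sup>2 - 1) = 0" and B3: "B * (\<beta> ^ 3 - 1) = 0"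
      using stabilizer_unit[OF det w fx]
      by (simp_all add: A_def B_def \<beta> right_diff_distrib power_mult[symmetric])
    show ?thesis
    proof (cases "klein_j w = 0")
      case True
      then have "A = 0" using j D by simp
      then have "B \<noteq> 0" using D by auto
      then show ?thesis using B3 True by (simp add: ramification_def)
    next
      case False
      then have "A \<noteq> 0" using j by auto
      then have 2: "\<beta>\<^sup>2 = 1" using A2 by simp
      show ?thesis
      proof (cases "klein_j w = 1728")
        case True
        then show ?thesis using 2 by (simp add: ramification_def)
      next
        case neq: False
        have "B \<noteq> 0" using neq j D by auto
        then have "\<beta> ^ 3 = 1" using B3 by simp
        then have "\<beta> = 1" using 2 by (simp add: power3_eq_cube power2_eq_square)
        then show ?thesis by simp
      qed
    qed
  qed
  then have sub: "stabilizer_units w \<subseteq> {\<beta>. \<beta> ^ ?n = 1}" by blast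
  have fin: "finite {\<beta>::complex. \<beta> ^ ?n = 1}" using finite_roots_unity[OF n] .
  then show "finite (stabilizer_units w)" using sub finite_subset by blast
  have "card (stabilizer_units w) \<le> card {\<beta>::complex. \<beta> ^ ?n = 1}" by (rule card_mono[OF fin sub])
  also have "\<dots> \<le> ?n" by (rule card_roots_unity[OF n])
  finally show "card (stabilizer_units w) \<le> ?n" .
qed

text \<open>If \<open>w\<close> is fixed, the numerator at \<open>w\<close> is the denominator times
  \<open>w\<close>. The denominator therefore determines all four entries, and its square determines
  them up to a common sign.\<close>

lemma stabilizer_eq_of_unit_sq_eq:
  assumes w: "Im w > 0"
    and det: "a * d - b * c = (1::int)" "a' * d' - b' * c' = (1::int)"
    and fx: "moebius_int a b c d w = w" "moebius_int a' b' c' d' w = w"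
    and eq: "(of_int c * w + of_int d)\<^sup>2 = (of_int c' * w + of_int d' :: complex)\<^sup>2"
  shows "moebius_int a b c d = moebius_int a' b' c' d'"
proof -
  have Iw: "Im w \<noteq> 0" using w by simp
  have num: "of_int a * w + of_int b = (of_int c * w + of_int d) * w"
    "of_int a' * w + of_int b' = (of_int c' * w + of_int d') * w"
    using fx moebius_denom_nonzero[OF det(1) w] moebius_denom_nonzero[OF det(2) w]
    by (simp_all add: moebius_int_def field_simps)
  from eq consider "of_int c * w + of_int d = of_int c' * w + of_int d'"
    | "of_int c * w + of_int d = - (of_int c' * w + of_int d')" by (auto simp: power2_eq_iff)
  then show ?thesis
  proof cases
    case 1
    then have e1: "of_int d + of_int c * w = of_int d' + of_int c' * w" by (simp add: add.commute)
    have e2: "of_int b + of_int a * w = of_int b' + of_int a' * w" using num 1 by (simp add: add.commute)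
    from lattice_coords_unique[OF Iw e1] lattice_coords_unique[OF Iw e2] show ?thesis by simp
  next
    case 2
    then have e1: "of_int d + of_int c * w = of_int (- d') + of_int (- c') * w" by (simp add: algebra_simps)
    have "of_int a * w + of_int b = - (of_int a' * w + of_int b')" unfolding num 2 by (simp add: algebra_simps)
    then have e2: "of_int b + of_int a * w = of_int (- b') + of_int (- a') * w" by (simp add: algebra_simps)
    from lattice_coords_unique[OF Iw e1] lattice_coords_unique[OF Iw e2]
    have "a = - a'" "b = - b'" "c = - c'" "d = - d'" by simp_all
    then show ?thesis
    proof -
      have "(- x) / (- y) = x / y" for x y :: complex by simp
      then have "(of_int a * z + of_int b) / (of_int c * z + of_int d)
          = (of_int a' * z + of_int b') / (of_int c' * z + of_int d' :: complex)" for z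
        unfolding \<open>a = - a'\<close> \<open>b = - b'\<close> \<open>c = - c'\<close> \<open>d = - d'\<close>
        by (metis (no_types, lifting) add_uminus_conv_diff minus_add_distrib minus_mult_left of_int_minus)
      then show ?thesis by (simp add: moebius_int_def fun_eq_iff)
    qed
  qed
qed

lemma klein_j_i: "klein_j \<i> = 1728"
proof -
  have "moebius_int 0 (-1) 1 0 \<i> = \<i>" by (simp add: moebius_int_def)
  from stabilizer_unit(2)[OF _ _ this] have "g3 (tau_lattice \<i>) = - g3 (tau_lattice \<i>)"
    by (simp add: eval_nat_numeral)
  then have "g3 (tau_lattice \<i>) = 0" by simp
  then show ?thesis using discriminant_tau_nonzero[of \<i>] by (simp add: klein_j_def lattice_j_def)
qed

definition zeta6 :: complex where "zeta6 = Complex (1 / 2) (sqrt 3 / 2)"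

lemma zeta6_sq: "zeta6\<^sup>2 = zeta6 - 1"
  by (simp add: zeta6_def complex_eq_iff power2_eq_square)

lemma Im_zeta6: "Im zeta6 > 0"
  by (simp add: zeta6_def)

lemma klein_j_zeta6: "klein_j zeta6 = 0"
proof -
  have nz: "zeta6 \<noteq> 0" using Im_zeta6 by auto
  have "moebius_int 1 (-1) 1 0 zeta6 = zeta6"
  proof -
    have "moebius_int 1 (-1) 1 0 zeta6 = (zeta6 - 1) / zeta6" by (simp add: moebius_int_def)
    also have "\<dots> = zeta6\<^sup>2 / zeta6" by (simp only: zeta6_sq)
    also have "\<dots> = zeta6" using nz by (simp add: power2_eq_square)
    finally show ?thesis .
  qed
  from stabilizer_unit(1)[OF _ Im_zeta6 this] have g: "g2 (tau_lattice zeta6) = g2 (tau_lattice zeta6) * zeta6 ^ 4"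
    by simp
  have "zeta6 ^ 4 = (zeta6\<^sup>2)\<^sup>2" by (simp add: power_mult[symmetric])
  also have "\<dots> = (zeta6 - 1)\<^sup>2" by (simp only: zeta6_sq)
  also have "\<dots> = zeta6\<^sup>2 - 2 * zeta6 + 1" by (simp add: power2_eq_square algebra_simps)
  also have "\<dots> = - zeta6" unfolding zeta6_sq by simp
  finally have "zeta6 ^ 4 = - zeta6" .
  then have "g2 (tau_lattice zeta6) * (1 + zeta6) = g2 (tau_lattice zeta6) - g2 (tau_lattice zeta6) * zeta6 ^ 4"
    by (simp only:) (simp add: algebra_simps)
  then have "g2 (tau_lattice zeta6) * (1 + zeta6) = 0" by (simp only: g[symmetric] diff_self)
  moreover have "1 + zeta6 \<noteq> 0" using Im_zeta6 by (auto simp: complex_eq_iff)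
  ultimately have "g2 (tau_lattice zeta6) = 0" by simp
  then show ?thesis by (simp add: klein_j_def lattice_j_def)
qed

section \<open>Surjectivity of the modular function\<close>

text \<open>\<open>S\<close> is the set of denominators c z + d of unimodular matrices. After a
  translation with |Re| <= 1/2, the numerator for an element \<open>s\<close> of minimal norm is
  again in \<open>S\<close>, so the quotient has norm at least 1.\<close>

lemma moebius_reduction:
  assumes z: "Im z > 0"
  obtains a b c d where "a * d - b * c = (1::int)"
    "\<bar>Re (moebius_int a b c d z)\<bar> \<le> 1 / 2" "1 \<le> norm (moebius_int a b c d z)"
proof -
  interpret complex_lattice "tau_lattice z" by (rule complex_lattice_tau[OF z])
  define S where "S = {of_int c * z + of_int d | a b c d. a * d - b * c = (1::int)}"
  have 1: "1 \<in> S" unfolding S_def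
    by (rule CollectI, rule exI[of _ 1], rule exI[of _ 0], rule exI[of _ 0], rule exI[of _ 1]) simp
  have "S \<inter> {x. norm x \<le> 1} \<subseteq> {\<omega> \<in> tau_lattice z. norm \<omega> \<le> 1}"
  proof
    fix x assume x: "x \<in> S \<inter> {x. norm x \<le> 1}"
    then obtain c d where "x = of_int d + of_int c * z" unfolding S_def by (auto simp: add.commute)
    then show "x \<in> {\<omega> \<in> tau_lattice z. norm \<omega> \<le> 1}" using x tau_latticeI[of d c z] by simp
  qed
  then have fin: "finite (norm ` (S \<inter> {x. norm x \<le> 1}))"
    using finite_bounded finite_subset by blast
  define \<mu> where "\<mu> = Min (norm ` (S \<inter> {x. norm x \<le> 1}))"
  have "\<mu> \<in> norm ` (S \<inter> {x. norm x \<le> 1})" unfolding \<mu>_def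
    by (rule Min_in[OF fin]) (use 1 in auto)
  then obtain s where s: "s \<in> S" "norm s = \<mu>" "\<mu> \<le> 1" by auto
  have min: "\<mu> \<le> norm x" if "x \<in> S" for x
  proof (cases "norm x \<le> 1")
    case True
    then show ?thesis unfolding \<mu>_def by (intro Min_le fin) (use that in auto)
  qed (use s in auto)
  obtain a b c d where det: "a * d - b * c = (1::int)" and scd: "s = of_int c * z + of_int d"
    using s(1) unfolding S_def by blast
  define w where "w = moebius_int a b c d z"
  define k where "k = - round (Re w)"
  have nz: "s \<noteq> 0" using moebius_denom_nonzero[OF det z] scd by simp
  have w': "moebius_int (a + k * c) (b + k * d) c d z = w + of_int k"
  proof -
    have "moebius_int (a + k * c) (b + k * d) c d z = ((of_int a * z + of_int b) + of_int k * s) / s"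
      by (simp add: moebius_int_def scd algebra_simps)
    also have "\<dots> = (of_int a * z + of_int b) / s + of_int k" using nz by (simp add: add_divide_distrib)
    finally show ?thesis by (simp only: w_def moebius_int_def scd)
  qed
  have det': "(a + k * c) * d - (b + k * d) * c = 1" using det by (simp add: algebra_simps)
  have num: "of_int (a + k * c) * z + of_int (b + k * d) = (w + of_int k) * s"
    using w' nz by (simp add: moebius_int_def scd field_simps)
  \<comment> \<open>The matrix with rows (-c, -d) and (a + k c, b + k d), that is, the translated
    one followed by z -> -1 / z, has this numerator as its denominator.\<close>
  have "of_int (a + k * c) * z + of_int (b + k * d) \<in> S" unfolding S_def
    by (rule CollectI, rule exI[of _ "- c"], rule exI[of _ "- d"], rule exI[of _ "a + k * c"], rule exI[of _ "b + k * d"])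
       (use det' in \<open>simp add: algebra_simps\<close>)
  from min[OF this] have "norm s \<le> norm (w + of_int k) * norm s"
    unfolding num norm_mult s(2) .
  then have "1 \<le> norm (w + of_int k)" using nz by simp
  moreover have "\<bar>Re (w + of_int k)\<bar> \<le> 1 / 2"
    using of_int_round_abs_le[of "Re w"] by (simp add: k_def abs_minus_commute)
  ultimately show ?thesis using that[OF det'] unfolding w' by blast
qed

lemma reduced_Im_bound:
  assumes "\<bar>Re w\<bar> \<le> 1 / 2" "1 \<le> norm w" "Im w > 0"
  shows "Im w \<ge> 1 / 2"
proof (rule ccontr)
  assume "\<not> Im w \<ge> 1 / 2"
  then have "(Im w)\<^sup>2 \<le> (1 / 2)\<^sup>2" using assms(3) by (intro power_mono) auto
  moreover have "(Re w)\<^sup>2 \<le> (1 / 2)\<^sup>2" using assms(1) by (metis abs_ge_zero power2_abs power_mono)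
  ultimately have "(norm w)\<^sup>2 \<le> 1 / 2" unfolding cmod_power2 by (simp add: power2_eq_square)
  moreover have "1 \<le> (norm w)\<^sup>2" using assms(2) by (rule one_le_power)
  ultimately show False by simp
qed

text \<open>Stated for an arbitrary half plane: a = 0 gives functions of q on the unit disc, a = ln
  \<rho> the descent of the lift in \<open>branched_lift\<close>.\<close>

lemma periodic_factors_through_exp:
  fixes h :: "complex \<Rightarrow> complex"
  assumes hol: "h holomorphic_on {u. Re u < a}"
    and per: "\<And>u. Re u < a \<Longrightarrow> h (u + 2 * of_real pi * \<i>) = h u"
  defines "k \<equiv> \<lambda>q. h (Ln q)"
  shows "k holomorphic_on ball 0 (exp a) - {0}" "\<And>u. Re u < a \<Longrightarrow> h u = k (exp u)"
proof -
  have per_nat: "h (u + of_nat n * (2 * of_real pi * \<i>)) = h u" if "Re u < a" for n u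
  proof (induction n)
    case (Suc n)
    have "h (u + of_nat n * (2 * of_real pi * \<i>) + 2 * of_real pi * \<i>) = h (u + of_nat n * (2 * of_real pi * \<i>))"
      by (rule per) (use that in simp)
    then show ?case unfolding Suc by (simp add: algebra_simps)
  qed simp
  have per_int: "h (u + of_int n * (2 * of_real pi * \<i>)) = h u" if "Re u < a" for n u
  proof (cases n)
    case (nonneg m)
    then show ?thesis using per_nat[OF that, of m] by simp
  next
    case (neg m)
    have "h (u + of_int n * (2 * of_real pi * \<i>) + of_nat (Suc m) * (2 * of_real pi * \<i>))
        = h (u + of_int n * (2 * of_real pi * \<i>))"
      by (rule per_nat) (use that in simp)
    then show ?thesis by (simp add: neg algebra_simps)
  qed
  have per_exp: "h u = h v" if e: "exp u = exp v" and v: "Re v < a" for u v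
  proof -
    obtain n :: int where "u = v + (of_int (2 * n) * pi) * \<i>" using e unfolding exp_eq by blast
    then have u: "u = v + of_int n * (2 * of_real pi * \<i>)" by simp
    show ?thesis unfolding u by (rule per_int[OF v])
  qed
  have Re_lt: "Re u < a \<longleftrightarrow> exp u \<in> ball 0 (exp a)" for u by simp
  show k: "h u = k (exp u)" if "Re u < a" for u
    unfolding k_def by (rule per_exp[symmetric]) (use that in auto)
  have "k field_differentiable at q" if q: "q \<in> ball 0 (exp a) - {0}" for q
  proof -
    define S where "S = {x. x / q \<notin> \<real>\<^sub>\<le>\<^sub>0} \<inter> ball 0 (exp a)"
    have q0: "q \<noteq> 0" using q by simp
    have "open {x. x / q \<notin> \<real>\<^sub>\<le>\<^sub>0}"
    proof -
      have "open ((\<lambda>x. x / q) -` (- \<real>\<^sub>\<le>\<^sub>0))"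
        by (rule open_vimage) (use q0 in \<open>auto intro!: continuous_intros\<close>)
      then show ?thesis by (simp add: vimage_def)
    qed
    then have S: "open S" unfolding S_def by auto
    have qS: "q \<in> S" using q by (simp add: S_def)
    \<comment> \<open>A logarithm near \<open>q\<close> that avoids the cut of \<open>Ln\<close>. By
      periodicity \<open>h\<close> takes the same value at all logarithms of a point in the disc, so
      \<open>k\<close> is holomorphic across the cut.\<close>
    define l where "l x = Ln q + Ln (x / q)" for x
    have expl: "exp (l x) = x" if "x \<in> S" for x
    proof -
      have "x / q \<noteq> 0" using that by (auto simp: S_def)
      then show ?thesis using q0 by (simp add: l_def exp_add)
    qed
    have "l holomorphic_on S" unfolding l_def
      by (intro holomorphic_intros) (use q0 in \<open>auto simp: S_def\<close>)
    moreover have lS: "l ` S \<subseteq> {u. Re u < a}"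
    proof
      fix y assume "y \<in> l ` S"
      then obtain x where x: "x \<in> S" "y = l x" by blast
      then have "exp y \<in> ball 0 (exp a)" using expl by (simp add: S_def)
      then show "y \<in> {u. Re u < a}" unfolding mem_Collect_eq Re_lt .
    qed
    ultimately have "(h \<circ> l) holomorphic_on S"
      by (rule holomorphic_on_compose_gen[OF _ hol])
    then have "k holomorphic_on S"
    proof (rule holomorphic_transform)
      fix x assume x: "x \<in> S"
      have "(h \<circ> l) x = k (exp (l x))" using k lS x by auto
      then show "(h \<circ> l) x = k x" using expl[OF x] by simp
    qed
    then show ?thesis using S qS by (rule holomorphic_on_imp_differentiable_at)
  qed
  then show "k holomorphic_on ball 0 (exp a) - {0}"
    by (simp add: holomorphic_on_def field_differentiable_at_within)
qed

lemma eisenstein_translate: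
  assumes "Im z > 0"
  shows "eisenstein k (z + 1) = eisenstein k z"
proof -
  have "tau_lattice (moebius_int 1 1 0 1 z) = (*) (1 / (of_int 0 * z + of_int 1)) ` tau_lattice z"
    by (rule moebius_int_lattice) (use assms in auto)
  then have "tau_lattice (z + 1) = tau_lattice z" by (simp add: moebius_int_def)
  then show ?thesis
    using lattice_sum_eisenstein[of z k] lattice_sum_eisenstein[of "z + 1" k] assms by simp
qed

definition nome :: "complex \<Rightarrow> complex" where
  "nome z = exp (2 * of_real pi * \<i> * z)"

lemma norm_nome: "norm (nome z) = exp (- 2 * pi * Im z)"
  by (simp add: nome_def)

lemma nome_surj:
  assumes "q \<noteq> 0"
  obtains z where "nome z = q" "\<bar>Re z\<bar> \<le> 1 / 2"
proof
  have nz: "2 * of_real pi * \<i> \<noteq> 0" by simp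
  show "nome (Ln q / (2 * of_real pi * \<i>)) = q" using assms by (simp add: nome_def)
  have "Re (Ln q / (2 * of_real pi * \<i>)) = Im (Ln q) / (2 * pi)"
    by (simp add: Re_divide power2_eq_square field_simps)
  moreover have "\<bar>Im (Ln q)\<bar> \<le> pi"
    using assms Im_Ln_le_pi[OF assms] mpi_less_Im_Ln[OF assms] by linarith
  ultimately show "\<bar>Re (Ln q / (2 * of_real pi * \<i>))\<bar> \<le> 1 / 2"
    using pi_gt_zero by (simp add: abs_divide divide_le_eq)
qed

text \<open>Invariance under z -> z + 1 gives a function of q on the punctured disc, and boundedness
  near the cusp removes the singularity at 0. No Fourier coefficient has to be computed.\<close>

lemma eisenstein_nome_expansion:
  assumes "k \<ge> 3"
  obtains E where "E holomorphic_on ball 0 1" "\<And>z. Im z > 0 \<Longrightarrow> eisenstein k z = E (nome z)"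
proof -
  define h where "h u = eisenstein k (u / (2 * of_real pi * \<i>))" for u
  have Im_eq: "Im (u / (2 * of_real pi * \<i>)) = - Re u / (2 * pi)" for u
    by (simp add: Im_divide power2_eq_square field_simps)
  have hol: "h holomorphic_on {u. Re u < 0}"
  proof -
    have "(eisenstein k \<circ> (\<lambda>u. u / (2 * of_real pi * \<i>))) holomorphic_on {u. Re u < 0}"
      by (rule holomorphic_on_compose_gen[OF _ eisenstein_holomorphic[OF assms]])
         (auto intro!: holomorphic_intros simp: Im_eq divide_neg_pos)
    then show ?thesis by (simp add: o_def h_def[abs_def])
  qed
  have per: "h (u + 2 * of_real pi * \<i>) = h u" if "Re u < 0" for u
  proof -
    have "(u + 2 * of_real pi * \<i>) / (2 * of_real pi * \<i>) = u / (2 * of_real pi * \<i>) + 1"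
      by (simp add: add_divide_distrib)
    moreover have "Im (u / (2 * of_real pi * \<i>)) > 0" using that by (simp add: Im_eq divide_neg_pos)
    ultimately show ?thesis unfolding h_def using eisenstein_translate by simp
  qed
  define E0 where "E0 = (\<lambda>q. h (Ln q))"
  have E0: "E0 holomorphic_on ball 0 1 - {0}"
    using periodic_factors_through_exp(1)[OF hol per] unfolding E0_def exp_zero .
  have E0_exp: "h u = E0 (exp u)" if "Re u < 0" for u
    unfolding E0_def by (rule periodic_factors_through_exp(2)[OF hol per that])
  have eE: "eisenstein k z = E0 (nome z)" if "Im z > 0" for z
  proof -
    have "Re (2 * of_real pi * \<i> * z) < 0" using that by simp
    from E0_exp[OF this] show ?thesis by (simp add: h_def nome_def)
  qed
  obtain M where M: "\<And>\<tau>. Im \<tau> \<ge> 1 \<Longrightarrow> \<bar>Re \<tau>\<bar> \<le> 1 / 2 \<Longrightarrow> norm (eisenstein k \<tau>) \<le> M"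
    using eisenstein_bounded[OF assms, of 1 "1 / 2"] by auto
  have "\<forall>\<^sub>F q in at 0. norm (E0 q) \<le> M"
    unfolding eventually_at
  \<comment> \<open>The condition |q| < exp(-2 pi) means Im z > 1, the range of the bound
    \<open>M\<close>.\<close>
  proof (intro exI[of _ "exp (- 2 * pi)"] conjI ballI impI)
    fix q :: complex assume q: "q \<noteq> 0 \<and> dist q 0 < exp (- 2 * pi)"
    from q have "q \<noteq> 0" by simp
    then obtain z where z: "nome z = q" "\<bar>Re z\<bar> \<le> 1 / 2" by (rule nome_surj)
    have "exp (- 2 * pi * Im z) < exp (- 2 * pi)" using q norm_nome[of z] z by simp
    then have "Im z > 1" by simp
    then show "norm (E0 q) \<le> M" using M[of z] eE[of z] z by simp
  qed simp
  then have "\<exists>B. \<forall>\<^sub>F q in at 0. norm (E0 q) \<le> B" by blast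
  then obtain E where E: "E holomorphic_on ball 0 1" "\<And>q. q \<in> ball 0 1 - {0} \<Longrightarrow> E q = E0 q"
    using holomorphic_on_extend_bounded[of E0 "ball 0 1" 0] E0 by auto
  show ?thesis
  proof (rule that[OF E(1)])
    fix z assume z: "Im z > 0"
    have "nome z \<in> ball 0 1 - {0}" using z norm_nome[of z] by (auto simp: nome_def)
    then show "eisenstein k z = E (nome z)" using E(2) eE[OF z] by simp
  qed
qed

text \<open>This replaces compactness of the modular curve.\<close>

lemma constant_of_values_on_smaller_disc:
  fixes K :: "complex \<Rightarrow> complex"
  assumes hol: "K holomorphic_on ball 0 1" and \<rho>: "0 < \<rho>" "\<rho> < 1"
    and val: "\<And>q. q \<in> ball 0 1 \<Longrightarrow> \<exists>q'\<in>cball 0 \<rho>. K q' = K q"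
  shows "K constant_on ball 0 1"
proof -
  have sub: "cball 0 \<rho> \<subseteq> ball (0::complex) 1" using \<rho> by auto
  \<comment> \<open>A maximum of |K| over the closed disc bounds |K| on the whole unit disc by
    \<open>val\<close>, and it is attained at an interior point of the unit disc.\<close>
  have "continuous_on (cball 0 \<rho>) (\<lambda>q. norm (K q))"
    by (intro continuous_intros holomorphic_on_imp_continuous_on holomorphic_on_subset[OF hol sub])
  then obtain \<xi> where \<xi>: "\<xi> \<in> cball 0 \<rho>" "\<forall>q\<in>cball 0 \<rho>. norm (K q) \<le> norm (K \<xi>)"
    using continuous_attains_sup[of "cball (0::complex) \<rho>" "\<lambda>q. norm (K q)"] \<rho> by auto
  show ?thesis
  proof (rule maximum_modulus_principle[OF hol open_ball connected_ball open_ball order_refl])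
    show "\<xi> \<in> ball 0 1" using \<xi>(1) sub by blast
    show "norm (K q) \<le> norm (K \<xi>)" if q: "q \<in> ball 0 1" for q
    proof -
      obtain q' where "q' \<in> cball 0 \<rho>" "K q' = K q" using val[OF q] by blast
      then show ?thesis using \<xi>(2) by metis
    qed
  qed
qed

text \<open>As a function of q, \<open>j\<close> is a quotient of functions holomorphic at 0. With a
  finite limit there it would extend and be constant, but it takes the values 0 and 1728. With a
  pole, omitting \<open>v\<close> would make 1 / (j - v) extend by 0 and be constant, hence
  0.\<close>

theorem klein_j_surj: "\<exists>z. Im z > 0 \<and> klein_j z = v"
proof (rule ccontr)
  assume omit: "\<not> (\<exists>z. Im z > 0 \<and> klein_j z = v)"
  obtain E4 where E4: "E4 holomorphic_on ball 0 1" "\<And>z. Im z > 0 \<Longrightarrow> eisenstein 4 z = E4 (nome z)"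
    using eisenstein_nome_expansion[of 4] by auto
  obtain E6 where E6: "E6 holomorphic_on ball 0 1" "\<And>z. Im z > 0 \<Longrightarrow> eisenstein 6 z = E6 (nome z)"
    using eisenstein_nome_expansion[of 6] by auto
  define N where "N q = 1728 * (60 * E4 q) ^ 3" for q
  define D where "D q = (60 * E4 q) ^ 3 - 27 * (140 * E6 q)\<^sup>2" for q
  define J where "J q = N q / D q" for q
  have holN: "N holomorphic_on ball 0 1" and holD: "D holomorphic_on ball 0 1"
    unfolding N_def D_def by (intro holomorphic_intros E4 E6)+
  have jJ: "klein_j z = J (nome z)" if "Im z > 0" for z
    using that E4(2) E6(2) by (simp add: klein_j_def lattice_j_def g2_tau g3_tau J_def N_def D_def)
  have nome_pre: "\<exists>z. Im z > 0 \<and> nome z = q" if q: "q \<in> ball 0 1 - {0}" for q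
  proof -
    have "q \<noteq> 0" using q by simp
    then obtain z where z: "nome z = q" by (rule nome_surj)
    have "norm (nome z) < 1" using z q by simp
    then have "- 2 * pi * Im z < 0" unfolding norm_nome by simp
    then have "Im z > 0" using pi_gt_zero by (simp add: zero_less_mult_iff)
    then show ?thesis using z by blast
  qed
  have D0: "D q \<noteq> 0" if "q \<in> ball 0 1 - {0}" for q
  proof -
    obtain z where z: "Im z > 0" "nome z = q" using nome_pre[OF \<open>q \<in> _\<close>] by blast
    then show ?thesis
      using discriminant_tau_nonzero[OF z(1)] E4(2)[OF z(1)] E6(2)[OF z(1)] by (simp add: g2_tau g3_tau D_def)
  qed
  have holJ: "J holomorphic_on ball 0 1 - {0}"
    unfolding J_def
    by (intro holomorphic_on_divide holomorphic_on_subset[OF holN] holomorphic_on_subset[OF holD] D0) auto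
  \<comment> \<open>A reduced point has Im >= 1/2, which bounds its q by exp(-2 pi / 2).\<close>
  define \<rho> where "\<rho> = exp (- pi)"
  have \<rho>: "0 < \<rho>" "\<rho> < 1" using pi_gt_zero by (auto simp: \<rho>_def)
  have small: "\<exists>q'\<in>cball 0 \<rho> - {0}. J q' = J q" if "q \<in> ball 0 1 - {0}" for q
  proof -
    obtain z where z: "Im z > 0" "nome z = q" using nome_pre[OF \<open>q \<in> _\<close>] by blast
    obtain a b c d where m: "a * d - b * c = (1::int)"
      "\<bar>Re (moebius_int a b c d z)\<bar> \<le> 1 / 2" "1 \<le> norm (moebius_int a b c d z)"
      by (rule moebius_reduction[OF z(1)])
    define w where "w = moebius_int a b c d z"
    have w: "Im w > 0" unfolding w_def by (rule moebius_int_upper[OF m(1) z(1)])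
    have "Im w \<ge> 1 / 2" by (rule reduced_Im_bound[OF m(2,3)[folded w_def] w])
    then have "norm (nome w) \<le> \<rho>" unfolding norm_nome \<rho>_def by simp
    moreover have "J (nome w) = J q"
    proof -
      have "J (nome w) = klein_j w" by (rule jJ[OF w, symmetric])
      also have "\<dots> = klein_j z" unfolding w_def by (rule klein_j_moebius[OF m(1) z(1)])
      also have "\<dots> = J q" unfolding jJ[OF z(1)] z(2) ..
      finally show ?thesis .
    qed
    moreover have "nome w \<noteq> 0" by (simp add: nome_def)
    ultimately show ?thesis by (intro bexI[of _ "nome w"]) auto
  qed
  \<comment> \<open>\<open>K\<close> is the extension over q = 0 of a function of \<open>J\<close>;
    the centre 0 already lies in the smaller disc, and every other value recurs there by
    \<open>small\<close>.\<close>
  have extend_const: "K constant_on ball 0 1"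
    if "K holomorphic_on ball 0 1" "\<And>q. q \<in> ball 0 1 - {0} \<Longrightarrow> K q = F (J q)" for K and F :: "complex \<Rightarrow> complex"
  proof (rule constant_of_values_on_smaller_disc[OF that(1) \<rho>])
    fix q :: complex assume q: "q \<in> ball 0 1"
    show "\<exists>q'\<in>cball 0 \<rho>. K q' = K q"
    proof (cases "q = 0")
      case True
      then show ?thesis using \<rho> by (intro bexI[of _ 0]) auto
    next
      case False
      then have q': "q \<in> ball 0 1 - {0}" using q by simp
      obtain p where p: "p \<in> cball 0 \<rho> - {0}" "J p = J q" using small[OF q'] by blast
      then have "p \<in> ball 0 1 - {0}" using \<rho> by auto
      then have "K p = K q" using that(2) p(2) q' by simp
      then show ?thesis using p(1) by blast
    qed
  qed
  have iso: "isolated_singularity_at N 0" "isolated_singularity_at D 0" "not_essential N 0" "not_essential D 0"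
    using holN holD
    by (auto intro!: isolated_singularity_at_analytic not_essential_analytic holomorphic_on_imp_analytic_at[of _ "ball 0 1"])
  have "not_essential (\<lambda>q. N q / D q) 0"
    by (rule not_essential_divide) (use iso in auto)
  then consider c where "(\<lambda>q. N q / D q) \<midarrow>0\<rightarrow> c" | "is_pole (\<lambda>q. N q / D q) 0"
    unfolding not_essential_def by blast
  then show False
  proof cases
    case 1
    then have "J \<midarrow>0\<rightarrow> c" by (simp add: J_def[abs_def])
    then have "(\<lambda>q. if q = 0 then c else J q) holomorphic_on ball 0 1"
      by (rule removable_singularity[OF holJ open_ball])
    then have "(\<lambda>q. if q = 0 then c else J q) constant_on ball 0 1"
      by (rule extend_const[where F = "\<lambda>x. x"]) auto
    then obtain e where e: "\<And>q. q \<in> ball 0 1 \<Longrightarrow> (if q = 0 then c else J q) = e"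
      unfolding constant_on_def by blast
    have "klein_j z = e" if z: "Im z > 0" for z
    proof -
      have "nome z \<in> ball 0 1" "nome z \<noteq> 0" using z norm_nome[of z] by (auto simp: nome_def)
      then show ?thesis using e[of "nome z"] jJ[OF z] by simp
    qed
    from this[of \<i>] this[OF Im_zeta6] show False by (simp add: klein_j_i klein_j_zeta6)
  next
    case 2
    have Jv: "J q - v \<noteq> 0" if q: "q \<in> ball 0 1 - {0}" for q
    proof -
      obtain z where z: "Im z > 0" "nome z = q" using nome_pre[OF q] by blast
      have "klein_j z \<noteq> v" using omit z(1) by blast
      then show ?thesis using jJ[OF z(1)] z(2) by simp
    qed
    have "filterlim J at_infinity (at 0)" using 2 by (simp add: is_pole_def J_def[abs_def])
    then have "filterlim (\<lambda>q. J q + (- v)) at_infinity (at 0)"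
      by (rule tendsto_add_filterlim_at_infinity'[OF _ tendsto_const])
    then have "(\<lambda>q. inverse (J q + (- v))) \<midarrow>0\<rightarrow> 0"
      by (rule filterlim_compose[OF tendsto_inverse_0])
    then have lim: "(\<lambda>q. 1 / (J q - v)) \<midarrow>0\<rightarrow> 0" by (simp add: inverse_eq_divide)
    have "(\<lambda>q. if q = 0 then 0 else 1 / (J q - v)) holomorphic_on ball 0 1"
      by (rule removable_singularity[OF _ open_ball lim])
         (intro holomorphic_intros holJ Jv)
    then have "(\<lambda>q. if q = 0 then 0 else 1 / (J q - v)) constant_on ball 0 1"
      by (rule extend_const[where F = "\<lambda>x. 1 / (x - v)"]) auto
    then obtain e where e: "\<And>q. q \<in> ball 0 1 \<Longrightarrow> (if q = 0 then 0 else 1 / (J q - v)) = e"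
      unfolding constant_on_def by blast
    have "e = 0" using e[of 0] by simp
    moreover have "1 / (J (1 / 2) - v) = e" using e[of "1 / 2"] by simp
    ultimately show False using Jv[of "1 / 2"] by simp
  qed
qed

section \<open>Inverse branches and the Schwarz lemma\<close>

text \<open>Write f - f(w) = (z - w)^n g with g free of zeros on a disc. There g has a holomorphic
  n-th root G, and (z - w) G is a local coordinate whose n-th power is f - f(w); \<psi> is its
  inverse.\<close>

lemma local_normal_form:
  assumes holf: "f holomorphic_on S" and S: "open S" "connected S" "w \<in> S" and nc: "\<not> f constant_on S"
  obtains m \<epsilon> and \<psi> :: "complex \<Rightarrow> complex"
  where "0 < (m::nat)" "0 < \<epsilon>" "\<psi> holomorphic_on ball 0 \<epsilon>" "\<psi> 0 = w" "inj_on \<psi> (ball 0 \<epsilon>)"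
    "\<psi> ` ball 0 \<epsilon> \<subseteq> S" "\<And>t. t \<in> ball 0 \<epsilon> \<Longrightarrow> f (\<psi> t) = f w + t ^ m"
proof -
  have hol: "(\<lambda>z. f z - f w) holomorphic_on S" by (intro holomorphic_intros holf)
  have nc': "\<not> (\<lambda>z. f z - f w) constant_on S"
  proof
    assume "(\<lambda>z. f z - f w) constant_on S"
    then obtain c where c: "\<And>z. z \<in> S \<Longrightarrow> f z - f w = c" unfolding constant_on_def by blast
    have "f z = c + f w" if "z \<in> S" for z using c[OF that] by (simp add: algebra_simps)
    then show False using nc unfolding constant_on_def by blast
  qed
  obtain g r n where n: "0 < n" and r: "0 < r" "ball w r \<subseteq> S" and g: "g holomorphic_on ball w r"
    and fg: "\<And>z. z \<in> ball w r \<Longrightarrow> f z - f w = (z - w) ^ n * g z"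
    and g0: "\<And>z. z \<in> ball w r \<Longrightarrow> g z \<noteq> 0"
  proof (rule holomorphic_factor_zero_nonconstant[OF hol S(1,2,3) _ nc'])
    show "f w - f w = 0" by simp
  qed (rule that)
  have contr: "contractible (ball w r)" by (rule convex_imp_contractible) simp
  obtain l where l: "l holomorphic_on ball w r" "\<And>z. z \<in> ball w r \<Longrightarrow> g z = exp (l z)"
  proof (rule contractible_imp_holomorphic_log[OF g contr])
    show "g z \<noteq> 0" if "z \<in> ball w r" for z by (rule g0[OF that])
  qed (rule that)
  define G where "G z = exp (l z / of_nat n)" for z
  have G: "G holomorphic_on ball w r" unfolding G_def using n by (intro holomorphic_intros l) auto
  have Gn: "G z ^ n = g z" if "z \<in> ball w r" for z
    using n l(2)[OF that] by (simp add: G_def exp_of_nat_mult[symmetric])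
  define \<phi> where "\<phi> z = (z - w) * G z" for z
  have \<phi>: "\<phi> holomorphic_on ball w r" unfolding \<phi>_def by (intro holomorphic_intros G)
  have wr: "w \<in> ball w r" using r by simp
  have "(\<phi> has_field_derivative (w - w) * deriv G w + 1 * G w) (at w)"
    unfolding \<phi>_def
    by (rule derivative_eq_intros refl holomorphic_derivI[OF G open_ball wr])+ simp
  then have "deriv \<phi> w = G w" by (simp add: DERIV_imp_deriv)
  then have "deriv \<phi> w \<noteq> 0" by (simp add: G_def)
  then obtain r' where r': "r' > 0" "ball w r' \<subseteq> ball w r" "open (\<phi> ` ball w r')" "inj_on \<phi> (ball w r')"
    by (rule has_complex_derivative_locally_invertible[OF \<phi> wr open_ball])
  obtain \<psi> where \<psi>: "\<psi> holomorphic_on (\<phi> ` ball w r')" "\<And>z. z \<in> ball w r' \<Longrightarrow> \<psi> (\<phi> z) = z"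
    by (rule holomorphic_has_inverse[OF holomorphic_on_subset[OF \<phi> r'(2)] open_ball r'(4)]) (rule that)
  have "\<phi> w \<in> \<phi> ` ball w r'" using r'(1) by (intro imageI) simp
  then have "0 \<in> \<phi> ` ball w r'" by (simp add: \<phi>_def)
  with r'(3) obtain \<epsilon> where \<epsilon>: "\<epsilon> > 0" "ball 0 \<epsilon> \<subseteq> \<phi> ` ball w r'"
    unfolding open_contains_ball by blast
  have inv: "\<psi> t \<in> ball w r'" "\<phi> (\<psi> t) = t" if "t \<in> ball 0 \<epsilon>" for t
  proof -
    obtain z where z: "z \<in> ball w r'" "t = \<phi> z" using \<epsilon>(2) \<open>t \<in> ball 0 \<epsilon>\<close> by blast
    show "\<psi> t \<in> ball w r'" "\<phi> (\<psi> t) = t" unfolding z(2) \<psi>(2)[OF z(1)] using z(1) by auto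
  qed
  show ?thesis
  proof (rule that[OF n \<epsilon>(1)])
    show "\<psi> holomorphic_on ball 0 \<epsilon>" by (rule holomorphic_on_subset[OF \<psi>(1) \<epsilon>(2)])
    show "\<psi> 0 = w" using \<psi>(2)[of w] r'(1) by (simp add: \<phi>_def)
    show "inj_on \<psi> (ball 0 \<epsilon>)" by (rule inj_on_inverseI[where g = \<phi>]) (rule inv(2))
    show "\<psi> ` ball 0 \<epsilon> \<subseteq> S" using inv(1) r'(2) r(2) by blast
    fix t :: complex assume t: "t \<in> ball 0 \<epsilon>"
    have mem: "\<psi> t \<in> ball w r" using inv(1)[OF t] r'(2) by blast
    have "f (\<psi> t) - f w = \<phi> (\<psi> t) ^ n"
      unfolding fg[OF mem] \<phi>_def power_mult_distrib Gn[OF mem] ..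
    then have "f (\<psi> t) - f w = t ^ n" unfolding inv(2)[OF t] .
    then show "f (\<psi> t) = f w + t ^ n" by (simp add: algebra_simps)
  qed
qed

lemma moebius_int_holomorphic:
  assumes "a * d - b * c = (1::int)"
  shows "moebius_int a b c d holomorphic_on \<H>"
  unfolding moebius_int_def
  by (intro holomorphic_intros) (use moebius_denom_nonzero[OF assms] in auto)

section \<open>Proper discontinuity and the multiplicity of \<open>klein_j\<close>\<close>

text \<open>If z and its image both lie in the disc, their imaginary parts are between r and 3 r, so
  |c z + d|^2 <= 3. The lower bound for lattice points then limits c and d, and applied to the
  numerator it limits a and b.\<close>

lemma unimodular_near_finite:
  assumes w: "Im w > 0"
  shows "finite {(a, b, c, d). a * d - b * c = (1::int) \<and>
     (\<exists>z\<in>ball w (Im w / 2). moebius_int a b c d z \<in> ball w (Im w / 2))}" (is "finite ?M")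
proof -
  define r where "r = Im w / 2"
  define C where "C = 1 + (\<bar>Re w\<bar> + r + 1) / r"
  define K where "K = C * (2 * (norm w + r + 1))"
  have r: "r > 0" using w by (simp add: r_def)
  have C: "C \<ge> 0" using r by (simp add: C_def)
  have bound: "\<bar>real_of_int a\<bar> \<le> K \<and> \<bar>real_of_int b\<bar> \<le> K \<and> \<bar>real_of_int c\<bar> \<le> K \<and> \<bar>real_of_int d\<bar> \<le> K"
    if det: "a * d - b * c = (1::int)" and z: "z \<in> ball w r" and \<gamma>z: "moebius_int a b c d z \<in> ball w r" for a b c d z
  proof -
    define \<alpha> where "\<alpha> = of_int c * z + of_int d"
    define z' where "z' = moebius_int a b c d z"
    have near: "Im x \<ge> r" "Im x \<le> 3 * r" "\<bar>Re x\<bar> \<le> \<bar>Re w\<bar> + r" "norm x \<le> norm w + r" if "x \<in> ball w r" for x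
    proof -
      have d: "norm (x - w) < r" using that by (simp add: dist_norm norm_minus_commute)
      have "\<bar>Im (x - w)\<bar> < r" using abs_Im_le_cmod[of "x - w"] d by linarith
      then have "Im (x - w) < r" "- Im (x - w) < r" by linarith+
      then show "Im x \<ge> r" "Im x \<le> 3 * r" by (simp_all add: r_def)
      have "\<bar>Re (x - w)\<bar> < r" using abs_Re_le_cmod[of "x - w"] d by linarith
      then show "\<bar>Re x\<bar> \<le> \<bar>Re w\<bar> + r" by (simp add: abs_if split: if_splits)
      show "norm x \<le> norm w + r" using norm_triangle_ineq2[of x w] d by linarith
    qed
    have zIm: "Im z > 0" using near(1)[OF z] r by linarith
    have \<alpha>0: "\<alpha> \<noteq> 0" unfolding \<alpha>_def by (rule moebius_denom_nonzero[OF det zIm])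
    have "Im z' = Im z / (norm \<alpha>)\<^sup>2" unfolding z'_def \<alpha>_def by (rule Im_moebius_int[OF det])
    then have "(norm \<alpha>)\<^sup>2 * Im z' = Im z" using \<alpha>0 by simp
    moreover have "(norm \<alpha>)\<^sup>2 * r \<le> (norm \<alpha>)\<^sup>2 * Im z'"
      using near(1)[OF \<gamma>z] by (intro mult_left_mono) (simp_all add: z'_def)
    ultimately have "(norm \<alpha>)\<^sup>2 * r \<le> 3 * r" using near(2)[OF z] by linarith
    then have "(norm \<alpha>)\<^sup>2 \<le> 3" using r by simp
    then have "(norm \<alpha>)\<^sup>2 \<le> 2\<^sup>2" by simp
    then have \<alpha>2: "norm \<alpha> \<le> 2" by (rule power2_le_imp_le) simp
    have low: "\<bar>real_of_int m\<bar> + \<bar>real_of_int n\<bar> \<le> C * norm (of_int m + of_int n * z)" for m n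
      using lattice_point_lower_bound[OF r near(1)[OF z] near(3)[OF z]] by (simp add: C_def)
    have "\<bar>real_of_int d\<bar> + \<bar>real_of_int c\<bar> \<le> C * norm \<alpha>"
      using low[of d c] by (simp add: \<alpha>_def add.commute)
    also have "\<dots> \<le> K" unfolding K_def
    proof (rule mult_left_mono[OF _ C])
      have "0 \<le> norm w + r" using r by (intro add_nonneg_nonneg) auto
      then have "2 \<le> 2 * (norm w + r + 1)" by simp
      with \<alpha>2 show "norm \<alpha> \<le> 2 * (norm w + r + 1)" by (rule order_trans)
    qed
    finally have cd: "\<bar>real_of_int d\<bar> + \<bar>real_of_int c\<bar> \<le> K" .
    have "of_int b + of_int a * z = z' * \<alpha>"
    proof -
      have "z' = (of_int a * z + of_int b) / \<alpha>" by (simp only: z'_def moebius_int_def \<alpha>_def)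
      then show ?thesis using \<alpha>0 by (simp add: add.commute)
    qed
    then have "\<bar>real_of_int b\<bar> + \<bar>real_of_int a\<bar> \<le> C * (norm z' * norm \<alpha>)"
      using low[of b a] by (simp add: norm_mult)
    also have "\<dots> \<le> K" unfolding K_def
    proof (rule mult_left_mono[OF _ C])
      have "norm z' * norm \<alpha> \<le> (norm w + r) * 2"
        using near(4)[OF \<gamma>z] \<alpha>2 r by (intro mult_mono) (auto simp: z'_def)
      then show "norm z' * norm \<alpha> \<le> 2 * (norm w + r + 1)" by simp
    qed
    finally show ?thesis using cd by linarith
  qed
  define N where "N = {- \<lfloor>K\<rfloor>..\<lfloor>K\<rfloor>}"
  have inN: "x \<in> N" if "\<bar>real_of_int x\<bar> \<le> K" for x
  proof -
    have "x \<le> \<lfloor>K\<rfloor>" "- x \<le> \<lfloor>K\<rfloor>" using that by (simp_all add: le_floor_iff abs_le_iff)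
    then show ?thesis by (simp add: N_def)
  qed
  have "?M \<subseteq> N \<times> N \<times> N \<times> N"
  proof
    fix x assume "x \<in> ?M"
    then obtain a b c d z where x: "x = (a, b, c, d)" and "a * d - b * c = 1"
      "z \<in> ball w r" "moebius_int a b c d z \<in> ball w r"
      unfolding r_def by auto
    from bound[OF this(2-4)] show "x \<in> N \<times> N \<times> N \<times> N"
      unfolding x using inN by simp
  qed
  then show ?thesis by (rule finite_subset) (simp add: N_def)
qed

text \<open>Only finitely many matrices can return a point of a fixed disc to it, and each of those
  that move \<open>w\<close> is excluded by shrinking the disc.\<close>

lemma proper_discontinuity:
  assumes w: "Im w > 0"
  obtains \<rho> where "\<rho> > 0" "ball w \<rho> \<subseteq> \<H>"
    "\<And>a b c d z. a * d - b * c = (1::int) \<Longrightarrow> z \<in> ball w \<rho> \<Longrightarrow> moebius_int a b c d z \<in> ball w \<rho>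
        \<Longrightarrow> moebius_int a b c d w = w"
proof -
  define r where "r = Im w / 2"
  have r: "r > 0" using w by (simp add: r_def)
  define M where "M = {(a, b, c, d). a * d - b * c = (1::int) \<and>
     (\<exists>z\<in>ball w r. moebius_int a b c d z \<in> ball w r)}"
  have fin: "finite M" unfolding M_def r_def by (rule unimodular_near_finite[OF w])
  have ev1: "\<forall>\<^sub>F \<rho> in at_right 0. \<forall>z\<in>ball w \<rho>. moebius_int a b c d z \<in> ball w \<rho> \<longrightarrow> moebius_int a b c d w = w"
    if det: "a * d - b * c = (1::int)" for a b c d
  proof (cases "moebius_int a b c d w = w")
    case True
    then show ?thesis by simp
  next
    case False
    define e where "e = dist (moebius_int a b c d w) w / 2"
    have e: "e > 0" using False by (simp add: e_def)
    have "isCont (moebius_int a b c d) w"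
      by (rule field_differentiable_imp_continuous_at)
         (rule holomorphic_on_imp_differentiable_at[OF moebius_int_holomorphic[OF det] open_upper_half_plane],
          use w in simp)
    then obtain s where s: "s > 0" "\<And>z. dist z w < s \<Longrightarrow> dist (moebius_int a b c d z) (moebius_int a b c d w) < e"
      using e unfolding continuous_at_eps_delta by blast
    have "\<forall>\<^sub>F \<rho> in at_right 0. \<rho> < min s e" using s e by (intro eventually_at_rightI[of 0 "min s e"]) auto
    then show ?thesis
    proof eventually_elim
      case (elim \<rho>)
      show ?case
      proof (intro ballI impI)
        fix z assume z: "z \<in> ball w \<rho>" "moebius_int a b c d z \<in> ball w \<rho>"
        have "dist (moebius_int a b c d z) (moebius_int a b c d w) < e"
          using z(1) elim by (intro s(2)) (simp add: dist_commute)
        moreover have "dist (moebius_int a b c d z) w < e" using z(2) elim by (simp add: dist_commute)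
        moreover have "dist (moebius_int a b c d w) w
            \<le> dist (moebius_int a b c d z) (moebius_int a b c d w) + dist (moebius_int a b c d z) w"
          by (rule dist_triangle3)
        ultimately have False by (simp add: e_def)
        then show "moebius_int a b c d w = w" ..
      qed
    qed
  qed
  have "\<forall>\<^sub>F \<rho> in at_right 0. \<forall>q\<in>M. case q of (a, b, c, d) \<Rightarrow>
      \<forall>z\<in>ball w \<rho>. moebius_int a b c d z \<in> ball w \<rho> \<longrightarrow> moebius_int a b c d w = w"
  proof (rule eventually_ball_finite[OF fin], rule ballI)
    fix q assume "q \<in> M"
    then obtain a b c d where q: "q = (a, b, c, d)" "a * d - b * c = 1" unfolding M_def by auto
    show "\<forall>\<^sub>F \<rho> in at_right 0. case q of (a, b, c, d) \<Rightarrow>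
      \<forall>z\<in>ball w \<rho>. moebius_int a b c d z \<in> ball w \<rho> \<longrightarrow> moebius_int a b c d w = w"
      unfolding q(1) prod.case by (rule ev1[OF q(2)])
  qed
  moreover have "\<forall>\<^sub>F \<rho> in at_right (0::real). 0 < \<rho> \<and> \<rho> < r"
    using r by (intro eventually_at_rightI[of 0 r]) auto
  ultimately have "\<forall>\<^sub>F \<rho> in at_right 0. (\<forall>q\<in>M. case q of (a, b, c, d) \<Rightarrow>
      \<forall>z\<in>ball w \<rho>. moebius_int a b c d z \<in> ball w \<rho> \<longrightarrow> moebius_int a b c d w = w) \<and> 0 < \<rho> \<and> \<rho> < r"
    by (rule eventually_conj)
  then obtain \<rho> where M: "\<forall>q\<in>M. case q of (a, b, c, d) \<Rightarrow>
      \<forall>z\<in>ball w \<rho>. moebius_int a b c d z \<in> ball w \<rho> \<longrightarrow> moebius_int a b c d w = w" and \<rho>: "0 < \<rho>" "\<rho> < r"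
    using eventually_happens'[OF trivial_limit_at_right_real] by blast
  show ?thesis
  proof (rule that[OF \<rho>(1)])
    show "ball w \<rho> \<subseteq> \<H>"
    proof
      fix x assume "x \<in> ball w \<rho>"
      then have "norm (x - w) < r" using \<rho> by (simp add: dist_norm norm_minus_commute)
      then have "\<bar>Im (x - w)\<bar> < r" using abs_Im_le_cmod[of "x - w"] by linarith
      then have "- Im (x - w) < r" by linarith
      then have "Im w - Im x < Im w / 2" by (simp add: r_def)
      then show "x \<in> \<H>" using w by simp
    qed
    fix a b c d z
    assume *: "a * d - b * c = (1::int)" "z \<in> ball w \<rho>" "moebius_int a b c d z \<in> ball w \<rho>"
    have "z \<in> ball w r" "moebius_int a b c d z \<in> ball w r" using * \<rho> by auto
    with *(1) have "(a, b, c, d) \<in> M" unfolding M_def by blast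
    with M have "\<forall>z\<in>ball w \<rho>. moebius_int a b c d z \<in> ball w \<rho> \<longrightarrow> moebius_int a b c d w = w" by auto
    then show "moebius_int a b c d w = w" using * by blast
  qed
qed

lemma klein_j_not_constant: "\<not> klein_j constant_on \<H>"
proof
  assume "klein_j constant_on \<H>"
  then obtain c where c: "\<And>z. z \<in> \<H> \<Longrightarrow> klein_j z = c" unfolding constant_on_def by blast
  have "klein_j \<i> = c" "klein_j zeta6 = c" by (rule c, simp add: Im_zeta6)+
  then show False by (simp add: klein_j_i klein_j_zeta6)
qed

text \<open>The \<open>m\<close> preimages near \<open>w\<close> of a nearby value are exchanged by the stabilizer of \<open>w\<close>,
  which bounds the multiplicity \<open>m\<close>.\<close>

lemma klein_j_local_form:
  assumes w: "Im w > 0"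
  obtains m \<epsilon> \<psi>
  where "0 < m" "m \<le> ramification (klein_j w)" "0 < \<epsilon>" "\<psi> holomorphic_on ball 0 \<epsilon>" "\<psi> 0 = w"
    "inj_on \<psi> (ball 0 \<epsilon>)" "\<psi> ` ball 0 \<epsilon> \<subseteq> \<H>"
    "\<And>t. t \<in> ball 0 \<epsilon> \<Longrightarrow> klein_j (\<psi> t) = klein_j w + t ^ m"
proof -
  obtain m \<epsilon> \<psi> where m: "0 < m" and \<epsilon>: "0 < \<epsilon>" and \<psi>: "\<psi> holomorphic_on ball 0 \<epsilon>" "\<psi> 0 = w"
    and inj: "inj_on \<psi> (ball 0 \<epsilon>)" and up: "\<psi> ` ball 0 \<epsilon> \<subseteq> \<H>"
    and j: "\<And>t. t \<in> ball 0 \<epsilon> \<Longrightarrow> klein_j (\<psi> t) = klein_j w + t ^ m"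
  proof (rule local_normal_form[OF klein_j_holomorphic open_upper_half_plane _ _ klein_j_not_constant])
    show "connected \<H>" by (rule convex_connected[OF convex_upper_half_plane])
    show "w \<in> \<H>" using w by simp
  qed (rule that)
  obtain \<rho> where \<rho>: "\<rho> > 0" "ball w \<rho> \<subseteq> \<H>"
    and pd: "\<And>a b c d z. a * d - b * c = (1::int) \<Longrightarrow> z \<in> ball w \<rho> \<Longrightarrow> moebius_int a b c d z \<in> ball w \<rho>
        \<Longrightarrow> moebius_int a b c d w = w"
    by (rule proper_discontinuity[OF w]) (rule that)
  have "isCont \<psi> 0"
    using holomorphic_on_imp_continuous_on[OF \<psi>(1)] \<epsilon> by (simp add: continuous_on_eq_continuous_at)
  then obtain s where s: "s > 0" "\<And>t. dist t 0 < s \<Longrightarrow> dist (\<psi> t) w < \<rho>"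
    using \<rho>(1) unfolding continuous_at_eps_delta \<psi>(2) by blast
  define t where "t = complex_of_real (min s \<epsilon> / 2)"
  have t: "t \<noteq> 0" "norm t < s" "norm t < \<epsilon>" using s(1) \<epsilon> by (auto simp: t_def)
  \<comment> \<open>The \<open>m\<close> roots yield \<open>m\<close> distinct points \<psi>(x) with
    the same value of \<open>j\<close>, all close to \<open>w\<close>. They must therefore be images
    of \<psi>(t) under matrices fixing \<open>w\<close>.\<close>
  define R where "R = {x. x ^ m = t ^ m}"
  have Rnorm: "norm x = norm t" if "x \<in> R" for x
  proof -
    have "norm x ^ m = norm t ^ m" using that by (simp add: R_def norm_power[symmetric])
    then show ?thesis using m by (simp add: power_eq_iff_eq_base)
  qed
  have Rsub: "R \<subseteq> ball 0 \<epsilon>" using Rnorm t by auto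
  have Rnear: "\<psi> x \<in> ball w \<rho>" if "x \<in> R" for x
    using s(2)[of x] Rnorm[OF that] t(2) by (simp add: dist_commute)
  have cardR: "card R = m" unfolding R_def by (rule card_nth_roots) (use t m in auto)
  have tR: "t \<in> R" by (simp add: R_def)
  define Q where "Q = {(a, b, c, d). a * d - b * c = (1::int) \<and> moebius_int a b c d w = w}"
  define u where "u = (\<lambda>(a::int, b::int, c::int, d::int). (of_int c * w + of_int d)\<^sup>2)"
  define act where "act = (\<lambda>(a, b, c, d). moebius_int a b c d (\<psi> t))"
  have uQ: "u ` Q = stabilizer_units w" unfolding u_def Q_def stabilizer_units_def by force
  \<comment> \<open>A matrix acts through its unit alone, so choosing one matrix per unit maps
    \<open>stabilizer_units w\<close> onto a set containing \<psi>(R).\<close>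
  define pick where "pick \<beta> = (SOME q. q \<in> Q \<and> u q = \<beta>)" for \<beta>
  have act_pick: "act q = act (pick (u q))" if q: "q \<in> Q" for q
  proof -
    have p: "pick (u q) \<in> Q \<and> u (pick (u q)) = u q" unfolding pick_def
      by (rule someI[of _ q]) (use q in simp)
    obtain a b c d where qd: "q = (a, b, c, d)" by (metis surj_pair)
    obtain a' b' c' d' where pd': "pick (u q) = (a', b', c', d')" by (metis surj_pair)
    have "moebius_int a b c d = moebius_int a' b' c' d'"
    proof (rule stabilizer_eq_of_unit_sq_eq[OF w])
      show "a * d - b * c = 1" "moebius_int a b c d w = w" using q unfolding qd Q_def by auto
      show "a' * d' - b' * c' = 1" "moebius_int a' b' c' d' w = w" using p unfolding pd' Q_def by auto
      show "(of_int c * w + of_int d)\<^sup>2 = (of_int c' * w + of_int d' :: complex)\<^sup>2"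
        using p unfolding pd' unfolding qd u_def by simp
    qed
    then show ?thesis unfolding pd' unfolding qd act_def by simp
  qed
  have "\<psi> ` R \<subseteq> (\<lambda>\<beta>. act (pick \<beta>)) ` stabilizer_units w"
  proof
    fix y assume "y \<in> \<psi> ` R"
    then obtain x where x: "x \<in> R" "y = \<psi> x" by blast
    have Im: "Im (\<psi> x) > 0" "Im (\<psi> t) > 0" using up Rsub x(1) tR by auto
    have "klein_j (\<psi> x) = klein_j (\<psi> t)"
    proof -
      have "x \<in> ball 0 \<epsilon>" "t \<in> ball 0 \<epsilon>" using Rsub x(1) tR by blast+
      moreover have "x ^ m = t ^ m" using x(1) by (simp add: R_def)
      ultimately show ?thesis using j[of x] j[of t] by simp
    qed
    then obtain a b c d where g: "a * d - b * c = (1::int)" "\<psi> x = moebius_int a b c d (\<psi> t)"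
      by (rule klein_j_eq_imp_equivalent[OF Im])
    have "moebius_int a b c d w = w"
      by (rule pd[OF g(1) Rnear[OF tR]]) (use Rnear[OF x(1)] g(2) in simp)
    then have q: "(a, b, c, d) \<in> Q" using g(1) by (simp add: Q_def)
    have "y = act (a, b, c, d)" by (simp add: x(2) g(2) act_def)
    also have "\<dots> = act (pick (u (a, b, c, d)))" by (rule act_pick[OF q])
    finally show "y \<in> (\<lambda>\<beta>. act (pick \<beta>)) ` stabilizer_units w" using q uQ by blast
  qed
  then have "card (\<psi> ` R) \<le> card ((\<lambda>\<beta>. act (pick \<beta>)) ` stabilizer_units w)"
    by (rule card_mono[rotated]) (simp add: stabilizer_units_card[OF w])
  also have "\<dots> \<le> card (stabilizer_units w)" by (rule card_image_le) (rule stabilizer_units_card(1)[OF w])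
  also have "\<dots> \<le> ramification (klein_j w)" by (rule stabilizer_units_card(2)[OF w])
  also have "card (\<psi> ` R) = m" using card_image[OF inj_on_subset[OF inj Rsub]] cardR by simp
  finally show ?thesis by (intro that[OF m _ \<epsilon> \<psi> inj up j])
qed

section \<open>The covering over the complement of the critical values\<close>

abbreviation regular_values :: "complex set" where
  "regular_values \<equiv> - {0, 1728}"

abbreviation regular_points :: "complex set" where
  "regular_points \<equiv> {z \<in> \<H>. klein_j z \<in> regular_values}"

lemma open_regular_points: "open regular_points"
proof -
  have "open (\<H> \<inter> klein_j -` regular_values)"
    by (rule continuous_open_preimage[OF holomorphic_on_imp_continuous_on[OF klein_j_holomorphic]
          open_upper_half_plane]) auto
  then show ?thesis by (simp add: Int_def vimage_def)
qed

lemma klein_j_local_section: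
  assumes w: "Im w > 0" "klein_j w \<in> regular_values"
  obtains \<epsilon> \<sigma> where "\<epsilon> > 0" "\<sigma> holomorphic_on ball (klein_j w) \<epsilon>" "\<sigma> ` ball (klein_j w) \<epsilon> \<subseteq> \<H>"
    "\<And>v. v \<in> ball (klein_j w) \<epsilon> \<Longrightarrow> klein_j (\<sigma> v) = v" "\<sigma> (klein_j w) = w"
proof -
  obtain m \<epsilon> \<psi> where m: "0 < m" "m \<le> ramification (klein_j w)" and \<epsilon>: "0 < \<epsilon>"
    and \<psi>: "\<psi> holomorphic_on ball 0 \<epsilon>" "\<psi> 0 = w"
    and inj: "inj_on \<psi> (ball 0 \<epsilon>)" and up: "\<psi> ` ball 0 \<epsilon> \<subseteq> \<H>"
    and j: "\<And>t. t \<in> ball 0 \<epsilon> \<Longrightarrow> klein_j (\<psi> t) = klein_j w + t ^ m"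
    by (rule klein_j_local_form[OF w(1)]) (rule that)
  have "ramification (klein_j w) = 1" using w(2) by (simp add: ramification_def)
  then have m1: "m = 1" using m by simp
  define \<sigma> where "\<sigma> v = \<psi> (v - klein_j w)" for v
  have sh: "v - klein_j w \<in> ball 0 \<epsilon>" if "v \<in> ball (klein_j w) \<epsilon>" for v
    using that by (simp add: dist_norm norm_minus_commute)
  show ?thesis
  proof (rule that[OF \<epsilon>])
    have "(\<psi> \<circ> (\<lambda>v. v - klein_j w)) holomorphic_on ball (klein_j w) \<epsilon>"
      by (rule holomorphic_on_compose_gen[OF _ \<psi>(1)]) (use sh in \<open>auto intro!: holomorphic_intros\<close>)
    then show "\<sigma> holomorphic_on ball (klein_j w) \<epsilon>" by (simp add: o_def \<sigma>_def[abs_def])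
    show "\<sigma> ` ball (klein_j w) \<epsilon> \<subseteq> \<H>" using up sh unfolding \<sigma>_def by blast
    show "\<sigma> (klein_j w) = w" by (simp add: \<sigma>_def \<psi>(2))
    show "klein_j (\<sigma> v) = v" if "v \<in> ball (klein_j w) \<epsilon>" for v
      using j[OF sh[OF that]] by (simp add: \<sigma>_def m1)
  qed
qed

lemma klein_j_locally_injective:
  assumes w: "Im w > 0" "klein_j w \<in> regular_values"
  obtains N where "open N" "w \<in> N" "inj_on klein_j N"
proof -
  obtain m \<epsilon> \<psi> where m: "0 < m" "m \<le> ramification (klein_j w)" and \<epsilon>: "0 < \<epsilon>"
    and \<psi>: "\<psi> holomorphic_on ball 0 \<epsilon>" "\<psi> 0 = w"
    and inj: "inj_on \<psi> (ball 0 \<epsilon>)" and up: "\<psi> ` ball 0 \<epsilon> \<subseteq> \<H>"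
    and j: "\<And>t. t \<in> ball 0 \<epsilon> \<Longrightarrow> klein_j (\<psi> t) = klein_j w + t ^ m"
    by (rule klein_j_local_form[OF w(1)]) (rule that)
  have "ramification (klein_j w) = 1" using w(2) by (simp add: ramification_def)
  then have m1: "m = 1" using m by simp
  show ?thesis
  proof (rule that)
    show "open (\<psi> ` ball 0 \<epsilon>)" by (rule open_mapping_thm3[OF \<psi>(1) open_ball inj])
    show "w \<in> \<psi> ` ball 0 \<epsilon>" using \<psi>(2) \<epsilon> by force
    show "inj_on klein_j (\<psi> ` ball 0 \<epsilon>)"
    proof (rule inj_onI)
      fix x y assume "x \<in> \<psi> ` ball 0 \<epsilon>" "y \<in> \<psi> ` ball 0 \<epsilon>" and eq: "klein_j x = klein_j y"
      then obtain s t where st: "s \<in> ball 0 \<epsilon>" "x = \<psi> s" "t \<in> ball 0 \<epsilon>" "y = \<psi> t" by blast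
      then have "s = t" using eq j[OF st(1)] j[OF st(3)] by (simp add: m1)
      then show "x = y" using st by simp
    qed
  qed
qed

text \<open>At the regular value over \<open>x0\<close>, \<open>j\<close> is locally injective, so
  the lifts agree near \<open>x0\<close>; analytic continuation does the rest on the connected set
  \<open>T\<close>.\<close>

lemma holomorphic_lifts_agree:
  assumes T: "open T" "connected T"
    and \<sigma>: "\<sigma> holomorphic_on T" "\<sigma> ` T \<subseteq> \<H>" and \<tau>: "\<tau> holomorphic_on T" "\<tau> ` T \<subseteq> \<H>"
    and eq: "\<And>x. x \<in> T \<Longrightarrow> klein_j (\<sigma> x) = klein_j (\<tau> x)"
    and x0: "x0 \<in> T" "\<sigma> x0 = \<tau> x0" "klein_j (\<sigma> x0) \<in> regular_values"
    and x: "x \<in> T"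
  shows "\<sigma> x = \<tau> x"
proof -
  have "Im (\<sigma> x0) > 0" using \<sigma>(2) x0(1) by auto
  then obtain N where N: "open N" "\<sigma> x0 \<in> N" "inj_on klein_j N"
    by (rule klein_j_locally_injective[OF _ x0(3)])
  define U where "U = (T \<inter> \<sigma> -` N) \<inter> (T \<inter> \<tau> -` N)"
  have U: "open U" unfolding U_def
    by (intro open_Int continuous_open_preimage[OF holomorphic_on_imp_continuous_on[OF \<sigma>(1)] T(1) N(1)]
         continuous_open_preimage[OF holomorphic_on_imp_continuous_on[OF \<tau>(1)] T(1) N(1)])
  have x0U: "x0 \<in> U" using N(2) x0 by (simp add: U_def)
  show ?thesis
  proof (rule analytic_continuation_open[OF U T(1) _ T(2) _ \<sigma>(1) \<tau>(1) _ x])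
    show "U \<noteq> {}" using x0U by blast
    show "U \<subseteq> T" by (auto simp: U_def)
    fix z assume z: "z \<in> U"
    have "z \<in> T" using z by (simp add: U_def)
    then have "klein_j (\<sigma> z) = klein_j (\<tau> z)" by (rule eq)
    then show "\<sigma> z = \<tau> z"
      by (rule inj_onD[OF N(3)]) (use z in \<open>simp_all add: U_def\<close>)
  qed
qed

text \<open>Over a small disc there is one holomorphic section through a chosen preimage, and its
  images under the modular group pass through all other preimages. Sections that meet
  coincide.\<close>

lemma klein_j_covering: "covering_space regular_points klein_j regular_values"
proof
  show "continuous_on regular_points klein_j"
    by (rule continuous_on_subset[OF holomorphic_on_imp_continuous_on[OF klein_j_holomorphic]]) auto
  show "klein_j ` regular_points = regular_values"
  proof
    show "klein_j ` regular_points \<subseteq> regular_values" by auto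
    show "regular_values \<subseteq> klein_j ` regular_points"
    proof
      fix v :: complex assume v: "v \<in> regular_values"
      obtain z where "Im z > 0" "klein_j z = v" using klein_j_surj by blast
      then show "v \<in> klein_j ` regular_points" using v by (intro image_eqI[of _ _ z]) auto
    qed
  qed
  fix v :: complex assume v: "v \<in> regular_values"
  obtain w where w: "Im w > 0" "klein_j w = v" using klein_j_surj by blast
  have wv: "klein_j w \<in> regular_values" using w v by simp
  obtain \<epsilon> \<sigma> where \<epsilon>: "\<epsilon> > 0" and "\<sigma> holomorphic_on ball (klein_j w) \<epsilon>" "\<sigma> ` ball (klein_j w) \<epsilon> \<subseteq> \<H>"
    "\<And>v. v \<in> ball (klein_j w) \<epsilon> \<Longrightarrow> klein_j (\<sigma> v) = v" "\<sigma> (klein_j w) = w"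
    by (rule klein_j_local_section[OF w(1) wv]) (rule that)
  note \<sigma> = this(2-4)[unfolded w(2)]
  have "open regular_values" by auto
  then obtain \<delta> where \<delta>: "\<delta> > 0" "ball v \<delta> \<subseteq> regular_values"
    using v unfolding open_contains_ball by blast
  define T where "T = ball v (min \<epsilon> \<delta>)"
  have "T \<subseteq> ball v \<delta>" unfolding T_def by (rule subset_ball) simp
  then have TS: "T \<subseteq> regular_values" using \<delta>(2) by (rule order_trans)
  have T: "open T" "connected T" "v \<in> T" "T \<subseteq> ball v \<epsilon>"
    using \<epsilon> \<delta>(1) unfolding T_def by auto
  \<comment> \<open>The sheets are the images of all holomorphic sections. Indexing them by sections
    and not by matrices keeps a sheet from being listed twice.\<close>
  define V where "V = {\<tau> ` T | \<tau>. \<tau> holomorphic_on T \<and> \<tau> ` T \<subseteq> \<H> \<and> (\<forall>x\<in>T. klein_j (\<tau> x) = x)}"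
  have "\<Union>V = regular_points \<inter> klein_j -` T"
  proof
    show "\<Union>V \<subseteq> regular_points \<inter> klein_j -` T"
    proof
      fix z assume "z \<in> \<Union>V"
      then obtain \<tau> x where \<tau>: "\<tau> ` T \<subseteq> \<H>" "\<forall>x\<in>T. klein_j (\<tau> x) = x" and x: "x \<in> T" "z = \<tau> x"
        unfolding V_def by blast
      have "z \<in> \<H>" "klein_j z = x" using \<tau> x by blast+
      then show "z \<in> regular_points \<inter> klein_j -` T" using x TS by auto
    qed
    show "regular_points \<inter> klein_j -` T \<subseteq> \<Union>V"
    proof
      fix z assume "z \<in> regular_points \<inter> klein_j -` T"
      then have z: "Im z > 0" "klein_j z \<in> T" by auto
      define x where "x = klein_j z"
      have x: "x \<in> T" "x \<in> ball v \<epsilon>" using z T(4) by (auto simp: x_def)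
      have Im\<sigma>: "Im (\<sigma> x) > 0" using \<sigma>(2) x(2) by blast
      have "klein_j z = klein_j (\<sigma> x)" using \<sigma>(3)[OF x(2)] by (simp add: x_def)
      then obtain a b c d where g: "a * d - b * c = (1::int)" "z = moebius_int a b c d (\<sigma> x)"
        by (rule klein_j_eq_imp_equivalent[OF z(1) Im\<sigma>])
      define \<tau> where "\<tau> = moebius_int a b c d \<circ> \<sigma>"
      have \<sigma>T: "\<sigma> holomorphic_on T" "\<sigma> ` T \<subseteq> \<H>"
        using holomorphic_on_subset[OF \<sigma>(1) T(4)] \<sigma>(2) T(4) by blast+
      have "\<tau> holomorphic_on T" unfolding \<tau>_def
        by (rule holomorphic_on_compose_gen[OF \<sigma>T(1) moebius_int_holomorphic[OF g(1)] \<sigma>T(2)])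
      moreover have "\<tau> ` T \<subseteq> \<H>" unfolding \<tau>_def using moebius_int_upper[OF g(1)] \<sigma>T(2) by auto
      moreover have "\<forall>y\<in>T. klein_j (\<tau> y) = y"
      proof
        fix y assume y: "y \<in> T"
        have "Im (\<sigma> y) > 0" using \<sigma>T(2) y by blast
        then have "klein_j (\<tau> y) = klein_j (\<sigma> y)" unfolding \<tau>_def o_def by (rule klein_j_moebius[OF g(1)])
        also have "\<dots> = y" by (rule \<sigma>(3)) (use y T(4) in blast)
        finally show "klein_j (\<tau> y) = y" .
      qed
      ultimately have "\<tau> ` T \<in> V" unfolding V_def by blast
      moreover have "z \<in> \<tau> ` T" using x(1) g(2) unfolding \<tau>_def by auto
      ultimately show "z \<in> \<Union>V" by blast
    qed
  qed
  moreover have "\<forall>u\<in>V. openin (top_of_set regular_points) u"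
  proof
    fix u assume "u \<in> V"
    then obtain \<tau> where \<tau>: "u = \<tau> ` T" "\<tau> holomorphic_on T" "\<tau> ` T \<subseteq> \<H>" "\<forall>x\<in>T. klein_j (\<tau> x) = x"
      unfolding V_def by blast
    have "inj_on \<tau> T" using \<tau>(4) by (metis inj_onI)
    then have "open u" unfolding \<tau>(1) by (rule open_mapping_thm3[OF \<tau>(2) T(1)])
    moreover have "u \<subseteq> regular_points" unfolding \<tau>(1) using \<tau>(3,4) TS by auto
    ultimately show "openin (top_of_set regular_points) u"
      unfolding openin_open_eq[OF open_regular_points] by blast
  qed
  moreover have "pairwise disjnt V"
  proof (rule pairwiseI)
    fix u u' assume "u \<in> V" "u' \<in> V" and ne: "u \<noteq> u'"
    then obtain \<tau> \<tau>' where \<tau>: "u = \<tau> ` T" "\<tau> holomorphic_on T" "\<tau> ` T \<subseteq> \<H>" "\<forall>x\<in>T. klein_j (\<tau> x) = x"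
      and \<tau>': "u' = \<tau>' ` T" "\<tau>' holomorphic_on T" "\<tau>' ` T \<subseteq> \<H>" "\<forall>x\<in>T. klein_j (\<tau>' x) = x"
      unfolding V_def by blast
    show "disjnt u u'"
    proof (rule ccontr)
      assume "\<not> disjnt u u'"
      then obtain x x' where x: "x \<in> T" "x' \<in> T" "\<tau> x = \<tau>' x'"
        unfolding disjnt_def \<tau>(1) \<tau>'(1) by blast
      have "x = x'" using \<tau>(4) \<tau>'(4) x by metis
      then have xx: "\<tau> x = \<tau>' x" using x by simp
      have "\<tau> y = \<tau>' y" if y: "y \<in> T" for y
      proof (rule holomorphic_lifts_agree[OF T(1,2) \<tau>(2,3) \<tau>'(2,3) _ x(1) xx _ y])
        show "klein_j (\<tau> z) = klein_j (\<tau>' z)" if "z \<in> T" for z using \<tau>(4) \<tau>'(4) that by simp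
        show "klein_j (\<tau> x) \<in> regular_values" using \<tau>(4) x(1) TS by auto
      qed
      then have "u = u'" unfolding \<tau>(1) \<tau>'(1) by (intro image_cong refl)
      then show False using ne by simp
    qed
  qed
  moreover have "\<forall>u\<in>V. \<exists>q. homeomorphism u T klein_j q"
  proof
    fix u assume "u \<in> V"
    then obtain \<tau> where \<tau>: "u = \<tau> ` T" "\<tau> holomorphic_on T" "\<tau> ` T \<subseteq> \<H>" "\<forall>x\<in>T. klein_j (\<tau> x) = x"
      unfolding V_def by blast
    have "homeomorphism u T klein_j \<tau>"
    proof
      show "continuous_on u klein_j"
        by (rule continuous_on_subset[OF holomorphic_on_imp_continuous_on[OF klein_j_holomorphic]])
           (use \<tau> in blast)
      show "continuous_on T \<tau>" by (rule holomorphic_on_imp_continuous_on[OF \<tau>(2)])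
      show "klein_j ` u \<subseteq> T" unfolding \<tau>(1) using \<tau>(4) by auto
      show "\<tau> ` T \<subseteq> u" unfolding \<tau>(1) ..
      show "\<tau> (klein_j x) = x" if "x \<in> u" for x
      proof -
        obtain y where y: "y \<in> T" "x = \<tau> y" using \<open>x \<in> u\<close> unfolding \<tau>(1) by blast
        then show ?thesis using \<tau>(4) by simp
      qed
      show "klein_j (\<tau> y) = y" if "y \<in> T" for y using \<tau>(4) that by blast
    qed
    then show "\<exists>q. homeomorphism u T klein_j q" by blast
  qed
  moreover have "openin (top_of_set regular_values) T"
    using T TS by (simp add: openin_open_eq open_Compl)
  ultimately show "\<exists>T. v \<in> T \<and> openin (top_of_set regular_values) T \<and>
      (\<exists>V. \<Union>V = regular_points \<inter> klein_j -` T \<and> (\<forall>u\<in>V. openin (top_of_set regular_points) u) \<and>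
        pairwise disjnt V \<and> (\<forall>u\<in>V. \<exists>q. homeomorphism u T klein_j q))"
    using T(3) by blast
qed

text \<open>A convex set is simply connected, so the covering provides a continuous lift. Locally it
  equals a holomorphic section composed with \<open>F\<close>, and a modular transformation moves
  its value at \<open>p\<close> to the prescribed \<open>z\<close>.\<close>

lemma klein_j_lift:
  assumes P: "open P" "convex P" and F: "F holomorphic_on P" "F ` P \<subseteq> regular_values"
    and p: "p \<in> P" and z: "Im z > 0" "klein_j z = F p"
  obtains h where "h holomorphic_on P" "h ` P \<subseteq> \<H>" "\<And>u. u \<in> P \<Longrightarrow> klein_j (h u) = F u" "h p = z"
proof -
  obtain h0 where h0: "continuous_on P h0" "h0 \<in> P \<rightarrow> regular_points" "\<And>u. u \<in> P \<Longrightarrow> klein_j (h0 u) = F u"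
  proof (rule covering_space_lift[OF klein_j_covering])
    show "simply_connected P" by (rule convex_imp_simply_connected[OF P(2)])
    show "locally path_connected P" by (rule open_imp_locally_path_connected[OF P(1)])
    show "continuous_on P F" by (rule holomorphic_on_imp_continuous_on[OF F(1)])
    show "F \<in> P \<rightarrow> regular_values" using F(2) by auto
  qed (rule that)
  have "h0 field_differentiable at u" if u: "u \<in> P" for u
  proof -
    have hu: "Im (h0 u) > 0" "klein_j (h0 u) \<in> regular_values" using h0(2) u by auto
    obtain N where N: "open N" "h0 u \<in> N" "inj_on klein_j N"
      by (rule klein_j_locally_injective[OF hu])
    obtain \<epsilon> \<sigma> where \<epsilon>: "\<epsilon> > 0" and \<sigma>: "\<sigma> holomorphic_on ball (klein_j (h0 u)) \<epsilon>" "\<sigma> ` ball (klein_j (h0 u)) \<epsilon> \<subseteq> \<H>"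
      and j\<sigma>: "\<And>v. v \<in> ball (klein_j (h0 u)) \<epsilon> \<Longrightarrow> klein_j (\<sigma> v) = v" and \<sigma>u: "\<sigma> (klein_j (h0 u)) = h0 u"
      by (rule klein_j_local_section[OF hu]) (rule that)
    define B where "B = ball (klein_j (h0 u)) \<epsilon>"
    have openB: "open (B \<inter> \<sigma> -` N)" unfolding B_def
      by (rule continuous_open_preimage[OF holomorphic_on_imp_continuous_on[OF \<sigma>(1)] open_ball N(1)])
    define U where "U = (P \<inter> h0 -` N) \<inter> (P \<inter> F -` (B \<inter> \<sigma> -` N))"
    have U: "open U" unfolding U_def
      by (intro open_Int continuous_open_preimage[OF h0(1) P(1) N(1)]
          continuous_open_preimage[OF holomorphic_on_imp_continuous_on[OF F(1)] P(1) openB])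
    have "F u = klein_j (h0 u)" using h0(3)[OF u] by simp
    then have uU: "u \<in> U" using u N(2) \<epsilon> \<sigma>u by (simp add: U_def B_def)
    have "(\<sigma> \<circ> F) holomorphic_on U"
      by (rule holomorphic_on_compose_gen[OF holomorphic_on_subset[OF F(1)] \<sigma>(1)])
         (auto simp: U_def B_def)
    then have "h0 holomorphic_on U"
    proof (rule holomorphic_transform)
      fix x assume x: "x \<in> U"
      have "klein_j ((\<sigma> \<circ> F) x) = klein_j (h0 x)"
        using j\<sigma>[of "F x"] h0(3)[of x] x by (simp add: U_def B_def)
      then show "(\<sigma> \<circ> F) x = h0 x"
        by (rule inj_onD[OF N(3)]) (use x in \<open>simp_all add: U_def\<close>)
    qed
    then show ?thesis using U uU by (rule holomorphic_on_imp_differentiable_at)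
  qed
  then have h0hol: "h0 holomorphic_on P" by (simp add: holomorphic_on_def field_differentiable_at_within)
  have h0up: "Im (h0 u) > 0" if "u \<in> P" for u using h0(2) that by auto
  have "klein_j z = klein_j (h0 p)" using z(2) h0(3)[OF p] by simp
  then obtain a b c d where g: "a * d - b * c = (1::int)" "z = moebius_int a b c d (h0 p)"
    by (rule klein_j_eq_imp_equivalent[OF z(1) h0up[OF p]])
  show ?thesis
  proof (rule that[of "moebius_int a b c d \<circ> h0"])
    show "moebius_int a b c d \<circ> h0 holomorphic_on P"
      by (rule holomorphic_on_compose_gen[OF h0hol moebius_int_holomorphic[OF g(1)]]) (use h0up in auto)
    show "(moebius_int a b c d \<circ> h0) ` P \<subseteq> \<H>" using moebius_int_upper[OF g(1) h0up] by auto
    show "klein_j ((moebius_int a b c d \<circ> h0) u) = F u" if u: "u \<in> P" for u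
      using klein_j_moebius[OF g(1) h0up[OF u]] h0(3)[OF u] by simp
    show "(moebius_int a b c d \<circ> h0) p = z" using g(2) by simp
  qed
qed

text \<open>In the coordinate \<open>u = ln q\<close> the lift is unramified, and for small \<open>q\<close> it is \<open>\<psi> (exp u)\<close>;
  hence it is \<open>2 \<pi> \<i>\<close>-periodic and descends to the disc.\<close>

lemma branched_lift:
  assumes w: "Im w > 0" and R: "R > 0" and crit: "{0, 1728} \<inter> ball (klein_j w) R \<subseteq> {klein_j w}"
  obtains m \<rho> k where "0 < m" "m \<le> ramification (klein_j w)" "0 < \<rho>" "\<rho> ^ m = R"
    "k holomorphic_on ball 0 \<rho>" "k 0 = w" "k ` ball 0 \<rho> \<subseteq> \<H>"
    "\<And>q. q \<in> ball 0 \<rho> \<Longrightarrow> klein_j (k q) = klein_j w + q ^ m"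
proof -
  define v where "v = klein_j w"
  obtain m \<epsilon> \<psi> where m: "0 < m" "m \<le> ramification (klein_j w)" and \<epsilon>: "0 < \<epsilon>"
    and \<psi>: "\<psi> holomorphic_on ball 0 \<epsilon>" "\<psi> 0 = w"
    and "inj_on \<psi> (ball 0 \<epsilon>)" and up: "\<psi> ` ball 0 \<epsilon> \<subseteq> \<H>"
    and j: "\<And>t. t \<in> ball 0 \<epsilon> \<Longrightarrow> klein_j (\<psi> t) = klein_j w + t ^ m"
    by (rule klein_j_local_form[OF w]) (rule that)
  \<comment> \<open>The m-th power maps the disc of radius \<rho> onto the disc of radius
    \<open>R\<close>.\<close>
  define \<rho> where "\<rho> = root m R"
  have \<rho>: "0 < \<rho>" "\<rho> ^ m = R" using m(1) R by (simp_all add: \<rho>_def real_root_gt_zero)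
  define P where "P = {u. Re u < ln \<rho>}"
  have P: "open P" "convex P"
    unfolding P_def by (rule open_halfspace_Re_lt, rule convex_halfspace_Re_lt)
  have exp_ball: "exp u \<in> ball 0 s" if "Re u < ln s" "s > 0" for u :: complex and s
  proof -
    have "exp (Re u) < exp (ln s)" using that(1) by (simp only: exp_less_cancel_iff)
    then show ?thesis using that(2) by simp
  qed
  define F where "F u = v + exp u ^ m" for u
  have F: "F holomorphic_on P" unfolding F_def by (intro holomorphic_intros)
  have FS: "F ` P \<subseteq> regular_values"
  proof
    fix x assume "x \<in> F ` P"
    then obtain u where u: "Re u < ln \<rho>" "x = v + exp u ^ m" unfolding P_def F_def by blast
    have "norm (exp u) < \<rho>" using exp_ball[OF u(1) \<rho>(1)] by simp
    then have "norm (exp u) ^ m < R" unfolding \<rho>(2)[symmetric] by (rule power_strict_mono) (use m in auto)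
    then have "x \<in> ball v R" using u(2) by (simp add: dist_norm norm_power)
    \<comment> \<open>The exponential never vanishes, so \<open>F\<close> avoids the centre, the
      only value in the disc that may be critical.\<close>
    moreover have "x \<noteq> v" using u(2) by simp
    ultimately show "x \<in> regular_values" using crit by (auto simp: v_def)
  qed
  define s where "s = min \<epsilon> \<rho>"
  have s: "s > 0" "s \<le> \<epsilon>" "s \<le> \<rho>" using \<epsilon> \<rho> by (auto simp: s_def)
  define P' where "P' = {u. Re u < ln s}"
  have "ln s \<le> ln \<rho>" using s \<rho> by simp
  then have "P' \<subseteq> P" unfolding P'_def P_def by auto
  then have P': "open P'" "convex P'" "P' \<subseteq> P"
    unfolding P'_def by (simp_all add: open_halfspace_Re_lt convex_halfspace_Re_lt)
  define p where "p = complex_of_real (ln s - 1)"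
  have p: "p \<in> P'" by (simp add: p_def P'_def)
  have pP: "p \<in> P" using p P'(3) by blast
  have expP': "exp u \<in> ball 0 \<epsilon>" if "u \<in> P'" for u
    using exp_ball[of u s] that s by (simp add: P'_def)
  have "\<psi> (exp p) \<in> \<H>" using up expP'[OF p] by blast
  then have Imp: "Im (\<psi> (exp p)) > 0" by simp
  have jp: "klein_j (\<psi> (exp p)) = F p" using j[OF expP'[OF p]] by (simp add: F_def v_def)
  obtain h where h: "h holomorphic_on P" "h ` P \<subseteq> \<H>" and jh: "\<And>u. u \<in> P \<Longrightarrow> klein_j (h u) = F u"
    and hp: "h p = \<psi> (exp p)"
    by (rule klein_j_lift[OF P F FS pP Imp jp]) (rule that)
  have \<psi>exp: "(\<lambda>u. \<psi> (exp u)) holomorphic_on P'"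
  proof -
    have "(\<psi> \<circ> exp) holomorphic_on P'"
      by (rule holomorphic_on_compose_gen[OF _ \<psi>(1)]) (use expP' in \<open>auto intro!: holomorphic_intros\<close>)
    then show ?thesis by (simp add: o_def)
  qed
  have h\<psi>: "h u = \<psi> (exp u)" if u: "u \<in> P'" for u
  proof (rule holomorphic_lifts_agree[where \<sigma> = h and \<tau> = "\<lambda>u. \<psi> (exp u)",
        OF P'(1) convex_connected[OF P'(2)] _ _ \<psi>exp _ _ p hp _ u])
    show "h holomorphic_on P'" by (rule holomorphic_on_subset[OF h(1) P'(3)])
    show "h ` P' \<subseteq> \<H>" using h(2) P'(3) by blast
    show "(\<lambda>u. \<psi> (exp u)) ` P' \<subseteq> \<H>" using up expP' by blast
    show "klein_j (h u) = klein_j (\<psi> (exp u))" if "u \<in> P'" for u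
    proof -
      have "u \<in> P" using that P'(3) by blast
      then show ?thesis using jh[of u] j[OF expP'[OF that]] by (simp add: F_def v_def)
    qed
    show "klein_j (h p) \<in> regular_values" using jh[OF pP] FS pP by auto
  qed
  have h_shift: "(\<lambda>u. h (u + 2 * of_real pi * \<i>)) holomorphic_on P"
  proof -
    have "(h \<circ> (\<lambda>u. u + 2 * of_real pi * \<i>)) holomorphic_on P"
      by (rule holomorphic_on_compose_gen[OF _ h(1)]) (auto intro!: holomorphic_intros simp: P_def)
    then show ?thesis by (simp add: o_def)
  qed
  have per: "h (u + 2 * of_real pi * \<i>) = h u" if u: "Re u < ln \<rho>" for u
  proof (rule analytic_continuation_open[OF P'(1) P(1) _ convex_connected[OF P(2)] P'(3) h_shift h(1)])
    show "P' \<noteq> {}" using p by blast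
    show "u \<in> P" using u by (simp add: P_def)
    fix z assume z: "z \<in> P'"
    have "z + 2 * of_real pi * \<i> \<in> P'" using z by (simp add: P'_def)
    then have "h (z + 2 * of_real pi * \<i>) = \<psi> (exp (z + 2 * of_real pi * \<i>))" by (rule h\<psi>)
    also have "exp (z + 2 * of_real pi * \<i>) = exp z" by (simp add: exp_add)
    finally show "h (z + 2 * of_real pi * \<i>) = h z" using h\<psi>[OF z] by simp
  qed
  define k0 where "k0 = (\<lambda>q. h (Ln q))"
  have k0: "k0 holomorphic_on ball 0 \<rho> - {0}"
    using periodic_factors_through_exp(1)[OF h(1)[unfolded P_def] per] \<rho>(1) by (simp add: k0_def)
  have Ln_P: "Ln q \<in> P" if "q \<in> ball 0 \<rho> - {0}" for q
    using that \<rho>(1) by (simp add: P_def)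
  have k0_eq: "k0 q = \<psi> q" if q: "q \<in> ball 0 s - {0}" for q
  proof -
    have "Ln q \<in> P'" using q s(1) by (simp add: P'_def)
    then have "k0 q = \<psi> (exp (Ln q))" unfolding k0_def by (rule h\<psi>)
    then show ?thesis using q by simp
  qed
  have "isCont \<psi> 0"
    using holomorphic_on_imp_continuous_on[OF \<psi>(1)] \<epsilon> by (simp add: continuous_on_eq_continuous_at)
  then have lim\<psi>: "\<psi> \<midarrow>0\<rightarrow> w" unfolding isCont_def \<psi>(2) .
  have lim: "k0 \<midarrow>0\<rightarrow> w"
    by (rule Lim_transform_within[OF lim\<psi> s(1)]) (use k0_eq in simp)
  define k where "k q = (if q = 0 then w else k0 q)" for q
  show ?thesis
  proof (rule that[OF m \<rho>])
    show "k holomorphic_on ball 0 \<rho>"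
      using removable_singularity[OF k0 open_ball lim] by (simp add: k_def[abs_def])
    show "k 0 = w" by (simp add: k_def)
    show "k ` ball 0 \<rho> \<subseteq> \<H>"
    proof
      fix x assume "x \<in> k ` ball 0 \<rho>"
      then obtain q where q: "q \<in> ball 0 \<rho>" "x = k q" by blast
      show "x \<in> \<H>"
      proof (cases "q = 0")
        case True
        then show ?thesis using w q by (simp add: k_def)
      next
        case False
        then have "Ln q \<in> P" using Ln_P q by blast
        then have "h (Ln q) \<in> \<H>" using h(2) by blast
        then show ?thesis using False q by (simp add: k_def k0_def)
      qed
    qed
    fix q :: complex assume q: "q \<in> ball 0 \<rho>"
    show "klein_j (k q) = klein_j w + q ^ m"
    proof (cases "q = 0")
      case True
      then show ?thesis using m by (simp add: k_def)
    next
      case False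
      then have "Ln q \<in> P" using Ln_P q by blast
      then have "klein_j (k q) = F (Ln q)" using jh False by (simp add: k_def k0_def)
      then show ?thesis using False by (simp add: F_def v_def)
    qed
  qed
qed

section \<open>The Schwarz lemma for inverse branches\<close>

text \<open>The squares of the two sides differ by 4 Im z Im w.\<close>

lemma cayley_norm_less:
  assumes "Im z > 0" "Im w > 0"
  shows "norm (z - w) < norm (z - cnj w)"
proof -
  have "(norm (z - w))\<^sup>2 < (norm (z - cnj w))\<^sup>2"
    unfolding cmod_power2 using assms by (simp add: power2_eq_square algebra_simps)
  then show ?thesis by (rule power2_less_imp_less) simp
qed

theorem klein_j_schwarz:
  assumes w: "Im w > 0" and R: "R > 0" and crit: "{0, 1728} \<inter> ball (klein_j w) R \<subseteq> {klein_j w}"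
    and x: "norm (x - klein_j w) < R"
  obtains z where "Im z > 0" "klein_j z = x"
    "(norm (z - w) / norm (z - cnj w)) ^ ramification (klein_j w) \<le> norm (x - klein_j w) / R"
proof -
  obtain m \<rho> k where m: "0 < m" "m \<le> ramification (klein_j w)" and \<rho>: "0 < \<rho>" "\<rho> ^ m = R"
    and k: "k holomorphic_on ball 0 \<rho>" "k 0 = w" "k ` ball 0 \<rho> \<subseteq> \<H>"
    and jk: "\<And>q. q \<in> ball 0 \<rho> \<Longrightarrow> klein_j (k q) = klein_j w + q ^ m"
    by (rule branched_lift[OF w R crit]) (rule that)
  obtain q where q: "q ^ m = x - klein_j w" using exists_nth_root[OF m(1)] by blast
  have nq: "norm q ^ m = norm (x - klein_j w)" unfolding q[symmetric] by (rule norm_power[symmetric])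
  have "norm q < \<rho>"
  proof (rule power_less_imp_less_base)
    show "norm q ^ m < \<rho> ^ m" using nq x \<rho>(2) by simp
  qed (use \<rho> in simp)
  then have qb: "q \<in> ball 0 \<rho>" by simp
  \<comment> \<open>The lift, rescaled to the unit disc and followed by the Cayley transform that
    sends \<open>w\<close> to 0.\<close>
  define f where "f \<xi> = (k (of_real \<rho> * \<xi>) - w) / (k (of_real \<rho> * \<xi>) - cnj w)" for \<xi>
  have sc: "of_real \<rho> * \<xi> \<in> ball 0 \<rho>" if "\<xi> \<in> ball 0 1" for \<xi> :: complex
    using that \<rho>(1) by (simp add: norm_mult)
  have kIm: "Im (k y) > 0" if "y \<in> ball 0 \<rho>" for y using k(3) that by blast
  have den: "k y - cnj w \<noteq> 0" if "y \<in> ball 0 \<rho>" for y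
  proof
    assume "k y - cnj w = 0"
    then have "Im (k y) = - Im w" by (simp add: complex_eq_iff)
    then show False using kIm[OF that] w by simp
  qed
  have "(\<lambda>\<xi>. k (of_real \<rho> * \<xi>)) holomorphic_on ball 0 1"
  proof -
    have "(k \<circ> (\<lambda>\<xi>. of_real \<rho> * \<xi>)) holomorphic_on ball 0 1"
      by (rule holomorphic_on_compose_gen[OF _ k(1)]) (use sc in \<open>auto intro!: holomorphic_intros\<close>)
    then show ?thesis by (simp add: o_def)
  qed
  then have holf: "f holomorphic_on ball 0 1"
    unfolding f_def using den sc by (intro holomorphic_intros) auto
  have f0: "f 0 = 0" by (simp add: f_def k(2))
  have f1: "norm (f \<xi>) < 1" if "norm \<xi> < 1" for \<xi>
  proof -
    have b: "of_real \<rho> * \<xi> \<in> ball 0 \<rho>" using sc that by simp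
    have "norm (k (of_real \<rho> * \<xi>) - w) < norm (k (of_real \<rho> * \<xi>) - cnj w)"
      by (rule cayley_norm_less[OF kIm[OF b] w])
    moreover have "norm (k (of_real \<rho> * \<xi>) - cnj w) > 0" using den[OF b] by simp
    ultimately show ?thesis by (simp add: f_def norm_divide)
  qed
  define \<xi> where "\<xi> = q / of_real \<rho>"
  have n\<xi>: "norm \<xi> = norm q / \<rho>" using \<rho>(1) by (simp add: \<xi>_def norm_divide)
  have "norm \<xi> < 1" using qb \<rho>(1) by (simp add: n\<xi>)
  from Schwarz_Lemma(1)[OF holf f0 f1 this] have S: "norm (f \<xi>) \<le> norm q / \<rho>" by (simp add: n\<xi>)
  have "of_real \<rho> * \<xi> = q" using \<rho>(1) by (simp add: \<xi>_def)
  then have fq: "norm (f \<xi>) = norm (k q - w) / norm (k q - cnj w)" by (simp add: f_def norm_divide)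
  define \<delta> where "\<delta> = norm (k q - w) / norm (k q - cnj w)"
  have \<delta>1: "\<delta> \<le> 1" unfolding \<delta>_def fq[symmetric] using f1[OF \<open>norm \<xi> < 1\<close>] by simp
  have \<delta>0: "\<delta> \<ge> 0" by (simp add: \<delta>_def)
  show ?thesis
  proof (rule that[of "k q"])
    show "Im (k q) > 0" by (rule kIm[OF qb])
    show "klein_j (k q) = x" using jk[OF qb] q by simp
    \<comment> \<open>Only \<open>m\<close> <= ramification is known; as \<delta> <= 1, the larger
      exponent gives the smaller power.\<close>
    have "\<delta> ^ ramification (klein_j w) \<le> \<delta> ^ m" by (rule power_decreasing[OF m(2) \<delta>0 \<delta>1])
    also have "\<dots> \<le> (norm q / \<rho>) ^ m" using S \<delta>0 unfolding fq \<delta>_def[symmetric] by (rule power_mono)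
    also have "\<dots> = norm (x - klein_j w) / R" by (simp add: power_divide nq \<rho>(2))
    finally show "(norm (k q - w) / norm (k q - cnj w)) ^ ramification (klein_j w) \<le> norm (x - klein_j w) / R"
      unfolding \<delta>_def .
  qed
qed

section \<open>Quadratic forms and singular moduli\<close>

definition has_form :: "complex \<Rightarrow> int \<Rightarrow> bool" where
  "has_form z D \<longleftrightarrow> (\<exists>A B C. A > 0 \<and> of_int A * z\<^sup>2 + of_int B * z + of_int C = 0 \<and> B\<^sup>2 - 4 * A * C = D)"

lemma form_root:
  assumes "Im z > 0" "of_int A * z\<^sup>2 + of_int B * z + of_int C = 0"
  shows "real_of_int B = - 2 * real_of_int A * Re z"
    "real_of_int C = real_of_int A * ((Re z)\<^sup>2 + (Im z)\<^sup>2)"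
    "real_of_int (4 * A * C - B\<^sup>2) = (2 * real_of_int A * Im z)\<^sup>2"
proof -
  have "Im (of_int A * z\<^sup>2 + of_int B * z + of_int C) = 0" "Re (of_int A * z\<^sup>2 + of_int B * z + of_int C) = 0"
    using assms(2) by simp_all
  then have im: "(2 * real_of_int A * Re z + real_of_int B) * Im z = 0"
    and re: "real_of_int A * ((Re z)\<^sup>2 - (Im z)\<^sup>2) + real_of_int B * Re z + real_of_int C = 0"
    by (simp_all add: power2_eq_square algebra_simps)
  have "2 * real_of_int A * Re z + real_of_int B = 0" using im assms(1) by simp
  then show B: "real_of_int B = - 2 * real_of_int A * Re z" by linarith
  show C: "real_of_int C = real_of_int A * ((Re z)\<^sup>2 + (Im z)\<^sup>2)"
    using re unfolding B by (simp add: power2_eq_square algebra_simps)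
  show "real_of_int (4 * A * C - B\<^sup>2) = (2 * real_of_int A * Im z)\<^sup>2"
    by (simp add: B C power2_eq_square algebra_simps)
qed

lemma has_form_negative:
  assumes "Im z > 0" "has_form z D"
  shows "D < 0"
proof -
  obtain A B C where f: "A > 0" "of_int A * z\<^sup>2 + of_int B * z + of_int C = 0" "B\<^sup>2 - 4 * A * C = D"
    using assms(2) unfolding has_form_def by blast
  have "(2 * real_of_int A * Im z)\<^sup>2 > 0" using f(1) assms(1) by simp
  then have "real_of_int (4 * A * C - B\<^sup>2) > 0" unfolding form_root(3)[OF assms(1) f(2)] .
  then have "4 * A * C - B\<^sup>2 > 0" by (simp only: of_int_0_less_iff)
  then show ?thesis using f(3) by linarith
qed

text \<open>Substituting the transformation into the form and clearing denominators gives an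
  integral form with root \<open>z\<close>, whose discriminant is multiplied by the squared
  determinant. The new leading coefficient A' is positive because 4 A A' = (2 A a + B c)^2 - D c^2
  with D negative.\<close>

lemma has_form_moebius:
  assumes z: "Im z > 0" and det: "a * d - b * c = (1::int)" and f: "has_form (moebius_int a b c d z) D"
  shows "has_form z D"
proof -
  define \<tau> where "\<tau> = moebius_int a b c d z"
  define n where "n = of_int a * z + of_int b"
  define \<alpha> where "\<alpha> = of_int c * z + of_int d"
  have \<tau>: "Im \<tau> > 0" unfolding \<tau>_def by (rule moebius_int_upper[OF det z])
  obtain A B C where f: "A > 0" "of_int A * \<tau>\<^sup>2 + of_int B * \<tau> + of_int C = 0" "B\<^sup>2 - 4 * A * C = D"
    using f unfolding has_form_def \<tau>_def by blast
  have "has_form \<tau> D" using f unfolding has_form_def by blast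
  then have D: "D < 0" by (rule has_form_negative[OF \<tau>])
  have \<alpha>0: "\<alpha> \<noteq> 0" unfolding \<alpha>_def by (rule moebius_denom_nonzero[OF det z])
  have \<tau>n: "\<tau> * \<alpha> = n" using \<alpha>0 by (simp add: \<tau>_def moebius_int_def n_def \<alpha>_def)
  have eq: "of_int A * n\<^sup>2 + of_int B * (n * \<alpha>) + of_int C * \<alpha>\<^sup>2 = 0"
  proof -
    have "of_int A * n\<^sup>2 + of_int B * (n * \<alpha>) + of_int C * \<alpha>\<^sup>2
        = (of_int A * \<tau>\<^sup>2 + of_int B * \<tau> + of_int C) * \<alpha>\<^sup>2"
      unfolding \<tau>n[symmetric] by (simp add: power2_eq_square algebra_simps)
    then show ?thesis using f(2) by simp
  qed
  define A' where "A' = A * a\<^sup>2 + B * a * c + C * c\<^sup>2"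
  define B' where "B' = 2 * A * a * b + B * (a * d + b * c) + 2 * C * c * d"
  define C' where "C' = A * b\<^sup>2 + B * b * d + C * d\<^sup>2"
  have "of_int A' * z\<^sup>2 + of_int B' * z + of_int C' = 0"
    using eq unfolding n_def \<alpha>_def A'_def B'_def C'_def by (simp add: power2_eq_square algebra_simps)
  moreover have "B'\<^sup>2 - 4 * A' * C' = D * (a * d - b * c)\<^sup>2"
    unfolding A'_def B'_def C'_def f(3)[symmetric] by (simp add: power2_eq_square algebra_simps)
  moreover have "A' > 0"
  proof -
    have 4: "4 * A * A' = (2 * A * a + B * c)\<^sup>2 - D * c\<^sup>2"
      unfolding A'_def f(3)[symmetric] by (simp add: power2_eq_square algebra_simps)
    have "4 * A * A' > 0"
    proof (cases "c = 0")
      case True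
      then have "a \<noteq> 0" using det by auto
      then show ?thesis unfolding 4 using True f(1) by simp
    next
      case False
      then have "D * c\<^sup>2 < 0" using D by (simp add: mult_neg_pos)
      moreover have "(2 * A * a + B * c)\<^sup>2 \<ge> 0" by simp
      ultimately show ?thesis unfolding 4 by linarith
    qed
    then show ?thesis using f(1) by (simp add: zero_less_mult_iff)
  qed
  ultimately show ?thesis unfolding has_form_def using det by auto
qed

text \<open>Transfers the discriminant to the unspecified preimage that the Schwarz lemma
  produces.\<close>

lemma has_form_klein_j_eq:
  assumes z: "Im z > 0" and w: "Im w > 0" and eq: "klein_j z = klein_j w" and f: "has_form w D"
  shows "has_form z D"
proof -
  obtain a b c d where g: "a * d - b * c = (1::int)" "w = moebius_int a b c d z"
    by (rule klein_j_eq_imp_equivalent[OF w z eq[symmetric]])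
  show ?thesis by (rule has_form_moebius[OF z g(1)]) (use f g(2) in simp)
qed

text \<open>With \<open>m\<close> the polar form of the two quadratic forms, \<open>cosh d(z, w) = m / sqrt (D E)\<close>, and the
  integer \<open>m\<^sup>2 - D E\<close> is positive and divisible by 4.\<close>

lemma form_distance:
  assumes z: "Im z > 0" "has_form z D" and w: "Im w > 0" "has_form w E" and ne: "z \<noteq> w"
  shows "1 / (real_of_int (D * E) + 2) \<le> (norm (z - w) / norm (z - cnj w))\<^sup>2"
proof -
  obtain A B C where f: "A > 0" "of_int A * z\<^sup>2 + of_int B * z + of_int C = 0" "B\<^sup>2 - 4 * A * C = D"
    using z(2) unfolding has_form_def by blast
  obtain A' B' C' where f': "A' > 0" "of_int A' * w\<^sup>2 + of_int B' * w + of_int C' = 0" "B'\<^sup>2 - 4 * A' * C' = E"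
    using w(2) unfolding has_form_def by blast
  note r = form_root[OF z(1) f(2)]
  note r' = form_root[OF w(1) f'(2)]
  define m where "m = 2 * A * C' + 2 * A' * C - B * B'"
  \<comment> \<open>Here s is the square root of D E. The factor \<open>N\<close> clears
    denominators: \<open>N\<close> times the squared distances from z to w and to its conjugate
    equals m - s and m + s.\<close>
  define s where "s = 4 * real_of_int A * real_of_int A' * Im z * Im w"
  define N where "N = 2 * real_of_int A * real_of_int A'"
  have N: "N > 0" using f(1) f'(1) by (simp add: N_def)
  have s: "s > 0" using f(1) f'(1) z(1) w(1) by (simp add: s_def)
  have DE: "real_of_int (D * E) = s\<^sup>2"
  proof -
    have "D * E = (4 * A * C - B\<^sup>2) * (4 * A' * C' - B'\<^sup>2)"
      unfolding f(3)[symmetric] f'(3)[symmetric] by (simp add: algebra_simps)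
    then have "real_of_int (D * E) = real_of_int (4 * A * C - B\<^sup>2) * real_of_int (4 * A' * C' - B'\<^sup>2)"
      by (simp only: of_int_mult)
    also have "\<dots> = s\<^sup>2" unfolding r(3) r'(3) s_def by (simp add: power2_eq_square)
    finally show ?thesis .
  qed
  have m: "real_of_int m = N * ((Re z - Re w)\<^sup>2 + (Im z)\<^sup>2 + (Im w)\<^sup>2)"
    unfolding m_def N_def of_int_diff of_int_add of_int_mult r(1,2) r'(1,2)
    by (simp add: power2_eq_square algebra_simps)
  have d1: "N * (norm (z - w))\<^sup>2 = m - s"
    unfolding m s_def cmod_power2 by (simp add: N_def power2_eq_square algebra_simps)
  have d2: "N * (norm (z - cnj w))\<^sup>2 = m + s"
    unfolding m s_def cmod_power2 by (simp add: N_def power2_eq_square algebra_simps)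
  have "N * (norm (z - w))\<^sup>2 > 0" using N ne by simp
  then have ms: "m > s" using d1 by simp
  have "s\<^sup>2 < (real_of_int m)\<^sup>2" using ms s by (intro power_strict_mono) auto
  then have "real_of_int (D * E) < real_of_int (m\<^sup>2)" unfolding DE by simp
  then have pos: "m\<^sup>2 - D * E > 0" by (simp only: of_int_less_iff)
  \<comment> \<open>Modulo 4 both terms are the square of B B'. A positive multiple of 4 is at least
    4.\<close>
  have "m\<^sup>2 - D * E = 4 * ((A * C' + A' * C)\<^sup>2 - (A * C' + A' * C) * B * B' - 4 * A * C * A' * C'
      + A * C * B'\<^sup>2 + A' * C' * B\<^sup>2)"
    unfolding m_def f(3)[symmetric] f'(3)[symmetric] by (simp add: power2_eq_square algebra_simps)
  then obtain k where k: "m\<^sup>2 - D * E = 4 * k" by blast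
  then have "k > 0" using pos by linarith
  then have "m\<^sup>2 \<ge> D * E + 4" using k by linarith
  then have "real_of_int (D * E + 4) \<le> real_of_int (m\<^sup>2)" by (simp only: of_int_le_iff)
  then have m2: "s\<^sup>2 + 4 \<le> (real_of_int m)\<^sup>2" using DE by simp
  \<comment> \<open>This is (m - s) / (m + s) >= 1 / (s^2 + 2) with denominators cleared. At m^2 =
    s^2 + 4 the squares of the two sides differ by exactly 4.\<close>
  have key: "s * (s\<^sup>2 + 3) \<le> m * (s\<^sup>2 + 1)"
  proof (rule power2_le_imp_le)
    have "(s * (s\<^sup>2 + 3))\<^sup>2 \<le> (s\<^sup>2 + 4) * (s\<^sup>2 + 1)\<^sup>2"
      by (simp add: power2_eq_square algebra_simps)
    also have "\<dots> \<le> (real_of_int m)\<^sup>2 * (s\<^sup>2 + 1)\<^sup>2" using m2 by (intro mult_right_mono) auto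
    finally show "(s * (s\<^sup>2 + 3))\<^sup>2 \<le> (m * (s\<^sup>2 + 1))\<^sup>2" by (simp add: power_mult_distrib)
    show "0 \<le> m * (s\<^sup>2 + 1)" using ms s by simp
  qed
  have "(norm (z - w) / norm (z - cnj w))\<^sup>2 = (N * (norm (z - w))\<^sup>2) / (N * (norm (z - cnj w))\<^sup>2)"
    using N by (simp add: power_divide)
  also have "\<dots> = (m - s) / (m + s)" unfolding d1 d2 ..
  finally have \<delta>: "(norm (z - w) / norm (z - cnj w))\<^sup>2 = (m - s) / (m + s)" .
  have "1 * (m + s) \<le> (m - s) * (s\<^sup>2 + 2)" using key by (simp add: algebra_simps)
  moreover have "s\<^sup>2 + 2 > 0" by (simp add: add_nonneg_pos)
  moreover have "m + s > 0" using ms s by linarith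
  ultimately show ?thesis unfolding \<delta> DE by (simp add: divide_simps mult.commute)
qed

text \<open>For a reduced root, |B| <= A <= C, hence 3 A C <= - D. If - D < 7, this leaves A = C = 1
  and |B| <= 1, whose roots are i, \<open>zeta6\<close> and its translate by -1.\<close>

lemma has_form_small:
  assumes z: "Im z > 0" "has_form z D"
  shows "D = - 3 \<and> klein_j z = 0 \<or> D = - 4 \<and> klein_j z = 1728 \<or> D \<le> - 7"
proof -
  obtain a b c d where g: "a * d - b * c = (1::int)"
    "\<bar>Re (moebius_int a b c d z)\<bar> \<le> 1 / 2" "1 \<le> norm (moebius_int a b c d z)"
    by (rule moebius_reduction[OF z(1)])
  define w where "w = moebius_int a b c d z"
  have w: "Im w > 0" unfolding w_def by (rule moebius_int_upper[OF g(1) z(1)])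
  have jw: "klein_j w = klein_j z" unfolding w_def by (rule klein_j_moebius[OF g(1) z(1)])
  have "has_form w D" by (rule has_form_klein_j_eq[OF w z(1) jw z(2)])
  then obtain A B C where f: "A > 0" "of_int A * w\<^sup>2 + of_int B * w + of_int C = 0" "B\<^sup>2 - 4 * A * C = D"
    unfolding has_form_def by blast
  note r = form_root[OF w f(2)]
  have "\<bar>real_of_int B\<bar> = 2 * A * \<bar>Re w\<bar>" unfolding r(1) using f(1) by (simp add: abs_mult)
  also have "\<dots> \<le> 2 * A * (1 / 2)" using g(2) f(1) unfolding w_def[symmetric] by (intro mult_left_mono) auto
  finally have BA: "\<bar>B\<bar> \<le> A" by linarith
  have "1\<^sup>2 \<le> (norm w)\<^sup>2" using g(3) unfolding w_def[symmetric] by (intro power_mono) auto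
  then have "1 \<le> (Re w)\<^sup>2 + (Im w)\<^sup>2" by (simp add: cmod_power2)
  then have "real_of_int A * 1 \<le> C" unfolding r(2) using f(1) by (intro mult_left_mono) auto
  then have AC: "A \<le> C" by simp
  have B2: "B\<^sup>2 \<le> A\<^sup>2" using BA by (metis abs_ge_zero power2_abs power_mono)
  have "A * A \<le> A * C" using AC f(1) by (intro mult_left_mono) auto
  then have X: "3 * (A * C) \<le> - D" using B2 f(3) by (simp add: power2_eq_square)
  have A2: "A * A \<le> A * C" by fact
  show ?thesis
  proof (cases "- D \<ge> 7")
    case True
    then show ?thesis by simp
  next
    case False
    then have "A * C \<le> 2" using X by linarith
    have "A = 1"
    proof (rule ccontr)
      assume "A \<noteq> 1"
      then have "A \<ge> 2" using f(1) by linarith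
      then have "2 * 2 \<le> A * A" by (intro mult_mono) auto
      then show False using A2 \<open>A * C \<le> 2\<close> by linarith
    qed
    then have C: "C = 1 \<or> C = 2" using AC \<open>A * C \<le> 2\<close> by auto
    have B: "B = - 1 \<or> B = 0 \<or> B = 1" using BA \<open>A = 1\<close> by auto
    \<comment> \<open>With C = 2 the discriminant would be -7 or -8.\<close>
    have C1: "C = 1"
      using C B False f(3) \<open>A = 1\<close> by auto
    have "4 * A * C - B\<^sup>2 = - D" using f(3) by linarith
    then have "real_of_int (- D) = (2 * real_of_int A * Im w)\<^sup>2" using r(3) by (simp only:)
    then have ri: "(Im w)\<^sup>2 = real_of_int (- D) / 4" "Re w = - real_of_int B / 2"
      using r(1) by (simp_all add: \<open>A = 1\<close> power_mult_distrib)
    have sq: "Im w = sqrt ((Im w)\<^sup>2)" using w by simp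
    from B consider "B = 0" | "B = - 1" | "B = 1" by blast
    then show ?thesis
    proof cases
      case 1
      have D: "D = - 4" using f(3) \<open>A = 1\<close> C1 1 by simp
      have "Im w = 1" using sq unfolding ri(1) D by simp
      then have "w = \<i>" using ri(2) 1 by (simp add: complex_eq_iff)
      then show ?thesis using D jw klein_j_i by simp
    next
      case 2
      have D: "D = - 3" using f(3) \<open>A = 1\<close> C1 2 by simp
      have "Im w = sqrt 3 / 2" using sq unfolding ri(1) D by (simp add: real_sqrt_divide)
      then have "w = zeta6" using ri(2) 2 by (simp add: complex_eq_iff zeta6_def)
      then show ?thesis using D jw klein_j_zeta6 by simp
    next
      case 3
      have D: "D = - 3" using f(3) \<open>A = 1\<close> C1 3 by simp
      have "Im w = sqrt 3 / 2" using sq unfolding ri(1) D by (simp add: real_sqrt_divide)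
      then have "moebius_int 1 1 0 1 w = zeta6" using ri(2) 3 by (simp add: complex_eq_iff zeta6_def moebius_int_def)
      moreover have "klein_j (moebius_int 1 1 0 1 w) = klein_j w" by (rule klein_j_moebius[OF _ w]) simp
      ultimately show ?thesis using D jw klein_j_zeta6 by simp
    qed
  qed
qed

lemma has_form_i: "has_form \<i> (- 4)"
  unfolding has_form_def by (intro exI[of _ 1] exI[of _ 0] exI[of _ 1]) simp

lemma has_form_zeta6: "has_form zeta6 (- 3)"
  unfolding has_form_def by (rule exI[of _ 1], rule exI[of _ "- 1"], rule exI[of _ 1]) (simp add: zeta6_sq)

section \<open>The discriminant of the multiplier ring\<close>

text \<open>A multiplier has the form m + n \<tau>, and sending \<tau> back into the lattice forces
  A to divide n B and n C. As A, B, C have no common factor, A divides n. Conversely A \<tau> is a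
  multiplier because A \<tau>^2 = - B \<tau> - C.\<close>

lemma multiplier_ring_tau:
  assumes \<tau>: "Im \<tau> > 0" and A: "A > 0" and root: "of_int A * \<tau>\<^sup>2 + of_int B * \<tau> + of_int C = 0"
    and prim: "gcd A (gcd B C) = (1::int)"
  shows "multiplier_ring (tau_lattice \<tau>) = int_span2 1 (of_int A * \<tau>)"
proof (intro equalityI subsetI)
  have Iw: "Im \<tau> \<noteq> 0" using \<tau> by simp
  fix \<alpha> assume \<alpha>: "\<alpha> \<in> multiplier_ring (tau_lattice \<tau>)"
  have mem: "\<alpha> * \<omega> \<in> tau_lattice \<tau>" if "\<omega> \<in> tau_lattice \<tau>" for \<omega>
    using \<alpha> that unfolding multiplier_ring_def by blast
  have "\<alpha> \<in> tau_lattice \<tau>" using mem[of 1] tau_latticeI[of 1 0 \<tau>] by simp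
  then obtain m n where mn: "\<alpha> = of_int m + of_int n * \<tau>" by (rule tau_latticeE)
  have "\<alpha> * \<tau> \<in> tau_lattice \<tau>" using mem[of \<tau>] tau_latticeI[of 0 1 \<tau>] by simp
  then obtain p q where pq: "\<alpha> * \<tau> = of_int p + of_int q * \<tau>" by (rule tau_latticeE)
  have rt: "of_int A * \<tau>\<^sup>2 = - of_int B * \<tau> - of_int C" using root by (simp add: algebra_simps eq_neg_iff_add_eq_0)
  have "of_int (A * p) + of_int (A * q) * \<tau> = of_int A * (\<alpha> * \<tau>)" unfolding pq by (simp add: algebra_simps)
  also have "\<dots> = of_int A * of_int m * \<tau> + of_int n * (of_int A * \<tau>\<^sup>2)"
    unfolding mn by (simp add: power2_eq_square algebra_simps)
  also have "\<dots> = of_int (- (n * C)) + of_int (A * m - n * B) * \<tau>"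
    unfolding rt by (simp add: algebra_simps)
  finally have "of_int (A * p) + of_int (A * q) * \<tau> = of_int (- (n * C)) + of_int (A * m - n * B) * \<tau>" .
  from lattice_coords_unique[OF Iw this] have "A * p = - (n * C)" "A * q = A * m - n * B" by simp_all
  then have "n * C = A * (- p)" "n * B = A * (m - q)" by (simp_all add: algebra_simps)
  then have "A dvd n * C" "A dvd n * B" by (metis dvd_triv_left)+
  then have "A dvd gcd (n * B) (n * C)" by simp
  also have "\<dots> = \<bar>n\<bar> * gcd B C" by (simp add: gcd_mult_left abs_mult)
  finally have "A dvd n"
    using prim by (simp add: coprime_dvd_mult_left_iff coprime_iff_gcd_eq_1)
  then obtain k where k: "n = A * k" ..
  have "\<alpha> = of_int m * 1 + of_int k * (of_int A * \<tau>)" unfolding mn k by simp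
  then show "\<alpha> \<in> int_span2 1 (of_int A * \<tau>)" unfolding int_span2_def by blast
next
  fix \<alpha> assume "\<alpha> \<in> int_span2 1 (of_int A * \<tau>)"
  then obtain m n where \<alpha>: "\<alpha> = of_int m * 1 + of_int n * (of_int A * \<tau>)" unfolding int_span2_def by blast
  have rt: "of_int A * \<tau>\<^sup>2 = - of_int B * \<tau> - of_int C" using root by (simp add: algebra_simps eq_neg_iff_add_eq_0)
  have "\<alpha> * \<omega> \<in> tau_lattice \<tau>" if \<omega>: "\<omega> \<in> tau_lattice \<tau>" for \<omega>
  proof -
    obtain p q where pq: "\<omega> = of_int p + of_int q * \<tau>" using \<omega> by (rule tau_latticeE)
    have "\<alpha> * \<omega> = of_int (m * p) + of_int (m * q + n * A * p) * \<tau> + of_int (n * q) * (of_int A * \<tau>\<^sup>2)"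
      unfolding \<alpha> pq by (simp add: power2_eq_square algebra_simps)
    also have "\<dots> = of_int (m * p - n * q * C) + of_int (m * q + n * A * p - n * q * B) * \<tau>"
      unfolding rt by (simp add: algebra_simps)
    finally show ?thesis by (simp only: tau_latticeI)
  qed
  then show "\<alpha> \<in> multiplier_ring (tau_lattice \<tau>)" unfolding multiplier_ring_def by blast
qed

text \<open>The discriminant is defined through some basis. Any other basis differs from 1, \<theta>
  by an integer matrix of determinant 1 or -1, which disappears on squaring.\<close>

lemma order_discriminant_unique:
  assumes "order_has_discriminant (int_span2 1 \<theta>) D" "Im \<theta> \<noteq> 0"
  shows "of_int D = (cnj \<theta> - \<theta>)\<^sup>2"
proof -
  obtain \<omega>1 \<omega>2 where R: "int_span2 1 \<theta> = int_span2 \<omega>1 \<omega>2" and D: "of_int D = (\<omega>1 * cnj \<omega>2 - \<omega>2 * cnj \<omega>1)\<^sup>2"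
    using assms(1) unfolding order_has_discriminant_def by blast
  have "\<omega>1 \<in> int_span2 \<omega>1 \<omega>2" "\<omega>2 \<in> int_span2 \<omega>1 \<omega>2"
    unfolding int_span2_def by (force intro: exI[of _ 1] exI[of _ 0])+
  then have "\<omega>1 \<in> int_span2 1 \<theta>" "\<omega>2 \<in> int_span2 1 \<theta>" unfolding R .
  then obtain p q r s where w: "\<omega>1 = of_int p + of_int q * \<theta>" "\<omega>2 = of_int r + of_int s * \<theta>"
    by (auto elim!: tau_latticeE)
  have "1 \<in> int_span2 1 \<theta>" "\<theta> \<in> int_span2 1 \<theta>" using tau_latticeI[of 1 0 \<theta>] tau_latticeI[of 0 1 \<theta>] by simp_all
  then have "1 \<in> int_span2 \<omega>1 \<omega>2" "\<theta> \<in> int_span2 \<omega>1 \<omega>2" unfolding R .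
  then obtain a b c d where e: "1 = of_int a * \<omega>1 + of_int b * \<omega>2" "\<theta> = of_int c * \<omega>1 + of_int d * \<omega>2"
    unfolding int_span2_def by blast
  have "of_int 1 + of_int 0 * \<theta> = of_int (a * p + b * r) + of_int (a * q + b * s) * \<theta>"
    using e(1) unfolding w by (simp add: algebra_simps)
  from lattice_coords_unique[OF assms(2) this] have 1: "a * p + b * r = 1" "a * q + b * s = 0" by simp_all
  have "of_int 0 + of_int 1 * \<theta> = of_int c * \<omega>1 + of_int d * \<omega>2" using e(2) by simp
  also have "\<dots> = of_int (c * p + d * r) + of_int (c * q + d * s) * \<theta>"
    unfolding w by (simp add: algebra_simps)
  finally have "of_int 0 + of_int 1 * \<theta> = of_int (c * p + d * r) + of_int (c * q + d * s) * \<theta>" .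
  from lattice_coords_unique[OF assms(2) this] have 2: "c * p + d * r = 0" "c * q + d * s = 1" by simp_all
  have "(a * d - b * c) * (p * s - q * r) = (a * p + b * r) * (c * q + d * s) - (a * q + b * s) * (c * p + d * r)"
    by (simp add: algebra_simps)
  then have "(a * d - b * c) * (p * s - q * r) = 1" using 1 2 by simp
  then have "(p * s - q * r) dvd 1" by (metis dvd_triv_right)
  then have "\<bar>p * s - q * r\<bar> = 1" by simp
  then have "(p * s - q * r)\<^sup>2 = 1" by (metis power2_abs one_power2)
  then have "(of_int (p * s - q * r))\<^sup>2 = (1 :: complex)" by (metis of_int_1 of_int_power)
  moreover have "\<omega>1 * cnj \<omega>2 - \<omega>2 * cnj \<omega>1 = of_int (p * s - q * r) * (cnj \<theta> - \<theta>)"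
    unfolding w by (simp add: algebra_simps)
  ultimately show ?thesis unfolding D by (simp add: power_mult_distrib)
qed

text \<open>For the primitive form A, B, C of \<tau> with A > 0 the order has basis 1, A \<tau>. Its
  discriminant is therefore -(2 A Im \<tau>)^2 = B^2 - 4 A C.\<close>

lemma singular_modulus_form:
  assumes "singular_modulus x D"
  obtains \<tau> where "Im \<tau> > 0" "klein_j \<tau> = x" "has_form \<tau> D"
proof -
  obtain \<tau> where \<tau>: "Im \<tau> > 0" "imaginary_quadratic \<tau>" "x = klein_j \<tau>"
    and ord: "order_has_discriminant (multiplier_ring (tau_lattice \<tau>)) D"
    using assms unfolding singular_modulus_def by blast
  obtain a b c :: int where abc: "a \<noteq> 0" "of_int a * \<tau>\<^sup>2 + of_int b * \<tau> + of_int c = 0"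
    using \<tau>(2) unfolding imaginary_quadratic_def by blast
  \<comment> \<open>Dividing by the content makes the form primitive; the sign makes its leading
    coefficient positive.\<close>
  define g where "g = sgn a * gcd a (gcd b c)"
  have g0: "g \<noteq> 0" using abc(1) by (simp add: g_def sgn_0_0)
  have gabs: "\<bar>g\<bar> = gcd a (gcd b c)" using abc(1) by (simp add: g_def abs_mult)
  have "gcd a (gcd b c) dvd a" "gcd a (gcd b c) dvd b" "gcd a (gcd b c) dvd c"
    by (auto intro: dvd_trans[OF gcd_dvd2])
  then have gd: "g dvd a" "g dvd b" "g dvd c" unfolding gabs[symmetric] by simp_all
  then obtain A B C where ABC: "a = g * A" "b = g * B" "c = g * C" unfolding dvd_def by blast
  have prim: "gcd A (gcd B C) = 1"
  proof -
    define h where "h = gcd A (gcd B C)"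
    have "h dvd A" "h dvd B" "h dvd C" unfolding h_def by (auto intro: dvd_trans[OF gcd_dvd2])
    then have "g * h dvd a" "g * h dvd b" "g * h dvd c" unfolding ABC by (simp_all add: mult_dvd_mono)
    then have "g * h dvd gcd a (gcd b c)" by simp
    then have "g * h dvd g * 1" unfolding gabs[symmetric] by simp
    then have "h dvd 1" unfolding dvd_mult_cancel_left using g0 by simp
    then show ?thesis unfolding h_def by simp
  qed
  have "A > 0"
  proof -
    have "sgn g = sgn a" using abc(1) by (simp add: g_def sgn_mult)
    moreover have "sgn a = sgn g * sgn A" unfolding ABC(1) by (rule sgn_mult)
    ultimately have "sgn g * sgn A = sgn g * 1" by simp
    then have "sgn A = 1" using g0 by (simp add: sgn_0_0)
    then show ?thesis by (simp add: sgn_1_pos)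
  qed
  have "of_int g * (of_int A * \<tau>\<^sup>2 + of_int B * \<tau> + of_int C) = 0"
    using abc(2) unfolding ABC by (simp add: algebra_simps)
  then have root: "of_int A * \<tau>\<^sup>2 + of_int B * \<tau> + of_int C = 0" using g0 by simp
  define \<theta> where "\<theta> = of_int A * \<tau>"
  have \<theta>: "Im \<theta> \<noteq> 0" using \<tau>(1) \<open>A > 0\<close> by (simp add: \<theta>_def)
  have "order_has_discriminant (int_span2 1 \<theta>) D"
    using ord unfolding multiplier_ring_tau[OF \<tau>(1) \<open>A > 0\<close> root prim] \<theta>_def .
  then have D: "of_int D = (cnj \<theta> - \<theta>)\<^sup>2" by (rule order_discriminant_unique[OF _ \<theta>])
  have "cnj \<theta> - \<theta> = - (2 * \<i> * of_real (A * Im \<tau>))"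
    by (simp add: complex_eq_iff \<theta>_def)
  then have "(cnj \<theta> - \<theta>)\<^sup>2 = - of_real ((2 * real_of_int A * Im \<tau>)\<^sup>2)"
    by (simp add: power_mult_distrib)
  also have "(2 * real_of_int A * Im \<tau>)\<^sup>2 = real_of_int (4 * A * C - B\<^sup>2)"
    by (rule form_root(3)[OF \<tau>(1) root, symmetric])
  also have "- complex_of_real (real_of_int (4 * A * C - B\<^sup>2)) = of_int (B\<^sup>2 - 4 * A * C)"
    by simp
  finally have "D = B\<^sup>2 - 4 * A * C" unfolding D[symmetric] by (simp only: of_int_eq_iff)
  then have "has_form \<tau> D" unfolding has_form_def using \<open>A > 0\<close> root by blast
  then show ?thesis using that \<tau> by blast
qed

section \<open>The quantitative separation\<close>

text \<open>With n the ramification and t the distance of the two values, the Schwarz lemma gives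
  \<delta>^n <= t / R, and the forms give \<delta>^2 >= 1 / (D E + 2). Raising the latter to the
  power n eliminates \<delta>. For t >= R the claim holds since D E + 2 >= 1.\<close>

lemma klein_j_separation:
  assumes w: "Im w > 0" "has_form w E" and \<tau>: "Im \<tau> > 0" "has_form \<tau> D"
    and ne: "klein_j \<tau> \<noteq> klein_j w"
    and R: "R > 0" and crit: "{0, 1728} \<inter> ball (klein_j w) R \<subseteq> {klein_j w}"
  shows "R\<^sup>2 \<le> (norm (klein_j \<tau> - klein_j w))\<^sup>2 * (real_of_int (D * E) + 2) ^ ramification (klein_j w)"
proof -
  define n where "n = ramification (klein_j w)"
  define t where "t = norm (klein_j \<tau> - klein_j w)"
  define S where "S = real_of_int (D * E) + 2"
  have "D * E > 0" using has_form_negative[OF w] has_form_negative[OF \<tau>] by (rule mult_neg_neg[rotated])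
  then have "real_of_int (D * E) > 0" by (simp only: of_int_0_less_iff)
  then have S: "S \<ge> 1" by (simp add: S_def)
  show ?thesis
  proof (cases "t < R")
    case False
    then have "R\<^sup>2 * 1 \<le> t\<^sup>2 * S ^ n" using R S by (intro mult_mono power_mono one_le_power) auto
    then show ?thesis by (simp add: t_def S_def n_def)
  next
    case True
    obtain z where z: "Im z > 0" "klein_j z = klein_j \<tau>"
      and Sch: "(norm (z - w) / norm (z - cnj w)) ^ ramification (klein_j w) \<le> norm (klein_j \<tau> - klein_j w) / R"
      by (rule klein_j_schwarz[OF w(1) R crit]) (use True in \<open>simp_all add: t_def\<close>)
    define \<delta> where "\<delta> = norm (z - w) / norm (z - cnj w)"
    have \<delta>0: "\<delta> \<ge> 0" by (simp add: \<delta>_def)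
    have "has_form z D" by (rule has_form_klein_j_eq[OF z(1) \<tau>(1) z(2) \<tau>(2)])
    moreover have "z \<noteq> w" using ne z(2) by auto
    ultimately have "1 / S \<le> \<delta>\<^sup>2"
      unfolding \<delta>_def S_def by (intro form_distance[OF z(1) _ w])
    then have "(1 / S) ^ n \<le> (\<delta>\<^sup>2) ^ n" using S by (intro power_mono) auto
    also have "\<dots> = (\<delta> ^ n)\<^sup>2" by (simp add: power_mult[symmetric] mult.commute)
    also have "\<dots> \<le> (t / R)\<^sup>2" using Sch \<delta>0 unfolding \<delta>_def[symmetric] n_def[symmetric] t_def[symmetric]
      by (intro power_mono) auto
    finally have "1 / S ^ n \<le> t\<^sup>2 / R\<^sup>2" by (simp add: power_divide)
    then have "R\<^sup>2 \<le> t\<^sup>2 * S ^ n" using R S by (simp add: divide_simps split: if_splits)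
    then show ?thesis by (simp add: t_def S_def n_def)
  qed
qed

text \<open>Separation from j(\<open>zeta6\<close>) = 0, where the discriminant is -3 and the
  ramification 3. The radius 1728 reaches up to the other critical value.\<close>

lemma klein_j_lower_bound:
  assumes "Im \<tau> > 0" "has_form \<tau> D" "klein_j \<tau> \<noteq> 0"
  shows "1728\<^sup>2 \<le> (norm (klein_j \<tau>))\<^sup>2 * (3 * real_of_int (- D) + 2) ^ 3"
proof -
  have "1728\<^sup>2 \<le> (norm (klein_j \<tau> - klein_j zeta6))\<^sup>2 * (real_of_int (D * (- 3)) + 2) ^ ramification (klein_j zeta6)"
  proof (rule klein_j_separation[OF Im_zeta6 has_form_zeta6 assms(1,2)])
    show "klein_j \<tau> \<noteq> klein_j zeta6" using assms(3) by (simp add: klein_j_zeta6)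
    show "{0, 1728} \<inter> ball (klein_j zeta6) 1728 \<subseteq> {klein_j zeta6}" by (simp add: klein_j_zeta6)
  qed simp
  then show ?thesis by (simp add: klein_j_zeta6 ramification_def mult.commute)
qed

text \<open>Separation from j(i) = 1728, where the discriminant is -4 and the ramification 2; the
  other critical value is 0, again at distance 1728.\<close>

lemma klein_j_minus_1728_lower_bound:
  assumes "Im \<tau> > 0" "has_form \<tau> D" "klein_j \<tau> \<noteq> 1728"
  shows "1728\<^sup>2 \<le> (norm (klein_j \<tau> - 1728))\<^sup>2 * (4 * real_of_int (- D) + 2) ^ 2"
proof -
  have "1728\<^sup>2 \<le> (norm (klein_j \<tau> - klein_j \<i>))\<^sup>2 * (real_of_int (D * (- 4)) + 2) ^ ramification (klein_j \<i>)"
  proof (rule klein_j_separation[OF _ has_form_i assms(1,2)])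
    show "klein_j \<tau> \<noteq> klein_j \<i>" using assms(3) by (simp add: klein_j_i)
    show "{0, 1728} \<inter> ball (klein_j \<i>) 1728 \<subseteq> {klein_j \<i>}" by (simp add: klein_j_i dist_norm)
  qed simp_all
  then show ?thesis by (simp add: klein_j_i ramification_def mult.commute)
qed

text \<open>Isolates the passage from squares to the final bound, so that each case only has to
  compare its factor \<open>K\<close> with X^6.\<close>

lemma separation_from_squares:
  fixes t X K :: real
  assumes X: "X > 0" and t: "t \<ge> 0" and 1: "1728\<^sup>2 \<le> t\<^sup>2 * K" and 2: "700\<^sup>2 * K \<le> 1728\<^sup>2 * X ^ 6"
  shows "700 / X ^ 3 \<le> t"
proof -
  have "K > 0"
  proof (rule ccontr)
    assume "\<not> K > 0"
    then have "t\<^sup>2 * K \<le> 0" by (simp add: mult_nonneg_nonpos)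
    then show False using 1 by simp
  qed
  have "700\<^sup>2 * 1728\<^sup>2 \<le> 700\<^sup>2 * (t\<^sup>2 * K)" using 1 by (intro mult_left_mono) auto
  also have "\<dots> = t\<^sup>2 * (700\<^sup>2 * K)" by simp
  also have "\<dots> \<le> t\<^sup>2 * (1728\<^sup>2 * X ^ 6)" using 2 by (intro mult_left_mono) auto
  finally have "700\<^sup>2 \<le> t\<^sup>2 * X ^ 6" by simp
  also have "\<dots> = (t * X ^ 3)\<^sup>2" by (simp add: power_mult_distrib power_mult[symmetric])
  finally have "700 \<le> t * X ^ 3" by (rule power2_le_imp_le) (use t X in simp)
  then show ?thesis using X by (simp add: divide_simps)
qed

theorem singular_moduli_separation:
  assumes x: "singular_modulus x \<Delta>x" and y: "singular_modulus y \<Delta>y" and ne: "x \<noteq> y"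
    and le: "\<bar>\<Delta>x\<bar> \<ge> \<bar>\<Delta>y\<bar>"
  shows "700 / real_of_int \<bar>\<Delta>x\<bar> ^ 3 \<le> cmod (x - y)"
proof -
  obtain z where z: "Im z > 0" "klein_j z = x" "has_form z \<Delta>x" using x by (rule singular_modulus_form)
  obtain w where w: "Im w > 0" "klein_j w = y" "has_form w \<Delta>y" using y by (rule singular_modulus_form)
  define X where "X = real_of_int (- \<Delta>x)"
  define Y where "Y = real_of_int (- \<Delta>y)"
  have neg: "\<Delta>x < 0" "\<Delta>y < 0" using has_form_negative z(1,3) w(1,3) by blast+
  have absX: "real_of_int \<bar>\<Delta>x\<bar> = X" using neg by (simp add: X_def)
  have "- \<Delta>y \<le> - \<Delta>x" using le neg by linarith
  then have YX: "Y \<le> X" unfolding X_def Y_def by (simp only: of_int_le_iff)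
  have "\<Delta>x \<le> - 3" using has_form_small[OF z(1,3)] by auto
  then have X3: "X \<ge> 3" by (simp add: X_def)
  have XX: "X * X > 0" "X > 0" using X3 by simp_all
  have mono: "X ^ n \<ge> 3 ^ n" for n using X3 by (intro power_mono) auto
  show ?thesis
    unfolding absX
  proof (cases "y = 0")
    case True
    have "1728\<^sup>2 \<le> (cmod (x - y))\<^sup>2 * (3 * X + 2) ^ 3"
      using klein_j_lower_bound[OF z(1,3)] z(2) ne True by (simp add: X_def)
    then show "700 / X ^ 3 \<le> cmod (x - y)"
    proof (rule separation_from_squares[OF XX(2) norm_ge_zero])
      \<comment> \<open>Since X >= 3, 2 <= 2/3 X.\<close>
      have "(3 * X + 2) ^ 3 \<le> (11 / 3 * X) ^ 3" using X3 by (intro power_mono) auto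
      also have "\<dots> = (11 / 3) ^ 3 * X ^ 3" by (rule power_mult_distrib)
      finally have "700\<^sup>2 * (3 * X + 2) ^ 3 \<le> (700\<^sup>2 * (11 / 3) ^ 3) * X ^ 3" by simp
      also have "\<dots> \<le> (1728\<^sup>2 * 3 ^ 3) * X ^ 3" using X3 by (intro mult_right_mono) (auto simp: power_divide)
      also have "\<dots> \<le> (1728\<^sup>2 * X ^ 3) * X ^ 3" using mono[of 3] X3 by (intro mult_right_mono mult_left_mono) auto
      also have "\<dots> = 1728\<^sup>2 * X ^ 6" by (simp add: power_add[symmetric])
      finally show "700\<^sup>2 * (3 * X + 2) ^ 3 \<le> 1728\<^sup>2 * X ^ 6" .
    qed
  next
    case y0: False
    show "700 / X ^ 3 \<le> cmod (x - y)"
    proof (cases "y = 1728")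
      case True
      have "1728\<^sup>2 \<le> (cmod (x - y))\<^sup>2 * (4 * X + 2) ^ 2"
        using klein_j_minus_1728_lower_bound[OF z(1,3)] z(2) ne True by (simp add: X_def)
      then show ?thesis
      proof (rule separation_from_squares[OF XX(2) norm_ge_zero])
        \<comment> \<open>Again 2 <= 2/3 X.\<close>
        have "(4 * X + 2) ^ 2 \<le> (14 / 3 * X) ^ 2" using X3 by (intro power_mono) auto
        also have "\<dots> = (14 / 3) ^ 2 * X ^ 2" by (rule power_mult_distrib)
        finally have "700\<^sup>2 * (4 * X + 2) ^ 2 \<le> (700\<^sup>2 * (14 / 3) ^ 2) * X ^ 2" by simp
        also have "\<dots> \<le> (1728\<^sup>2 * 3 ^ 4) * X ^ 2" using X3 by (intro mult_right_mono) (auto simp: power_divide)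
        also have "\<dots> \<le> (1728\<^sup>2 * X ^ 4) * X ^ 2" using mono[of 4] X3 by (intro mult_right_mono mult_left_mono) auto
        also have "\<dots> = 1728\<^sup>2 * X ^ 6" by (simp add: power_add[symmetric])
        finally show "700\<^sup>2 * (4 * X + 2) ^ 2 \<le> 1728\<^sup>2 * X ^ 6" .
      qed
    next
      case y1: False
      have "\<Delta>y \<le> - 7" using has_form_small[OF w(1,3)] w(2) y0 y1 by auto
      then have Y7: "Y \<ge> 7" by (simp add: Y_def)
      then have X7: "X \<ge> 7" using YX by linarith
      \<comment> \<open>The distance from \<open>y\<close> to the nearer critical value: the largest
        disc around \<open>y\<close> over which \<open>j\<close> is unramified.\<close>
      define R where "R = min (cmod y) (cmod (y - 1728))"
      have R: "R > 0" using y0 y1 by (simp add: R_def)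
      have crit: "{0, 1728} \<inter> ball (klein_j w) R \<subseteq> {klein_j w}"
        unfolding w(2) by (auto simp: R_def dist_norm)
      have ram: "ramification (klein_j w) = 1" using w(2) y0 y1 by (simp add: ramification_def)
      have sep: "R\<^sup>2 \<le> (cmod (x - y))\<^sup>2 * (X * Y + 2)"
        using klein_j_separation[OF w(1,3) z(1,3) _ R crit] ne z(2) w(2) ram by (simp add: X_def Y_def)
      have "X * Y \<le> X * X" using YX X7 by (intro mult_left_mono) auto
      moreover have "7 * 7 \<le> X * X" using X7 by (intro mult_mono) auto
      \<comment> \<open>The constant is 1 + 2/49, from X^2 >= 49.\<close>
      ultimately have XY: "X * Y + 2 \<le> 51 / 49 * X ^ 2" by (simp add: power2_eq_square)
      have XY0: "X * Y + 2 \<ge> 0" using X7 Y7 by simp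
      \<comment> \<open>\<open>K\<close> measures how close \<open>y\<close> comes to a critical
        value. The bound 36 X^3 covers both critical values and leaves a total of order X^5; the
        missing factor X >= 7 pays for the constants.\<close>
      have fin: "700 / X ^ 3 \<le> cmod (x - y)"
        if K: "1728\<^sup>2 \<le> R\<^sup>2 * K" "K \<ge> 0" "K \<le> 36 * X ^ 3" for K
      proof (rule separation_from_squares[OF XX(2) norm_ge_zero])
        have "1728\<^sup>2 \<le> R\<^sup>2 * K" by fact
        also have "\<dots> \<le> ((cmod (x - y))\<^sup>2 * (X * Y + 2)) * K" by (intro mult_right_mono sep K)
        finally show "1728\<^sup>2 \<le> (cmod (x - y))\<^sup>2 * ((X * Y + 2) * K)" by (simp add: mult.assoc)
        have "(X * Y + 2) * K \<le> (51 / 49 * X ^ 2) * (36 * X ^ 3)"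
          using XY XY0 K X7 by (intro mult_mono) auto
        also have "\<dots> = (51 / 49 * 36) * X ^ 5" by (simp add: power_add[symmetric])
        finally have "700\<^sup>2 * ((X * Y + 2) * K) \<le> 700\<^sup>2 * ((51 / 49 * 36) * X ^ 5)"
          by (rule mult_left_mono) simp
        also have "\<dots> = (700\<^sup>2 * (51 / 49 * 36)) * X ^ 5" by simp
        also have "\<dots> \<le> (1728\<^sup>2 * 7) * X ^ 5" using X7 by (intro mult_right_mono) auto
        also have "\<dots> \<le> (1728\<^sup>2 * X) * X ^ 5" using X7 by (intro mult_right_mono mult_left_mono) auto
        also have "\<dots> = 1728\<^sup>2 * X ^ 6" by (simp add: power_Suc[symmetric])
        finally show "700\<^sup>2 * ((X * Y + 2) * K) \<le> 1728\<^sup>2 * X ^ 6" .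
      qed
      show ?thesis
      proof (cases "cmod y \<le> cmod (y - 1728)")
        case True
        then have R: "R = cmod y" by (simp add: R_def)
        show ?thesis
        proof (rule fin)
          show "1728\<^sup>2 \<le> R\<^sup>2 * (3 * Y + 2) ^ 3"
            unfolding R using klein_j_lower_bound[OF w(1,3)] w(2) y0 by (simp add: Y_def)
          show "(3 * Y + 2) ^ 3 \<ge> 0" using Y7 by simp
          \<comment> \<open>Here 2 <= 2/7 X, and (23/7)^3 is just below 36.\<close>
          have "(3 * Y + 2) ^ 3 \<le> (23 / 7 * X) ^ 3" using Y7 X7 YX by (intro power_mono) auto
          also have "\<dots> = (23 / 7) ^ 3 * X ^ 3" by (rule power_mult_distrib)
          also have "\<dots> \<le> 36 * X ^ 3" using X7 by (intro mult_right_mono) (auto simp: power_divide)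
          finally show "(3 * Y + 2) ^ 3 \<le> 36 * X ^ 3" .
        qed
      next
        case False
        then have R: "R = cmod (y - 1728)" by (simp add: R_def)
        show ?thesis
        proof (rule fin)
          show "1728\<^sup>2 \<le> R\<^sup>2 * (4 * Y + 2) ^ 2"
            unfolding R using klein_j_minus_1728_lower_bound[OF w(1,3)] w(2) y1 by (simp add: Y_def)
          show "(4 * Y + 2) ^ 2 \<ge> 0" by simp
          \<comment> \<open>Again 2 <= 2/7 X; the exponent 2 leaves a whole factor X to
            spare.\<close>
          have "(4 * Y + 2) ^ 2 \<le> (30 / 7 * X) ^ 2" using Y7 X7 YX by (intro power_mono) auto
          also have "\<dots> = ((30 / 7) ^ 2 * 1) * X ^ 2" by (simp only: power_mult_distrib mult_1_right)
          also have "\<dots> \<le> (36 * X) * X ^ 2" using X7 by (intro mult_right_mono mult_mono) (auto simp: power2_eq_square)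
          also have "\<dots> = 36 * X ^ 3" by (simp add: power2_eq_square power3_eq_cube)
          finally show "(4 * Y + 2) ^ 2 \<le> 36 * X ^ 3" .
        qed
      qed
    qed
  qed
qed

theorem theorem6p1:
  fixes x y :: complex and \<Delta>x \<Delta>y :: int
  assumes "singular_modulus x \<Delta>x"
    and "singular_modulus y \<Delta>y"
    and "x \<noteq> y"
    and "\<bar>\<Delta>x\<bar> \<ge> \<bar>\<Delta>y\<bar>"
  shows "cmod (x - y) \<ge> Min {800 * real_of_int \<bar>\<Delta>y\<bar> powi (-4),
           20000 * real_of_int \<bar>\<Delta>x\<bar> powi (-1) * real_of_int \<bar>\<Delta>y\<bar> powi (-3),
           700 * real_of_int \<bar>\<Delta>x\<bar> powi (-3)}"
proof -
  have "Min {800 * real_of_int \<bar>\<Delta>y\<bar> powi (-4),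
           20000 * real_of_int \<bar>\<Delta>x\<bar> powi (-1) * real_of_int \<bar>\<Delta>y\<bar> powi (-3),
           700 * real_of_int \<bar>\<Delta>x\<bar> powi (-3)} \<le> 700 * real_of_int \<bar>\<Delta>x\<bar> powi (-3)"
    by (rule Min_le) simp_all
  also have "\<dots> = 700 / real_of_int \<bar>\<Delta>x\<bar> ^ 3"
    by (simp add: power_int_minus field_simps)
  also have "\<dots> \<le> cmod (x - y)" by (rule singular_moduli_separation[OF assms])
  finally show ?thesis .
qed

end
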